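(* Let $\Gamma$ be a group with two ends, marked by a finite symmetric generating set $S$ with $1_\Gamma \notin S$ and $|S| = d$. Let $G$ be the shift graph of $(\Gamma, S)$, so that $G$ is a $d$-regular Borel graph. Then $\chi'_B(G) \leq d+1$; that is, $G$ admits a Borel edge coloring with $d+1$ colors.
   Context: A marked group is a finitely generated group $\Gamma$ together with a fixed finite generating set $S$, here taken to be symmetric ($S = S^{-1}$) and not containing the identity; the number of generators means $|S|$. A finitely generated group has two ends if its Cayley graph (with respect to any finite generating set) has exactly two ends. Shift graph: let $\Gamma$ act on the compact space $2^\Gamma = \{0,1\}^\Gamma$ by the left shift $(\gamma \cdot x)(\delta) = x(\gamma^{-1}\delta)$, and let $X = \{x \in 2^\Gamma : \gamma \cdot x \neq x \text{ for all } \gamma \in \Gamma \setminus \{1_\Gamma\}\}$ be the free part of this action, a standard Borel space. The shift graph of $(\Gamma, S)$ is the simple graph with vertex set $X$ in which $x, y \in X$ are adjacent if and only if $y = \gamma \cdot x$ for some $\gamma \in S$. For a graph $G$ on a set $X$, a $k$-edge coloring is a function assigning to each edge one of $k$ colors such that any two distinct edges incident on a common vertex receive different colors. If $X$ is a standard Borel space and $G$ is a Borel graph on $X$ (its edge relation is a Borel subset of $X \times X$), the Borel edge chromatic number $\chi'_B(G)$ is the smallest cardinal $k$ such that $G$ has a $k$-edge coloring which is Borel as a function on the edges (equivalently, as a symmetric function on the edge relation, a Borel subset of $X\times X$). *)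

theory Defs
  imports
    "HOL-Analysis.Analysis"
    "HOL-Library.Extended_Nat"
    "HOL-Algebra.Generated_Groups"
begin

section \<open>Marked groups and their Cayley graphs\<close>

text \<open>A graph is given by its adjacency relation, a symmetric irreflexive set of ordered pairs.\<close>

locale marked_group = group G for G (structure) +
  fixes S :: "'a set"
  assumes finite_gens: "finite S"
    and gens_subset: "S \<subseteq> carrier G"
    and gens_symmetric: "(\<lambda>s. inv s) ` S = S"
    and one_notin_gens: "\<one> \<notin> S"
    and generate_gens: "generate G S = carrier G"

definition cayley_graph :: "('a, 'b) monoid_scheme \<Rightarrow> 'a set \<Rightarrow> ('a \<times> 'a) set" where
  "cayley_graph G S = {(g, g \<otimes>\<^bsub>G\<^esub> s) | g s. g \<in> carrier G \<and> s \<in> S}"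

section \<open>Ends of a graph\<close>

text \<open>
  Ends are equivalence classes of rays (one-way infinite simple paths), where two rays are
  equivalent if for every finite set \<open>F\<close> of vertices they have tails in the same component of the
  graph with \<open>F\<close> removed.
\<close>

definition rays :: "('v \<times> 'v) set \<Rightarrow> (nat \<Rightarrow> 'v) set" where
  "rays E = {r. inj r \<and> (\<forall>n. (r n, r (Suc n)) \<in> E)}"

definition same_component_avoiding :: "('v \<times> 'v) set \<Rightarrow> 'v set \<Rightarrow> 'v \<Rightarrow> 'v \<Rightarrow> bool" where
  "same_component_avoiding E F u v \<longleftrightarrow>
     u \<notin> F \<and> v \<notin> F \<and> (u, v) \<in> (E \<inter> (- F) \<times> (- F))\<^sup>*"

definition ray_equiv :: "('v \<times> 'v) set \<Rightarrow> ((nat \<Rightarrow> 'v) \<times> (nat \<Rightarrow> 'v)) set" where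
  "ray_equiv E = {(r, r'). r \<in> rays E \<and> r' \<in> rays E \<and>
     (\<forall>F. finite F \<longrightarrow> (\<exists>N. \<forall>i\<ge>N. \<forall>j\<ge>N. same_component_avoiding E F (r i) (r' j)))}"

definition ends :: "('v \<times> 'v) set \<Rightarrow> (nat \<Rightarrow> 'v) set set" where
  "ends E = rays E // ray_equiv E"

section \<open>Borel edge colorings\<close>

definition edges :: "('v \<times> 'v) set \<Rightarrow> 'v set set" where
  "edges E = {{x, y} | x y. (x, y) \<in> E}"

definition edge_coloring :: "('v \<times> 'v) set \<Rightarrow> nat \<Rightarrow> ('v set \<Rightarrow> nat) \<Rightarrow> bool" where
  "edge_coloring E k c \<longleftrightarrow>
     (\<forall>e \<in> edges E. c e < k) \<and>
     (\<forall>e \<in> edges E. \<forall>e' \<in> edges E. e \<noteq> e' \<and> e \<inter> e' \<noteq> {} \<longrightarrow> c e \<noteq> c e')"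

text \<open>
  The vertex set is the underlying space of \<open>M\<close>, whose measurable sets are the Borel sets; the
  measure carried by \<open>M\<close> is irrelevant.
\<close>

definition borel_edge_coloring ::
    "'v measure \<Rightarrow> ('v \<times> 'v) set \<Rightarrow> nat \<Rightarrow> ('v set \<Rightarrow> nat) \<Rightarrow> bool" where
  "borel_edge_coloring M E k c \<longleftrightarrow>
     edge_coloring E k c \<and>
     (\<lambda>(x, y). c {x, y}) \<in> measurable (restrict_space (M \<Otimes>\<^sub>M M) E) (count_space {..<k})"

text \<open>All infinite values of the Borel edge chromatic number are identified with \<open>\<infinity>\<close>.\<close>

definition borel_edge_chromatic_number :: "'v measure \<Rightarrow> ('v \<times> 'v) set \<Rightarrow> enat" where
  "borel_edge_chromatic_number M E = Inf {enat k | k. \<exists>c. borel_edge_coloring M E k c}"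

section \<open>The shift graph\<close>

definition borel_of_topology :: "'x topology \<Rightarrow> 'x measure" where
  "borel_of_topology T = sigma (topspace T) {U. openin T U}"

text \<open>Elements of the shift space are extensional: they are \<open>undefined\<close> outside the carrier.\<close>

definition shift_topology :: "('a, 'b) monoid_scheme \<Rightarrow> ('a \<Rightarrow> bool) topology" where
  "shift_topology G = product_topology (\<lambda>_. discrete_topology UNIV) (carrier G)"

definition shift :: "('a, 'b) monoid_scheme \<Rightarrow> 'a \<Rightarrow> ('a \<Rightarrow> bool) \<Rightarrow> ('a \<Rightarrow> bool)" where
  "shift G \<gamma> x = (\<lambda>\<delta>\<in>carrier G. x (inv\<^bsub>G\<^esub> \<gamma> \<otimes>\<^bsub>G\<^esub> \<delta>))"

definition free_part :: "('a, 'b) monoid_scheme \<Rightarrow> ('a \<Rightarrow> bool) set" where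
  "free_part G = {x \<in> topspace (shift_topology G). \<forall>\<gamma> \<in> carrier G - {\<one>\<^bsub>G\<^esub>}. shift G \<gamma> x \<noteq> x}"

definition free_part_space :: "('a, 'b) monoid_scheme \<Rightarrow> ('a \<Rightarrow> bool) measure" where
  "free_part_space G = restrict_space (borel_of_topology (shift_topology G)) (free_part G)"

definition shift_graph ::
    "('a, 'b) monoid_scheme \<Rightarrow> 'a set \<Rightarrow> (('a \<Rightarrow> bool) \<times> ('a \<Rightarrow> bool)) set" where
  "shift_graph G S =
     {(x, y). x \<in> free_part G \<and> y \<in> free_part G \<and> (\<exists>\<gamma> \<in> S. y = shift G \<gamma> x)}"

section \<open>Basic properties\<close>

lemma sym_same_component_avoiding:
  assumes "sym E" "same_component_avoiding E F u v"
  shows "same_component_avoiding E F v u"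
proof -
  have "sym (E \<inter> (- F) \<times> (- F))"
    using assms(1) by (auto simp: sym_def)
  then have "sym ((E \<inter> (- F) \<times> (- F))\<^sup>*)"
    by (rule sym_rtrancl)
  then show ?thesis
    using assms(2) unfolding same_component_avoiding_def by (iprover dest: symD)
qed

lemma ray_equivD:
  assumes "(r, r') \<in> ray_equiv E" "finite F"
  shows "\<exists>N. \<forall>i\<ge>N. \<forall>j\<ge>N. same_component_avoiding E F (r i) (r' j)"
  using assms by (simp add: ray_equiv_def)

lemma equiv_ray_equiv:
  assumes "sym E"
  shows "equiv (rays E) (ray_equiv E)"
proof (rule equivI)
  show "ray_equiv E \<subseteq> rays E \<times> rays E"
    by (auto simp: ray_equiv_def)
  show "sym (ray_equiv E)"
  proof (rule symI)
    fix r s assume rs: "(r, s) \<in> ray_equiv E"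
    have "\<exists>N. \<forall>i\<ge>N. \<forall>j\<ge>N. same_component_avoiding E F (s i) (r j)" if fin: "finite F" for F
    proof -
      obtain N where "\<forall>i\<ge>N. \<forall>j\<ge>N. same_component_avoiding E F (r i) (s j)"
        using ray_equivD[OF rs fin] by blast
      then show ?thesis
        by (intro exI[of _ N] allI impI) (rule sym_same_component_avoiding[OF assms], simp)
    qed
    then show "(s, r) \<in> ray_equiv E"
      using rs by (simp add: ray_equiv_def)
  qed
  show "trans (ray_equiv E)"
  proof (rule transI)
    fix r s t
    assume rs: "(r, s) \<in> ray_equiv E" and st: "(s, t) \<in> ray_equiv E"
    have "\<exists>N. \<forall>i\<ge>N. \<forall>j\<ge>N. same_component_avoiding E F (r i) (t j)" if fin: "finite F" for F
    proof -
      obtain M where M: "\<forall>i\<ge>M. \<forall>j\<ge>M. same_component_avoiding E F (r i) (s j)"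
        using ray_equivD[OF rs fin] by blast
      obtain N where N: "\<forall>i\<ge>N. \<forall>j\<ge>N. same_component_avoiding E F (s i) (t j)"
        using ray_equivD[OF st fin] by blast
      have "same_component_avoiding E F (r i) (t j)" if "i \<ge> max M N" "j \<ge> max M N" for i j
      proof -
        have "same_component_avoiding E F (r i) (s (max M N))"
          "same_component_avoiding E F (s (max M N)) (t j)"
          using that M N by auto
        then show ?thesis
          by (auto simp: same_component_avoiding_def intro: rtrancl_trans)
      qed
      then show ?thesis by blast
    qed
    then show "(r, t) \<in> ray_equiv E"
      using rs st by (simp add: ray_equiv_def)
  qed
  show "refl_on (rays E) (ray_equiv E)"
  proof (rule refl_onI)
    fix r assume r: "r \<in> rays E"
    have "\<exists>N. \<forall>i\<ge>N. \<forall>j\<ge>N. same_component_avoiding E F (r i) (r j)" if F: "finite F" for F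
    proof -
      have "finite (r -` F)"
        using r F by (auto simp: rays_def intro: finite_vimageI)
      then obtain N where N: "\<forall>i \<in> r -` F. i < N"
        using finite_nat_set_iff_bounded by blast
      have nF: "r i \<notin> F" if "i \<ge> N" for i
        using N that by (meson leD vimageI)
      have up: "same_component_avoiding E F (r i) (r j)" if "N \<le> i" "i \<le> j" for i j
        using that(2)
      proof (induction rule: dec_induct)
        case base
        then show ?case using nF[OF that(1)] by (simp add: same_component_avoiding_def)
      next
        case (step n)
        have "(r n, r (Suc n)) \<in> E \<inter> (- F) \<times> (- F)"
          using r nF[of n] nF[of "Suc n"] step(1) that(1) by (auto simp: rays_def)
        then show ?case
          using step(3) by (auto simp: same_component_avoiding_def intro: rtrancl_into_rtrancl)
      qed
      have "same_component_avoiding E F (r i) (r j)" if "i \<ge> N" "j \<ge> N" for i j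
      proof (cases "i \<le> j")
        case True
        then show ?thesis using up that by simp
      next
        case False
        then have "same_component_avoiding E F (r j) (r i)"
          using up that by simp
        then show ?thesis by (rule sym_same_component_avoiding[OF assms])
      qed
      then show ?thesis by blast
    qed
    with r show "(r, r) \<in> ray_equiv E"
      by (simp add: ray_equiv_def)
  qed
qed

lemma borel_edge_chromatic_number_le_iff:
  "borel_edge_chromatic_number M E \<le> enat n \<longleftrightarrow> (\<exists>c. borel_edge_coloring M E n c)"
proof
  let ?A = "{enat k | k. \<exists>c. borel_edge_coloring M E k c}"
  assume le: "borel_edge_chromatic_number M E \<le> enat n"
  then have "?A \<noteq> {}"
    unfolding borel_edge_chromatic_number_def
    by (metis (no_types, lifting) Inf_enat_def enat_ord_code(5) infinity_ileE)
  then obtain a where "a \<in> ?A"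
    by blast
  then have "(LEAST x. x \<in> ?A) \<in> ?A"
    by (rule LeastI)
  then have "Inf ?A \<in> ?A"
    using \<open>?A \<noteq> {}\<close> by (simp only: Inf_enat_def if_False)
  then obtain k c where k: "Inf ?A = enat k" and c: "borel_edge_coloring M E k c"
    by auto
  have kn: "k \<le> n"
    using le k by (simp add: borel_edge_chromatic_number_def)
  have "(\<lambda>(x, y). c {x, y}) \<in>
      measurable (restrict_space (M \<Otimes>\<^sub>M M) E) (count_space {..<n})"
  proof -
    have "(\<lambda>m. m) \<in> measurable (count_space {..<k}) (count_space {..<n})"
      using kn by auto
    from measurable_compose[OF _ this] c show ?thesis
      by (auto simp: borel_edge_coloring_def)
  qed
  moreover have "edge_coloring E n c"
    using c kn unfolding borel_edge_coloring_def edge_coloring_def by (meson less_le_trans)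
  ultimately show "\<exists>c. borel_edge_coloring M E n c"
    unfolding borel_edge_coloring_def by blast
next
  assume "\<exists>c. borel_edge_coloring M E n c"
  then show "borel_edge_chromatic_number M E \<le> enat n"
    unfolding borel_edge_chromatic_number_def by (intro Inf_lower) auto
qed

lemma topspace_shift_topology: "topspace (shift_topology G) = carrier G \<rightarrow>\<^sub>E UNIV"
  by (simp add: shift_topology_def)

lemma space_borel_of_topology [simp]: "space (borel_of_topology T) = topspace T"
  unfolding borel_of_topology_def by (rule space_measure_of) (auto dest: openin_subset)

lemma sets_borel_of_topology_openin: "openin T U \<Longrightarrow> U \<in> sets (borel_of_topology T)"
  unfolding borel_of_topology_def by (subst sets_measure_of) (auto dest: openin_subset)

lemma space_free_part_space: "space (free_part_space G) = free_part G"
  by (auto simp: free_part_space_def space_restrict_space free_part_def)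

lemma measurable_shift_coordinate:
  assumes "\<delta> \<in> carrier G"
  shows "(\<lambda>x. x \<delta>) \<in> measurable (borel_of_topology (shift_topology G)) (count_space UNIV)"
proof (rule measurableI)
  fix A :: "bool set"
  have "continuous_map (shift_topology G) (discrete_topology UNIV) (\<lambda>x. x \<delta>)"
    unfolding shift_topology_def using assms by (rule continuous_map_product_projection)
  then have "openin (shift_topology G) {x \<in> topspace (shift_topology G). x \<delta> \<in> A}"
    by (rule openin_continuous_map_preimage) simp
  then show "(\<lambda>x. x \<delta>) -` A \<inter> space (borel_of_topology (shift_topology G))
      \<in> sets (borel_of_topology (shift_topology G))"
    by (auto simp: vimage_def Int_def conj_commute dest: sets_borel_of_topology_openin)
qed simp

context marked_group
begin

lemma inv_in_gens: "s \<in> S \<Longrightarrow> inv s \<in> S"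
  using gens_symmetric by blast

lemma sym_cayley_graph: "sym (cayley_graph G S)"
proof (rule symI)
  fix g h assume "(g, h) \<in> cayley_graph G S"
  then obtain s where s: "g \<in> carrier G" "s \<in> S" "h = g \<otimes> s"
    by (auto simp: cayley_graph_def)
  then have "g = h \<otimes> inv s" "h \<in> carrier G"
    using gens_subset by (auto simp: m_assoc)
  then show "(h, g) \<in> cayley_graph G S"
    using inv_in_gens[OF s(2)] by (auto simp: cayley_graph_def)
qed

lemma irrefl_cayley_graph: "irrefl (cayley_graph G S)"
  using one_notin_gens gens_subset by (auto simp: irrefl_def cayley_graph_def)

lemma countable_carrier: "countable (carrier G)"
proof -
  have "g \<in> (\<lambda>l. foldr (\<otimes>) l \<one>) ` lists S" if "g \<in> generate G S" for g
    using that
  proof induction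
    case one
    show ?case by (rule image_eqI[of _ _ "[]"]) auto
  next
    case (incl h)
    then show ?case using gens_subset by (intro image_eqI[of _ _ "[h]"]) auto
  next
    case (inv h)
    then show ?case
      using gens_subset inv_in_gens[of h] by (intro image_eqI[of _ _ "[inv h]"]) auto
  next
    case (eng g h)
    then obtain l m where l: "l \<in> lists S" "g = foldr (\<otimes>) l \<one>"
      and m: "m \<in> lists S" "h = foldr (\<otimes>) m \<one>"
      by auto
    have cl: "foldr (\<otimes>) k \<one> \<in> carrier G" if "k \<in> lists S" for k
      using that gens_subset by (induction k) auto
    have "foldr (\<otimes>) (k @ m) \<one> = foldr (\<otimes>) k \<one> \<otimes> foldr (\<otimes>) m \<one>" if "k \<in> lists S" for k
      using that
    proof (induction k)
      case (Cons a k)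
      then show ?case
        using gens_subset cl[of k] cl[OF m(1)] by (auto simp: m_assoc)
    qed (use cl[OF m(1)] in auto)
    with l m show ?case by (intro image_eqI[of _ _ "l @ m"]) auto
  qed
  then have "carrier G \<subseteq> (\<lambda>l. foldr (\<otimes>) l \<one>) ` lists S"
    using generate_gens by blast
  moreover have "countable (lists S)"
    using finite_gens by (simp add: countable_finite)
  ultimately show ?thesis
    by (meson countable_image countable_subset)
qed

lemma shift_in_space: "shift G \<gamma> x \<in> topspace (shift_topology G)"
  by (simp add: topspace_shift_topology shift_def)

lemma shift_one: "x \<in> topspace (shift_topology G) \<Longrightarrow> shift G \<one> x = x"
  by (auto simp: topspace_shift_topology shift_def PiE_def extensional_def fun_eq_iff restrict_def)

lemma shift_mult:
  "\<gamma> \<in> carrier G \<Longrightarrow> \<gamma>' \<in> carrier G \<Longrightarrow> shift G (\<gamma> \<otimes> \<gamma>') x = shift G \<gamma> (shift G \<gamma>' x)"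
  by (auto simp: shift_def fun_eq_iff restrict_def inv_mult_group m_assoc)

lemma shift_inv_shift:
  "\<gamma> \<in> carrier G \<Longrightarrow> x \<in> topspace (shift_topology G) \<Longrightarrow> shift G (inv \<gamma>) (shift G \<gamma> x) = x"
  by (simp flip: shift_mult add: shift_one)

lemma free_part_shift_eq_iff:
  assumes x: "x \<in> free_part G" and \<gamma>: "\<gamma> \<in> carrier G" "\<gamma>' \<in> carrier G"
  shows "shift G \<gamma> x = shift G \<gamma>' x \<longleftrightarrow> \<gamma> = \<gamma>'"
proof
  assume eq: "shift G \<gamma> x = shift G \<gamma>' x"
  have "shift G (inv \<gamma>' \<otimes> \<gamma>) x = x"
    using eq x \<gamma> by (simp add: shift_mult shift_inv_shift free_part_def)
  then have "inv \<gamma>' \<otimes> \<gamma> = \<one>"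
    using x \<gamma> by (auto simp: free_part_def)
  then show "\<gamma> = \<gamma>'"
    using \<gamma> by (metis inv_closed inv_equality inv_inv)
qed simp

lemma shift_free_part:
  assumes x: "x \<in> free_part G" and \<gamma>: "\<gamma> \<in> carrier G"
  shows "shift G \<gamma> x \<in> free_part G"
proof -
  have "shift G \<delta> (shift G \<gamma> x) \<noteq> shift G \<gamma> x" if "\<delta> \<in> carrier G" "\<delta> \<noteq> \<one>" for \<delta>
    using free_part_shift_eq_iff[OF x, of "\<delta> \<otimes> \<gamma>" \<gamma>] that \<gamma>
    by (simp add: shift_mult)
  then show ?thesis
    by (auto simp: free_part_def shift_in_space)
qed

lemma sym_shift_graph: "sym (shift_graph G S)"
proof (rule symI)
  fix x y assume "(x, y) \<in> shift_graph G S"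
  then obtain \<gamma> where *: "x \<in> free_part G" "y \<in> free_part G" "\<gamma> \<in> S" "y = shift G \<gamma> x"
    by (auto simp: shift_graph_def)
  have "\<gamma> \<in> carrier G" "x \<in> topspace (shift_topology G)"
    using * gens_subset by (auto simp: free_part_def)
  from shift_inv_shift[OF this] have "x = shift G (inv \<gamma>) y"
    using *(4) by metis
  with * show "(y, x) \<in> shift_graph G S"
    using inv_in_gens unfolding shift_graph_def by blast
qed

lemma irrefl_shift_graph: "irrefl (shift_graph G S)"
proof (rule irreflI)
  fix x show "(x, x) \<notin> shift_graph G S"
  proof
    assume "(x, x) \<in> shift_graph G S"
    then obtain \<gamma> where *: "x \<in> free_part G" "\<gamma> \<in> S" "x = shift G \<gamma> x"
      unfolding shift_graph_def by blast
    then have "\<gamma> \<in> carrier G - {\<one>}"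
      using gens_subset one_notin_gens by blast
    then show False
      using *(1) *(3)[symmetric] unfolding free_part_def by blast
  qed
qed

lemma shift_graph_regular:
  assumes x: "x \<in> free_part G"
  shows "card {y. (x, y) \<in> shift_graph G S} = card S"
proof -
  have "{y. (x, y) \<in> shift_graph G S} = (\<lambda>\<gamma>. shift G \<gamma> x) ` S"
    using x gens_subset shift_free_part[OF x] by (auto simp: shift_graph_def)
  moreover have "inj_on (\<lambda>\<gamma>. shift G \<gamma> x) S"
    using gens_subset free_part_shift_eq_iff[OF x] by (auto intro!: inj_onI)
  ultimately show ?thesis
    by (simp add: card_image)
qed

lemma shift_eq_iff:
  assumes "y \<in> topspace (shift_topology G)"
  shows "y = shift G \<gamma> x \<longleftrightarrow> (\<forall>\<delta>\<in>carrier G. y \<delta> = x (inv \<gamma> \<otimes> \<delta>))"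
  using assms
  by (auto simp: topspace_shift_topology shift_def PiE_def extensional_def fun_eq_iff restrict_def)

lemma free_part_borel: "free_part G \<in> sets (borel_of_topology (shift_topology G))"
proof -
  let ?M = "borel_of_topology (shift_topology G)"
  have neq: "shift G \<gamma> x \<noteq> x \<longleftrightarrow> (\<exists>\<delta>\<in>carrier G. x \<delta> \<noteq> x (inv \<gamma> \<otimes> \<delta>))"
    if "x \<in> topspace (shift_topology G)" for \<gamma> x
    using shift_eq_iff[OF that, of \<gamma> x] by metis
  have eq: "free_part G = {x \<in> space ?M. \<forall>\<gamma>\<in>carrier G - {\<one>}.
      \<exists>\<delta>\<in>carrier G. x \<delta> \<noteq> x (inv \<gamma> \<otimes> \<delta>)}"
    unfolding free_part_def space_borel_of_topology
    by (intro Collect_cong conj_cong ball_cong refl neq)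
  have *: "{x \<in> space ?M. x \<delta> \<noteq> x (inv \<gamma> \<otimes> \<delta>)} \<in> sets ?M"
    if "\<gamma> \<in> carrier G" "\<delta> \<in> carrier G" for \<gamma> \<delta>
  proof -
    have [measurable]: "Measurable.pred ?M (\<lambda>x. x \<delta>)" "Measurable.pred ?M (\<lambda>x. x (inv \<gamma> \<otimes> \<delta>))"
      using that by (auto intro!: measurable_shift_coordinate)
    show ?thesis by measurable
  qed
  show ?thesis
    unfolding eq
    by (intro sets.sets_Collect_countable_All' sets.sets_Collect_countable_Ex' *)
      (use countable_carrier in auto)
qed

lemma shift_graph_borel: "shift_graph G S \<in> sets (free_part_space G \<Otimes>\<^sub>M free_part_space G)"
proof -
  let ?M = "free_part_space G"
  let ?P = "?M \<Otimes>\<^sub>M ?M"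
  have coord: "(\<lambda>x. x \<delta>) \<in> measurable ?M (count_space UNIV)" if "\<delta> \<in> carrier G" for \<delta>
    unfolding free_part_space_def
    using measurable_shift_coordinate[OF that] by (rule measurable_restrict_space1)
  have eq: "shift_graph G S = {p \<in> space ?P. \<exists>\<gamma>\<in>S. \<forall>\<delta>\<in>carrier G.
      snd p \<delta> = fst p (inv \<gamma> \<otimes> \<delta>)}"
  proof -
    have "shift_graph G S =
        {p \<in> free_part G \<times> free_part G. \<exists>\<gamma>\<in>S. snd p = shift G \<gamma> (fst p)}"
      unfolding shift_graph_def by (simp add: case_prod_beta' mem_Times_iff conj_assoc)
    also have "\<dots> = {p \<in> free_part G \<times> free_part G. \<exists>\<gamma>\<in>S. \<forall>\<delta>\<in>carrier G.
        snd p \<delta> = fst p (inv \<gamma> \<otimes> \<delta>)}"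
      by (intro Collect_cong conj_cong bex_cong refl shift_eq_iff)
        (simp add: free_part_def mem_Times_iff)
    finally show ?thesis
      unfolding space_pair_measure space_free_part_space .
  qed
  have *: "{p \<in> space ?P. snd p \<delta> = fst p (inv \<gamma> \<otimes> \<delta>)} \<in> sets ?P"
    if "\<gamma> \<in> S" "\<delta> \<in> carrier G" for \<gamma> \<delta>
  proof -
    have c: "inv \<gamma> \<otimes> \<delta> \<in> carrier G"
      using that gens_subset by auto
    have [measurable]: "Measurable.pred ?P (\<lambda>p. snd p \<delta>)"
      "Measurable.pred ?P (\<lambda>p. fst p (inv \<gamma> \<otimes> \<delta>))"
      using measurable_compose[OF measurable_snd coord[OF that(2)]]
        measurable_compose[OF measurable_fst coord[OF c]] by auto
    show ?thesis by measurable
  qed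
  show ?thesis
    unfolding eq
    by (rule sets.sets_Collect_finite_Ex[OF sets.sets_Collect_countable_All'[OF * countable_carrier]
        finite_gens])
qed

end

end

theory Submission
  imports Defs
begin

text \<open>
  A two-ended group has linear growth: if \<open>A\<close> is one side of a finite cut, then \<open>h A\<close> agrees up to a
  finite set with \<open>A\<close> or with its complement, the \<open>h\<close> of the first kind form a subgroup of index at
  most two, and \<open>h \<mapsto> |A - h A| - |h A - A|\<close> is a homomorphism from it to the integers which has
  finite kernel and is bounded by a multiple of the word length.

  In a graph of linear growth with degrees at most \<open>d\<close>, every partial edge coloring with \<open>d + 1\<close>
  colors can be changed within a ball of fixed radius around any given uncolored edge so as to color
  that edge too. Vizing's argument either does this or produces a long alternating path along which
  the uncolored edge can be moved. If a second Vizing fan at the moved edge never succeeded, then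
  most vertices of that path would lie near an end of a long alternating path, which is too many
  vertices for linear growth.

  Finitely many sets of far apart points cover the free part in a Borel way. Treating the edges at
  the points of one such set at a time, all changes are local and do not interfere with each other,
  so finitely many rounds give a Borel coloring of all edges.
\<close>

section \<open>Kempe changes and Vizing fans\<close>

text \<open>The obstacle is locality. Only changes of bounded radius are allowed, whereas Vizing's
  argument switches two-color components of unbounded length. So a component is switched only when
  it fits into a ball, and a long one serves as a track for the uncolored edge instead.

  Linear growth enters by counting. The track has about \<open>n\<close> vertices inside a ball of
  size O(n). For a fixed pair of colors, each start of an alternating path of length 2K owns K + 1
  vertices, so only O(n / K) starts lie in that ball. Once K is large against the degree, the number
  of color pairs and the growth constant, the neighbors of all starts cannot fill the track.

  Two Cayley graphs occur. Ends are taken in the graph joining g to g s, whose automorphisms include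
  the left multiplications; orbits of the shift are copies of the graph joining g to s g. Products
  of at most n generators form the same set in both, and growth is transferred through these word
  balls.\<close>

lemma ex_less_of_not: "(\<not> P n) \<Longrightarrow> P 0 \<Longrightarrow> \<exists>l<n. P l \<and> \<not> P (Suc l)" for P :: "nat \<Rightarrow> bool"
  by (induction n) (auto simp: less_Suc_eq)

section \<open>Graph balls\<close>

definition gball :: "('v \<times> 'v) set \<Rightarrow> 'v \<Rightarrow> nat \<Rightarrow> 'v set" where
  "gball E v n = {w. \<exists>k\<le>n. (v, w) \<in> E ^^ k}"

lemma gball_refl [simp]: "v \<in> gball E v n"
  unfolding gball_def by (auto intro: exI[of _ 0])

lemma gball_mono: "m \<le> n \<Longrightarrow> gball E v m \<subseteq> gball E v n"
  unfolding gball_def by (auto intro: order_trans)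

lemma gball_trans: "w \<in> gball E v m \<Longrightarrow> z \<in> gball E w n \<Longrightarrow> z \<in> gball E v (m + n)"
  unfolding gball_def
proof clarify
  fix k l assume "k \<le> m" "(v, w) \<in> E ^^ k" "l \<le> n" "(w, z) \<in> E ^^ l"
  then have "(v, z) \<in> E ^^ (k + l)" "k + l \<le> m + n" by (auto simp: relpow_add)
  then show "\<exists>k\<le>m + n. (v, z) \<in> E ^^ k" by blast
qed

lemma gball_edge: "(v, w) \<in> E \<Longrightarrow> w \<in> gball E v 1"
  unfolding gball_def by (auto intro: exI[of _ 1])

lemma gball_step: "w \<in> gball E v n \<Longrightarrow> (w, z) \<in> E \<Longrightarrow> z \<in> gball E v (Suc n)"
  using gball_trans[of w E v n z 1] gball_edge by force

lemma gball_sym: "sym E \<Longrightarrow> w \<in> gball E v n \<Longrightarrow> v \<in> gball E w n"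
proof -
  have "(w, v) \<in> E ^^ k" if "sym E" "(v, w) \<in> E ^^ k" for k
    using that(2)
  proof (induction k arbitrary: w)
    case (Suc k)
    then obtain u where "(v, u) \<in> E ^^ k" "(u, w) \<in> E" by auto
    with Suc that(1) have "(w, u) \<in> E" "(u, v) \<in> E ^^ k" by (auto dest: symD)
    then show ?case by (rule relpow_Suc_I2)
  qed auto
  then show "sym E \<Longrightarrow> w \<in> gball E v n \<Longrightarrow> v \<in> gball E w n"
    by (auto simp: gball_def)
qed

text \<open>The palette is {0..d}: one color more than the degree bound, so that no vertex uses up
  all of them.\<close>

definition missing :: "nat \<Rightarrow> ('v \<Rightarrow> 'v \<Rightarrow> nat option) \<Rightarrow> 'v \<Rightarrow> nat set" where
  "missing d c v = {a. a \<le> d \<and> (\<forall>w. c v w \<noteq> Some a)}"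

definition pcoloring :: "('v \<times> 'v) set \<Rightarrow> nat \<Rightarrow> ('v \<Rightarrow> 'v \<Rightarrow> nat option) \<Rightarrow> bool" where
  "pcoloring E d c \<longleftrightarrow> (\<forall>u v. c u v = c v u) \<and> (\<forall>u v a. c u v = Some a \<longrightarrow> (u, v) \<in> E \<and> a \<le> d)
     \<and> (\<forall>u v w a. c u v = Some a \<longrightarrow> c u w = Some a \<longrightarrow> v = w)"

lemma pcoloring_sym: "pcoloring E d c \<Longrightarrow> c u v = c v u"
  and pcoloring_symD: "pcoloring E d c \<Longrightarrow> c u v = t \<Longrightarrow> c v u = t"
  and pcoloring_edge: "pcoloring E d c \<Longrightarrow> c u v = Some a \<Longrightarrow> (u, v) \<in> E"
  and pcoloring_le: "pcoloring E d c \<Longrightarrow> c u v = Some a \<Longrightarrow> a \<le> d"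
  and pcoloring_inj: "pcoloring E d c \<Longrightarrow> c u v = Some a \<Longrightarrow> c u w = Some a \<Longrightarrow> v = w"
  unfolding pcoloring_def by (iprover, iprover intro: trans, iprover, iprover, iprover)

lemma missD: "a \<in> missing d c v \<Longrightarrow> c v w \<noteq> Some a"
  and missing_le: "a \<in> missing d c v \<Longrightarrow> a \<le> d"
  by (auto simp: missing_def)

definition recolor :: "('v \<Rightarrow> 'v \<Rightarrow> nat option) \<Rightarrow> 'v \<Rightarrow> 'v \<Rightarrow> nat option \<Rightarrow> 'v \<Rightarrow> 'v \<Rightarrow> nat option" where
  "recolor c u v t = (\<lambda>x y. if {x, y} = {u, v} then t else c x y)"

text \<open>The colored set may only grow, so later rounds never undo earlier ones. Both ends of
  every changed edge lie in \<open>B\<close>, so changes made in disjoint sets do not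
  interfere.\<close>

definition augmentable :: "('v \<times> 'v) set \<Rightarrow> nat \<Rightarrow> ('v \<Rightarrow> 'v \<Rightarrow> nat option) \<Rightarrow> 'v \<Rightarrow> 'v \<Rightarrow> 'v set \<Rightarrow> bool" where
  "augmentable E d c u v B \<longleftrightarrow> (\<exists>c'. pcoloring E d c' \<and> c' u v \<noteq> None \<and> (\<forall>x y. c x y \<noteq> None \<longrightarrow> c' x y \<noteq> None)
     \<and> (\<forall>x y. c' x y \<noteq> c x y \<longrightarrow> x \<in> B \<and> y \<in> B))"

lemma augmentable_sym:
  assumes "augmentable E d c u v B"
  shows "augmentable E d c v u B"
proof -
  obtain c' where c': "pcoloring E d c'" "c' u v \<noteq> None" "\<forall>x y. c x y \<noteq> None \<longrightarrow> c' x y \<noteq> None"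
    "\<forall>x y. c' x y \<noteq> c x y \<longrightarrow> x \<in> B \<and> y \<in> B"
    using assms unfolding augmentable_def by blast
  have "c' v u \<noteq> None" using c'(2) pcoloring_sym[OF c'(1), of u v] by simp
  then show ?thesis unfolding augmentable_def using c' by blast
qed

lemma augmentable_mono:
  assumes "augmentable E d c u v B" "B \<subseteq> B'"
  shows "augmentable E d c u v B'"
proof -
  obtain c' where c': "pcoloring E d c'" "c' u v \<noteq> None" "\<forall>x y. c x y \<noteq> None \<longrightarrow> c' x y \<noteq> None"
    "\<forall>x y. c' x y \<noteq> c x y \<longrightarrow> x \<in> B \<and> y \<in> B"
    using assms unfolding augmentable_def by blast
  have "\<forall>x y. c' x y \<noteq> c x y \<longrightarrow> x \<in> B' \<and> y \<in> B'" using c'(4) assms(2) by blast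
  then show ?thesis unfolding augmentable_def using c' by blast
qed

definition swap_colors :: "nat \<Rightarrow> nat \<Rightarrow> nat \<Rightarrow> nat" where
  "swap_colors a b x = (if x = a then b else if x = b then a else x)"

lemma swap_colors_swap_colors [simp]: "swap_colors a b (swap_colors a b x) = x"
  by (auto simp: swap_colors_def)

lemma swap_colors_eq_iff: "swap_colors a b x = y \<longleftrightarrow> x = swap_colors a b y"
  by (auto simp: swap_colors_def)

text \<open>Any union of two-color components qualifies; no connectedness is asked for, which spares
  a definition of components.\<close>

definition kempe_closed :: "('v \<Rightarrow> 'v \<Rightarrow> nat option) \<Rightarrow> nat \<Rightarrow> nat \<Rightarrow> 'v set \<Rightarrow> bool" where
  "kempe_closed c a b C \<longleftrightarrow> (\<forall>u\<in>C. \<forall>v. c u v = Some a \<or> c u v = Some b \<longrightarrow> v \<in> C)"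

text \<open>Only the first endpoint is tested. For a closed \<open>C\<close> this is still
  symmetric, because an edge with one end outside \<open>C\<close> carries neither color and is
  fixed by the swap.\<close>

definition kempe_flip :: "('v \<Rightarrow> 'v \<Rightarrow> nat option) \<Rightarrow> nat \<Rightarrow> nat \<Rightarrow> 'v set \<Rightarrow> 'v \<Rightarrow> 'v \<Rightarrow> nat option" where
  "kempe_flip c a b C = (\<lambda>u v. if u \<in> C then map_option (swap_colors a b) (c u v) else c u v)"

text \<open>A Kempe path read from one of its ends: as \<open>p 0\<close> misses \<open>a\<close>,
  the first edge has color \<open>b\<close> and nothing precedes it. The number \<open>n\<close>
  counts edges; values of \<open>p\<close> beyond \<open>n\<close> are arbitrary.\<close>

definition altpath :: "nat \<Rightarrow> ('v \<Rightarrow> 'v \<Rightarrow> nat option) \<Rightarrow> nat \<Rightarrow> nat \<Rightarrow> (nat \<Rightarrow> 'v) \<Rightarrow> nat \<Rightarrow> bool" where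
  "altpath d c a b p n \<longleftrightarrow> a \<noteq> b \<and> a \<in> missing d c (p 0) \<and>
     (\<forall>i<n. c (p i) (p (Suc i)) = Some (if even i then b else a))"

text \<open>A Vizing fan with center \<open>x\<close>: \<open>y 0\<close> is the far end of the
  uncolored edge, and \<beta> i is the color that the edge to \<open>y i\<close> receives when the
  fan is shifted. The last leaf is \<open>y m\<close>, for which no color is prescribed.\<close>

definition fan :: "('v \<times> 'v) set \<Rightarrow> nat \<Rightarrow> ('v \<Rightarrow> 'v \<Rightarrow> nat option) \<Rightarrow> 'v \<Rightarrow> (nat \<Rightarrow> 'v) \<Rightarrow> (nat \<Rightarrow> nat) \<Rightarrow> nat \<Rightarrow> bool" where
  "fan E d c x y \<beta> m \<longleftrightarrow> (x, y 0) \<in> E \<and> c x (y 0) = None \<and> inj_on y {..m} \<and>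
     (\<forall>i<m. c x (y (Suc i)) = Some (\<beta> i) \<and> \<beta> i \<in> missing d c (y i))"

locale bounded_degree_graph =
  fixes E :: "('v \<times> 'v) set" and d :: nat
  assumes symE: "sym E" and irreflE: "irrefl E"
    and finite_nbrs: "finite {w. (v, w) \<in> E}"
    and card_nbrs: "card {w. (v, w) \<in> E} \<le> d"
begin

lemma not_refl: "(v, v) \<notin> E"
  using irreflE by (auto simp: irrefl_def)

lemma symED: "(u, v) \<in> E \<Longrightarrow> (v, u) \<in> E"
  using symE by (auto dest: symD)

lemma kclosedD: "kempe_closed c a b C \<Longrightarrow> u \<in> C \<Longrightarrow> c u v = Some a \<or> c u v = Some b \<Longrightarrow> v \<in> C"
  unfolding kempe_closed_def by blast

lemma pcoloring_irrefl: "pcoloring E d c \<Longrightarrow> c u u = None"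
  using pcoloring_edge not_refl by (metis not_None_eq)

lemma missing_nonempty:
  assumes "pcoloring E d c"
  shows "\<exists>a. a \<in> missing d c v"
proof (rule ccontr)
  assume "\<not> ?thesis"
  then have "\<forall>a\<in>{..d}. \<exists>w. c v w = Some a"
    by (auto simp: missing_def)
  then obtain f where f: "\<forall>a\<in>{..d}. c v (f a) = Some a"
    by (metis (no_types))
  have "inj_on f {..d}"
    by (rule inj_onI) (metis f option.inject)
  then have "card (f ` {..d}) = Suc d"
    by (simp add: card_image)
  moreover have "f ` {..d} \<subseteq> {w. (v, w) \<in> E}"
    using f pcoloring_edge[OF assms] by blast
  ultimately show False
    using card_mono[OF finite_nbrs, of "f ` {..d}" v] card_nbrs[of v] by simp
qed

section \<open>Recoloring a single edge and sliding the uncolored edge\<close>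

lemma pcoloring_recolor_None:
  assumes c: "pcoloring E d c"
  shows "pcoloring E d (recolor c u v None)"
  unfolding pcoloring_def
proof (intro conjI allI impI)
  let ?c = "recolor c u v None"
  have *: "c x y = Some a" if "?c x y = Some a" for x y a
    using that by (simp add: recolor_def split: if_splits)
  show "?c x y = ?c y x" for x y
    using pcoloring_sym[OF c, of x y] by (simp add: recolor_def insert_commute)
  show "(x, y) \<in> E" "a \<le> d" if "?c x y = Some a" for x y a
    using *[OF that] pcoloring_edge[OF c] pcoloring_le[OF c] by blast+
  show "y = z" if "?c x y = Some a" "?c x z = Some a" for x y z a
    using *[OF that(1)] *[OF that(2)] pcoloring_inj[OF c] by blast
qed

lemma pcoloring_recolor_Some:
  assumes c: "pcoloring E d c" and uv: "(u, v) \<in> E" and a: "a \<in> missing d c u" "a \<in> missing d c v"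
  shows "pcoloring E d (recolor c u v (Some a))"
  unfolding pcoloring_def
proof (intro conjI allI impI)
  let ?c = "recolor c u v (Some a)"
  have *: "{x, y} = {u, v} \<and> b = a \<or> {x, y} \<noteq> {u, v} \<and> c x y = Some b" if "?c x y = Some b" for x y b
    using that by (simp add: recolor_def split: if_splits)
  show "?c x y = ?c y x" for x y
    using pcoloring_sym[OF c, of x y] by (simp add: recolor_def insert_commute)
  show "(x, y) \<in> E" if "?c x y = Some b" for x y b
    using *[OF that] pcoloring_edge[OF c, of x y b] uv symED[OF uv] by (auto simp: doubleton_eq_iff)
  show "b \<le> d" if "?c x y = Some b" for x y b
    using *[OF that] pcoloring_le[OF c, of x y b] missing_le[OF a(1)] by auto
  show "y = z" if 1: "?c x y = Some b" and 2: "?c x z = Some b" for x y z b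
  proof -
    have x: "c x w \<noteq> Some a" if "x = u \<or> x = v" for w
      using that missD[OF a(1)] missD[OF a(2)] by auto
    show ?thesis
      using *[OF 1] *[OF 2]
    proof (elim disjE conjE)
      assume "{x, y} = {u, v}" "{x, z} = {u, v}"
      then show ?thesis by (auto simp: doubleton_eq_iff)
    next
      assume "{x, y} = {u, v}" "b = a" "c x z = Some b"
      then show ?thesis using x[of z] by (auto simp: doubleton_eq_iff)
    next
      assume "{x, z} = {u, v}" "b = a" "c x y = Some b"
      then show ?thesis using x[of y] by (auto simp: doubleton_eq_iff)
    next
      assume "c x y = Some b" "c x z = Some b"
      then show ?thesis by (rule pcoloring_inj[OF c])
    qed
  qed
qed

lemma recolor_other: "{x, y} \<noteq> {u, v} \<Longrightarrow> recolor c u v t x y = c x y"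
  and recolor_same: "recolor c u v t u v = t"
  by (simp_all add: recolor_def)

text \<open>The elementary move behind both fans and paths. The color \<open>g\<close> merely passes
  from \<open>v w\<close> to \<open>u v\<close>, so the color set at \<open>v\<close> is unchanged,
  \<open>u\<close> gains \<open>g\<close> and \<open>w\<close> loses it. The last conclusion pulls a
  later success back to the original uncolored edge.\<close>

lemma slide:
  assumes c: "pcoloring E d c" and uv: "c u v = None" "(u, v) \<in> E"
    and vw: "c v w = Some g" and g: "g \<in> missing d c u"
  defines "c1 \<equiv> recolor (recolor c v w None) u v (Some g)"
  shows "pcoloring E d c1" "c1 v w = None" "(v, w) \<in> E" "u \<noteq> w" "c1 u v = Some g"
    and "\<And>x y. {x, y} \<noteq> {u, v} \<Longrightarrow> {x, y} \<noteq> {v, w} \<Longrightarrow> c1 x y = c x y"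
    and "\<And>x y h. h \<noteq> g \<Longrightarrow> c1 x y = Some h \<longleftrightarrow> c x y = Some h"
    and "\<And>x h. h \<noteq> g \<Longrightarrow> h \<in> missing d c1 x \<longleftrightarrow> h \<in> missing d c x"
    and "g \<in> missing d c1 w"
    and "\<And>x. x \<noteq> u \<Longrightarrow> x \<noteq> v \<Longrightarrow> missing d c x \<subseteq> missing d c1 x"
    and "missing d c1 v = missing d c v"
    and "\<And>B. augmentable E d c1 v w B \<Longrightarrow> u \<in> B \<Longrightarrow> v \<in> B \<Longrightarrow> w \<in> B \<Longrightarrow> augmentable E d c u v B"
proof -
  \<comment> \<open>Erasing \<open>v w\<close> first makes \<open>g\<close> missing at both ends of
    \<open>u v\<close>, so coloring \<open>u v\<close> afterwards is an ordinary legal step.\<close>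
  let ?c0 = "recolor c v w None"
  have uw: "u \<noteq> w" using uv vw pcoloring_sym[OF c, of u v] by auto
  have ne: "u \<noteq> v" "v \<noteq> w" using uv(2) not_refl pcoloring_edge[OF c vw] by auto
  have gd: "g \<le> d" using pcoloring_le[OF c vw] .
  have nset: "{v, w} \<noteq> {u, v}" using uw ne by (auto simp: doubleton_eq_iff)
  have c0: "pcoloring E d ?c0" by (rule pcoloring_recolor_None[OF c])
  have c0D: "c x y = Some a" if "?c0 x y = Some a" for x y a
    using that by (simp add: recolor_def split: if_splits)
  have mono0: "missing d c x \<subseteq> missing d ?c0 x" for x
    using c0D by (fastforce simp: missing_def)
  have gv: "g \<in> missing d ?c0 v"
  proof -
    have "?c0 v z \<noteq> Some g" for z
    proof
      assume z: "?c0 v z = Some g"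
      then have "z = w" using pcoloring_inj[OF c c0D[OF z] vw] by simp
      then show False using z by (simp add: recolor_same)
    qed
    then show ?thesis using gd by (simp add: missing_def)
  qed
  have gu: "g \<in> missing d ?c0 u" using g mono0 by blast
  show "(v, w) \<in> E" using pcoloring_edge[OF c vw] .
  show "u \<noteq> w" by fact
  show p: "pcoloring E d c1"
    unfolding c1_def by (rule pcoloring_recolor_Some[OF c0 uv(2) gu gv])
  show uvg: "c1 u v = Some g" unfolding c1_def by (simp add: recolor_same)
  show vwN: "c1 v w = None" unfolding c1_def using nset by (simp add: recolor_other recolor_same)
  show eq: "c1 x y = c x y" if "{x, y} \<noteq> {u, v}" "{x, y} \<noteq> {v, w}" for x y
    using that unfolding c1_def by (simp add: recolor_other)
  show eq2: "c1 x y = Some h \<longleftrightarrow> c x y = Some h" if "h \<noteq> g" for h x y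
  proof -
    consider "{x, y} = {u, v}" | "{x, y} = {v, w}" "{x, y} \<noteq> {u, v}" | "{x, y} \<noteq> {u, v}" "{x, y} \<noteq> {v, w}"
      by blast
    then show ?thesis
    proof cases
      case 1
      then have "c1 x y = Some g" "c x y = None"
        using pcoloring_sym[OF c, of u v] uv by (auto simp: c1_def recolor_def doubleton_eq_iff)
      then show ?thesis using that by simp
    next
      case 2
      then have "c1 x y = None" "c x y = Some g"
        using pcoloring_sym[OF c, of w v] vw by (auto simp: c1_def recolor_def doubleton_eq_iff)
      then show ?thesis using that by simp
    next
      case 3 then show ?thesis by (simp add: eq)
    qed
  qed
  show "h \<in> missing d c1 x \<longleftrightarrow> h \<in> missing d c x" if "h \<noteq> g" for h x
    using eq2[OF that] by (simp add: missing_def)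
  show "g \<in> missing d c1 w"
  proof -
    have "c1 w z \<noteq> Some g" for z
    proof
      assume z: "c1 w z = Some g"
      have "{w, z} \<noteq> {u, v}" using uw ne by (auto simp: doubleton_eq_iff)
      then have "?c0 w z = Some g" using z by (simp add: c1_def recolor_other)
      then have "c w z = Some g" by (rule c0D)
      moreover have "c w v = Some g" using vw pcoloring_sym[OF c, of v w] by simp
      ultimately have "z = v" by (rule pcoloring_inj[OF c])
      then show False using vwN z pcoloring_sym[OF p, of v w] by simp
    qed
    then show ?thesis using gd by (simp add: missing_def)
  qed
  show "missing d c x \<subseteq> missing d c1 x" if "x \<noteq> u" "x \<noteq> v" for x
  proof -
    have "{x, z} \<noteq> {u, v}" for z using that by (auto simp: doubleton_eq_iff)
    then have "missing d c1 x = missing d ?c0 x" by (simp add: missing_def c1_def recolor_other)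
    then show ?thesis using mono0 by simp
  qed
  have "c1 v u = Some g" using uvg pcoloring_sym[OF p, of u v] by simp
  then have g1: "g \<notin> missing d c1 v" "g \<notin> missing d c v"
    using vw by (auto simp: missing_def)
  have "h \<in> missing d c1 v \<longleftrightarrow> h \<in> missing d c v" for h
    using g1 eq2[of h v] by (cases "h = g") (blast, simp add: missing_def eq2)
  then show "missing d c1 v = missing d c v" by blast
  fix B
  assume "augmentable E d c1 v w B" and B: "u \<in> B" "v \<in> B" "w \<in> B"
  then obtain c' where c': "pcoloring E d c'" "c' v w \<noteq> None" "\<And>x y. c1 x y \<noteq> None \<Longrightarrow> c' x y \<noteq> None"
    "\<And>x y. c' x y \<noteq> c1 x y \<Longrightarrow> x \<in> B \<and> y \<in> B"
    unfolding augmentable_def by blast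
  have "c' u v \<noteq> None"
    using c'(3)[of u v] uvg by simp
  moreover have "c' x y \<noteq> None" if "c x y \<noteq> None" for x y
  proof (cases "{x, y} = {u, v} \<or> {x, y} = {v, w}")
    case True
    then show ?thesis
      using c'(2) \<open>c' u v \<noteq> None\<close> pcoloring_sym[OF c'(1), of v w] pcoloring_sym[OF c'(1), of u v]
      by (auto simp: doubleton_eq_iff)
  next
    case False
    then show ?thesis using c'(3)[of x y] eq[of x y] that by simp
  qed
  moreover have "x \<in> B \<and> y \<in> B" if "c' x y \<noteq> c x y" for x y
  proof (cases "{x, y} = {u, v} \<or> {x, y} = {v, w}")
    case True
    then show ?thesis using B by (auto simp: doubleton_eq_iff)
  next
    case False
    then show ?thesis using c'(4)[of x y] eq[of x y] that by simp
  qed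
  ultimately show "augmentable E d c u v B"
    using c'(1) unfolding augmentable_def by blast
qed

lemma augmentable_color:
  assumes c: "pcoloring E d c" and uv: "c u v = None" "(u, v) \<in> E"
    and a: "a \<in> missing d c u" "a \<in> missing d c v" and B: "u \<in> B" "v \<in> B"
  shows "augmentable E d c u v B"
proof -
  let ?c = "recolor c u v (Some a)"
  have "pcoloring E d ?c" by (rule pcoloring_recolor_Some[OF c uv(2) a])
  moreover have "?c u v \<noteq> None" by (simp add: recolor_same)
  moreover have "\<forall>x y. c x y \<noteq> None \<longrightarrow> ?c x y \<noteq> None" by (simp add: recolor_def)
  moreover have "\<forall>x y. ?c x y \<noteq> c x y \<longrightarrow> x \<in> B \<and> y \<in> B"
    using B by (auto simp: recolor_def doubleton_eq_iff)
  ultimately show ?thesis unfolding augmentable_def by blast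
qed

text \<open>An edge with exactly one end in \<open>C\<close> carries neither of the two colors, so
  it does not notice the swap; inside \<open>C\<close> the swap is injective on colors.\<close>

lemma kempe_flip_pcoloring:
  assumes c: "pcoloring E d c" and C: "kempe_closed c a b C" and ab: "a \<le> d" "b \<le> d"
  shows "pcoloring E d (kempe_flip c a b C)"
proof -
  have *: "map_option (swap_colors a b) (c u v) = c u v" if "(u \<in> C) \<noteq> (v \<in> C)" for u v
  proof -
    have "c u v \<noteq> Some a \<and> c u v \<noteq> Some b"
    proof (cases "u \<in> C")
      case True
      then show ?thesis using that C unfolding kempe_closed_def by blast
    next
      case False
      then have "v \<in> C" using that by blast
      then have "c v u \<noteq> Some a \<and> c v u \<noteq> Some b" using False C unfolding kempe_closed_def by blast
      then show ?thesis by (simp add: pcoloring_sym[OF c, of u v])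
    qed
    then show ?thesis by (cases "c u v") (auto simp: swap_colors_def)
  qed
  show ?thesis
    unfolding pcoloring_def
  proof (intro conjI allI impI)
    show "kempe_flip c a b C u v = kempe_flip c a b C v u" for u v
    proof -
      have "c v u = c u v" by (rule pcoloring_sym[OF c])
      then show ?thesis
        using *[of u v] *[of v u] by (cases "u \<in> C"; cases "v \<in> C") (simp_all add: kempe_flip_def)
    qed
    show "(u, v) \<in> E" if "kempe_flip c a b C u v = Some h" for u v h
      using that by (auto simp: kempe_flip_def split: if_splits intro: pcoloring_edge[OF c])
    show "h \<le> d" if "kempe_flip c a b C u v = Some h" for u v h
      using that ab by (auto simp: kempe_flip_def swap_colors_def split: if_splits dest: pcoloring_le[OF c])
    show "v = w" if "kempe_flip c a b C u v = Some h" "kempe_flip c a b C u w = Some h" for u v w h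
    proof (cases "u \<in> C")
      case True
      then have "c u v = Some (swap_colors a b h)" "c u w = Some (swap_colors a b h)"
        using that by (auto simp: kempe_flip_def swap_colors_eq_iff)
      then show ?thesis by (rule pcoloring_inj[OF c])
    next
      case False
      then have "c u v = Some h" "c u w = Some h" using that by (auto simp: kempe_flip_def)
      then show ?thesis by (rule pcoloring_inj[OF c])
    qed
  qed
qed

lemma kempe_flip_missing_in:
  assumes "u \<in> C" "h \<in> missing d c u" "a \<le> d" "b \<le> d"
  shows "swap_colors a b h \<in> missing d (kempe_flip c a b C) u"
  using assms by (auto simp: missing_def kempe_flip_def swap_colors_eq_iff) (auto simp: swap_colors_def)

lemma kempe_flip_missing_out: "u \<notin> C \<Longrightarrow> missing d (kempe_flip c a b C) u = missing d c u"
  by (auto simp: missing_def kempe_flip_def)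

lemma kempe_flip_augmentable:
  assumes "augmentable E d (kempe_flip c a b C) u v B" and C: "kempe_closed c a b C" "C \<subseteq> B" and c: "pcoloring E d c"
  shows "augmentable E d c u v B"
proof -
  obtain c' where c': "pcoloring E d c'" "c' u v \<noteq> None" "\<And>x y. kempe_flip c a b C x y \<noteq> None \<Longrightarrow> c' x y \<noteq> None"
    "\<And>x y. c' x y \<noteq> kempe_flip c a b C x y \<Longrightarrow> x \<in> B \<and> y \<in> B"
    using assms unfolding augmentable_def by blast
  have "c' x y \<noteq> None" if "c x y \<noteq> None" for x y
    using c'(3)[of x y] that by (auto simp: kempe_flip_def)
  moreover have "x \<in> B \<and> y \<in> B" if "c' x y \<noteq> c x y" for x y
  proof (cases "c' x y = kempe_flip c a b C x y")
    case True
    then have "kempe_flip c a b C x y \<noteq> c x y" using that by simp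
    then have xC: "x \<in> C" and "map_option (swap_colors a b) (c x y) \<noteq> c x y"
      by (simp_all add: kempe_flip_def split: if_splits)
    then have "c x y = Some a \<or> c x y = Some b"
      by (cases "c x y") (simp_all add: swap_colors_def split: if_splits)
    with xC have "y \<in> C" using C(1) unfolding kempe_closed_def by blast
    then show ?thesis using C(2) xC by blast
  qed (use c'(4) in blast)
  ultimately show ?thesis
    using c'(1,2) unfolding augmentable_def by blast
qed

section \<open>Alternating paths and short two-color components\<close>

lemma altpath_inj:
  assumes c: "pcoloring E d c" and p: "altpath d c a b p n"
  shows "inj_on p {..n}"
proof -
  have ab: "a \<noteq> b" and a: "\<And>w. c (p 0) w \<noteq> Some a"
    and p: "\<And>i. i < n \<Longrightarrow> c (p i) (p (Suc i)) = Some (if even i then b else a)"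
    using p by (auto simp: altpath_def missing_def)
  have "inj_on p {..j}" if "j \<le> n" for j
    using that
  proof (induction j)
    case (Suc j)
    then have inj: "inj_on p {..j}" by simp
    \<comment> \<open>A return to \<open>p i\<close> would bring an edge whose color is already used
      there: that of the forward edge if \<open>i\<close> and \<open>j\<close> have equal parity,
      otherwise that of the backward edge, or the color \<open>a\<close> missing at
      \<open>p 0\<close>.\<close>
    have "p (Suc j) \<noteq> p i" if i: "i \<le> j" for i
    proof
      assume eq: "p (Suc j) = p i"
      have bwd: "c (p i) (p j) = Some (if even j then b else a)"
        using p[of j] Suc.prems pcoloring_sym[OF c] eq by (metis Suc_le_lessD)
      have "i < n" using i Suc.prems by simp
      note fwd = p[OF this]
      show False
      proof (cases "even i = even j")
        case True
        then have "p j = p (Suc i)"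
          using bwd fwd pcoloring_inj[OF c] by metis
        moreover have "p j \<noteq> p (Suc j)"
          using eq bwd pcoloring_irrefl[OF c] by (metis option.simps(3))
        ultimately have "i \<noteq> j" by auto
        then have "Suc i \<le> j" using i by simp
        then have "j = Suc i"
          using inj \<open>p j = p (Suc i)\<close> by (auto dest: inj_onD)
        then show False using True by simp
      next
        case False
        show False
        proof (cases i)
          case 0
          then show False using False bwd a by auto
        next
          case (Suc k)
          have "c (p i) (p k) = Some (if even k then b else a)"
            using p[of k] \<open>i < n\<close> Suc pcoloring_sym[OF c] by (metis Suc_lessD)
          then have "p k = p j"
            using bwd False Suc pcoloring_inj[OF c] by (metis even_Suc)
          then have "k = j"
            using inj i Suc by (auto dest: inj_onD)
          then show False using i Suc by simp
        qed
      qed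
    qed
    then show ?case
      using inj by (auto simp: atMost_Suc)
  qed auto
  then show ?thesis by simp
qed

text \<open>An even vertex other than the start is entered through its \<open>a\<close>-edge. From a
  common even vertex both paths are therefore forced backwards in step, and they reach their starts
  together because a start has no \<open>a\<close>-edge.\<close>

lemma altpath_even_disjoint:
  assumes c: "pcoloring E d c" and p: "altpath d c a b p n" and q: "altpath d c a b q n"
    and "2 * s \<le> n" "2 * t \<le> n" "p (2 * s) = q (2 * t)"
  shows "p 0 = q 0"
  using assms(4-)
proof (induction s arbitrary: t)
  have bwd: "c (r (2 * t)) (r (2 * t - 1)) = Some a" "c (r (2 * t - 1)) (r (2 * (t - 1))) = Some b"
    if r: "altpath d c a b r n" "2 * t \<le> n" "t > 0" for r :: "nat \<Rightarrow> 'v" and t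
  proof -
    obtain t' where t: "t = Suc t'" using r(3) by (cases t) auto
    have col: "\<And>i. i < n \<Longrightarrow> c (r i) (r (Suc i)) = Some (if even i then b else a)"
      using r(1) by (simp add: altpath_def)
    have "c (r (Suc (2 * t'))) (r (Suc (Suc (2 * t')))) = Some a" "c (r (2 * t')) (r (Suc (2 * t'))) = Some b"
      using col[of "Suc (2 * t')"] col[of "2 * t'"] r(2) t by simp_all
    from this[THEN pcoloring_symD[OF c]]
    show "c (r (2 * t)) (r (2 * t - 1)) = Some a" "c (r (2 * t - 1)) (r (2 * (t - 1))) = Some b"
      by (simp_all add: t)
  qed
  { case 0
    have "t = 0"
    proof (rule ccontr)
      assume "t \<noteq> 0"
      then show False
        using bwd(1)[OF q, of t] 0 p by (auto simp: altpath_def missing_def)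
    qed
    then show ?case using 0 by simp
  next
    case (Suc s)
    have "t \<noteq> 0"
    proof
      assume "t = 0"
      then show False
        using bwd(1)[OF p, of "Suc s"] Suc q by (auto simp: altpath_def missing_def)
    qed
    note b1 = bwd[OF p, of "Suc s"] and b2 = bwd[OF q, of t]
    have "p (2 * Suc s - 1) = q (2 * t - 1)"
      using b1(1) b2(1) Suc.prems \<open>t \<noteq> 0\<close> pcoloring_inj[OF c] by (metis gr0I nat.simps(3))
    then have "p (2 * s) = q (2 * (t - 1))"
      using b1(2) b2(2) Suc.prems \<open>t \<noteq> 0\<close> pcoloring_inj[OF c] by (metis gr0I nat.simps(3) diff_Suc_1)
    then show ?case
      using Suc.IH[of "t - 1"] Suc.prems by simp }
qed

lemma altpath_gball:
  assumes c: "pcoloring E d c" and p: "altpath d c a b p n" and "i \<le> n"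
  shows "p i \<in> gball E (p 0) i"
  using \<open>i \<le> n\<close>
proof (induction i)
  case (Suc i)
  then have "(p i, p (Suc i)) \<in> E"
    using p pcoloring_edge[OF c] by (auto simp: altpath_def)
  then show ?case using Suc gball_step by fastforce
qed simp

lemma kempe_closed_path:
  assumes c: "pcoloring E d c" and C: "kempe_closed c a b C"
    and p: "\<And>i. i < n \<Longrightarrow> c (p i) (p (Suc i)) = Some a \<or> c (p i) (p (Suc i)) = Some b"
    and i: "p i \<in> C" "i \<le> n"
  shows "p ` {..n} \<subseteq> C"
proof -
  have up: "p j \<in> C" if "i \<le> j" "j \<le> n" for j
    using that
  proof (induction j rule: dec_induct)
    case (step k)
    then show ?case using kclosedD[OF C, of "p k" "p (Suc k)"] p[of k] by simp
  qed (use i in simp)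
  have down: "p (i - k) \<in> C" for k
  proof (induction k)
    case (Suc k)
    show ?case
    proof (cases "i - k = 0")
      case False
      then have "i - k = Suc (i - Suc k)" "i - Suc k < n" using i by auto
      then have "c (p (i - Suc k)) (p (i - k)) = Some a \<or> c (p (i - Suc k)) (p (i - k)) = Some b"
        using p[of "i - Suc k"] by simp
      then have "c (p (i - k)) (p (i - Suc k)) = Some a \<or> c (p (i - k)) (p (i - Suc k)) = Some b"
        using pcoloring_symD[OF c] by blast
      then show ?thesis by (rule kclosedD[OF C Suc])
    qed (use Suc in auto)
  qed (use i in simp)
  show ?thesis
  proof
    fix z assume "z \<in> p ` {..n}"
    then obtain j where j: "z = p j" "j \<le> n" by auto
    show "z \<in> C"
    proof (cases "i \<le> j")
      case False
      then show ?thesis using down[of "i - j"] j by simp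
    qed (use up j in auto)
  qed
qed

text \<open>A longest alternating path from \<open>v\<close> is the whole component: its inner
  vertices have both colors, so only its two ends can miss one. Minimality among closed sets is what
  later shows that two such components are equal or disjoint.\<close>

lemma short_component:
  assumes c: "pcoloring E d c" and ab: "a \<noteq> b" and a: "a \<in> missing d c v"
    and short: "\<not> (\<exists>p. p 0 = v \<and> altpath d c a b p K)"
  obtains C w0 where "v \<in> C" "kempe_closed c a b C" "C \<subseteq> gball E v K" "finite C" "card C \<le> K"
    "\<forall>w\<in>C. a \<in> missing d c w \<or> b \<in> missing d c w \<longrightarrow> w = v \<or> w = w0"
    "\<forall>C'. kempe_closed c a b C' \<longrightarrow> C \<inter> C' \<noteq> {} \<longrightarrow> C \<subseteq> C'"
proof -
  let ?P = "\<lambda>n. \<exists>p. p 0 = v \<and> altpath d c a b p n"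
  have "?P 0" using ab a by (auto simp: altpath_def)
  with short obtain l where l: "l < K" "?P l" "\<not> ?P (Suc l)"
    using ex_less_of_not[of ?P K] by auto
  then obtain p where p: "p 0 = v" "altpath d c a b p l" by auto
  have col: "c (p i) (p (Suc i)) = Some (if even i then b else a)" if "i < l" for i
    using p that by (auto simp: altpath_def)
  have col': "c (p (Suc i)) (p i) = Some (if even i then b else a)" if "i < l" for i
    using col[OF that] pcoloring_sym[OF c] by metis
  \<comment> \<open>By maximality the last vertex has no edge of the color that is due next.\<close>
  have last: "c (p l) w \<noteq> Some (if even l then b else a)" for w
  proof
    assume w: "c (p l) w = Some (if even l then b else a)"
    have "altpath d c a b (p(Suc l := w)) (Suc l)"
      unfolding altpath_def
    proof (intro conjI allI impI)
      fix i assume "i < Suc l"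
      then show "c ((p(Suc l := w)) i) ((p(Suc l := w)) (Suc i)) = Some (if even i then b else a)"
        using col[of i] w by (cases "i = l") auto
    qed (use p a ab in auto)
    then show False using l(3) p(1) by (metis fun_upd_apply nat.simps(3))
  qed
  let ?C = "p ` {..l}"
  have nb: "w \<in> ?C" if "i \<le> l" "c (p i) w = Some a \<or> c (p i) w = Some b" for i w
  proof -
    let ?f = "Some (if even i then b else a)" and ?g = "Some (if even i then a else b)"
    have "c (p i) w = ?f \<or> c (p i) w = ?g" using that(2) by auto
    then show ?thesis
    proof
      assume f: "c (p i) w = ?f"
      then have "i \<noteq> l" using last by auto
      then have "i < l" using that by simp
      then have "w = p (Suc i)" using col[of i] f pcoloring_inj[OF c] by metis
      then show ?thesis using \<open>i < l\<close> by auto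
    next
      assume g: "c (p i) w = ?g"
      have "i \<noteq> 0"
        using g p(1) missD[OF a] by (metis even_zero)
      then obtain k where k: "i = Suc k" by (cases i) auto
      have "w = p k" using col'[of k] g k that(1) pcoloring_inj[OF c]
        by (metis Suc_le_lessD even_Suc)
      then show ?thesis using k that(1) by auto
    qed
  qed
  have closed: "kempe_closed c a b ?C"
    using nb by (auto simp: kempe_closed_def)
  have "gball E v i \<subseteq> gball E v K" if "i \<le> l" for i
    using that l(1) by (intro gball_mono) simp
  then have gb: "?C \<subseteq> gball E v K"
    using altpath_gball[OF c p(2)] p(1) by auto
  have crd: "card ?C \<le> K"
    using card_image_le[of "{..l}" p] l(1) by simp
  have ends: "w = v \<or> w = p l" if wC: "w \<in> ?C" and wm: "a \<in> missing d c w \<or> b \<in> missing d c w" for w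
  proof (rule ccontr)
    assume n: "\<not> ?thesis"
    obtain i where i: "w = p i" "i \<le> l" using wC by blast
    then have "i \<noteq> 0" "i \<noteq> l" using n p(1) by (metis, metis)
    then obtain k where k: "i = Suc k" by (cases i) auto
    have "c w (p (Suc i)) = Some (if even i then b else a)"
      using col[of i] i \<open>i \<noteq> l\<close> by auto
    moreover have "c w (p k) = Some (if even k then b else a)"
      using col'[of k] i k by auto
    ultimately show False
      using wm k by (auto simp: missing_def split: if_splits)
  qed
  have min: "?C \<subseteq> C'" if C': "kempe_closed c a b C'" and w: "w \<in> ?C" "w \<in> C'" for C' w
  proof -
    obtain i where i: "w = p i" "i \<le> l" using w by auto
    show ?thesis
    proof (rule kempe_closed_path[OF c C'])
      show "c (p j) (p (Suc j)) = Some a \<or> c (p j) (p (Suc j)) = Some b" if "j < l" for j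
        using col[OF that] by simp
    qed (use i w in auto)
  qed
  have "v \<in> ?C" using p(1) by auto
  moreover have "\<forall>w\<in>?C. a \<in> missing d c w \<or> b \<in> missing d c w \<longrightarrow> w = v \<or> w = p l"
    using ends by blast
  moreover have "\<forall>C'. kempe_closed c a b C' \<longrightarrow> ?C \<inter> C' \<noteq> {} \<longrightarrow> ?C \<subseteq> C'"
  proof (intro allI impI)
    fix C' assume C': "kempe_closed c a b C'" "?C \<inter> C' \<noteq> {}"
    then obtain w where "w \<in> ?C" "w \<in> C'" by blast
    then show "?C \<subseteq> C'" by (rule min[OF C'(1)])
  qed
  ultimately show ?thesis
    using closed gb crd by (intro that[of ?C "p l"]) simp_all
qed

section \<open>Vizing fans\<close>

lemma fan_mono: "fan E d c x y \<beta> m \<Longrightarrow> k \<le> m \<Longrightarrow> fan E d c x y \<beta> k"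
  unfolding fan_def by (auto intro: inj_on_subset)

lemma fan_edge: "pcoloring E d c \<Longrightarrow> fan E d c x y \<beta> m \<Longrightarrow> i \<le> m \<Longrightarrow> (x, y i) \<in> E"
  by (cases i) (auto simp: fan_def intro: pcoloring_edge)

text \<open>Iterated \<open>slide\<close> with the center as middle vertex, so the uncolored edge
  turns around \<open>x\<close> while the color set at \<open>x\<close> stays fixed. The only edge
  at \<open>y m\<close> that changes is the one to \<open>x\<close>, and it ends up uncolored, so
  \<open>y m\<close> keeps all its missing colors.\<close>

lemma fan_shift:
  assumes c: "pcoloring E d c" and "fan E d c x y \<beta> m"
  shows "\<exists>c'. pcoloring E d c' \<and> c' x (y m) = None \<and> missing d c' x = missing d c x
    \<and> (\<forall>u v. u \<noteq> x \<longrightarrow> v \<noteq> x \<longrightarrow> c' u v = c u v) \<and> missing d c (y m) \<subseteq> missing d c' (y m)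
    \<and> (\<forall>z. z \<notin> y ` {..m} \<longrightarrow> c' x z = c x z)
    \<and> (\<forall>B. x \<in> B \<longrightarrow> y ` {..m} \<subseteq> B \<longrightarrow> augmentable E d c' x (y m) B \<longrightarrow> augmentable E d c x (y 0) B)"
  using assms(2)
proof (induction m)
  case 0
  then show ?case using c by (intro exI[of _ c]) (auto simp: fan_def)
next
  case (Suc m)
  note f = Suc.prems
  obtain c' where c': "pcoloring E d c'" "c' x (y m) = None" "missing d c' x = missing d c x"
    "\<forall>u v. u \<noteq> x \<longrightarrow> v \<noteq> x \<longrightarrow> c' u v = c u v" "missing d c (y m) \<subseteq> missing d c' (y m)"
    "\<forall>z. z \<notin> y ` {..m} \<longrightarrow> c' x z = c x z"
    "\<forall>B. x \<in> B \<longrightarrow> y ` {..m} \<subseteq> B \<longrightarrow> augmentable E d c' x (y m) B \<longrightarrow> augmentable E d c x (y 0) B"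
    using Suc.IH[OF fan_mono[OF f, of m]] by auto
  have ed: "(x, y i) \<in> E" if "i \<le> Suc m" for i using fan_edge[OF c f that] .
  then have nx: "y i \<noteq> x" if "i \<le> Suc m" for i using that not_refl by metis
  have new: "y (Suc m) \<notin> y ` {..m}"
  proof
    assume "y (Suc m) \<in> y ` {..m}"
    then obtain k where "y (Suc m) = y k" "k \<le> m" by blast
    moreover have "inj_on y {..Suc m}" using f by (simp add: fan_def)
    ultimately have "Suc m = k" by (auto dest: inj_onD)
    then show False using \<open>k \<le> m\<close> by simp
  qed
  have s1: "c' (y m) x = None" "(y m, x) \<in> E"
    using c' pcoloring_sym[OF c'(1)] ed symED by auto
  have s2: "c' x (y (Suc m)) = Some (\<beta> m)" "\<beta> m \<in> missing d c' (y m)"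
    using f c'(5,6) new by (auto simp: fan_def)
  let ?c = "recolor (recolor c' x (y (Suc m)) None) (y m) x (Some (\<beta> m))"
  note sl = slide[OF c'(1) s1 s2]
  show ?case
  proof (intro exI[of _ ?c] conjI allI impI)
    show "pcoloring E d ?c" "?c x (y (Suc m)) = None" using sl(1,2) by auto
    show "missing d ?c x = missing d c x" using sl(11) c'(3) by simp
    show "?c u v = c u v" if "u \<noteq> x" "v \<noteq> x" for u v
      using sl(6)[of u v] that c'(4) by (auto simp: doubleton_eq_iff)
    show "?c x z = c x z" if "z \<notin> y ` {..Suc m}" for z
    proof -
      have "z \<noteq> y m" "z \<noteq> y (Suc m)" "z \<notin> y ` {..m}" using that by auto
      then show ?thesis using sl(6)[of x z] c'(6) nx[of m] nx[of "Suc m"] by (auto simp: doubleton_eq_iff)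
    qed
    have "missing d c (y (Suc m)) \<subseteq> missing d c' (y (Suc m))"
    proof
      fix h assume h: "h \<in> missing d c (y (Suc m))"
      have "c' (y (Suc m)) w \<noteq> Some h" for w
      proof (cases "w = x")
        case True
        have "c (y (Suc m)) x = c' (y (Suc m)) x"
          using c'(6) new pcoloring_sym[OF c] pcoloring_sym[OF c'(1)] by metis
        then show ?thesis using True missD[OF h] by metis
      next
        case False
        then show ?thesis using c'(4) nx[of "Suc m"] missD[OF h] by auto
      qed
      then show "h \<in> missing d c' (y (Suc m))" using missing_le[OF h] by (auto simp: missing_def)
    qed
    also have "\<dots> \<subseteq> missing d ?c (y (Suc m))"
    proof (rule sl(10))
      show "y (Suc m) \<noteq> y m" using new by auto
    qed (use nx in auto)
    finally show "missing d c (y (Suc m)) \<subseteq> missing d ?c (y (Suc m))" .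
    fix B assume B: "x \<in> B" "y ` {..Suc m} \<subseteq> B" "augmentable E d ?c x (y (Suc m)) B"
    have "augmentable E d c' (y m) x B"
      by (rule sl(12)[OF B(3)]) (use B in auto)
    then have "augmentable E d c' x (y m) B" by (rule augmentable_sym)
    moreover have "y ` {..m} \<subseteq> B" using B by auto
    ultimately show "augmentable E d c x (y 0) B" using c'(7) B by blast
  qed
qed

lemma fan_done:
  assumes c: "pcoloring E d c" and f: "fan E d c x y \<beta> m" and a: "a \<in> missing d c x" "a \<in> missing d c (y m)"
    and B: "gball E x 1 \<subseteq> B"
  shows "augmentable E d c x (y 0) B"
proof -
  have "x \<in> B" "y ` {..m} \<subseteq> B"
    using B gball_edge[OF fan_edge[OF c f]] by auto
  obtain c' where c': "pcoloring E d c'" "c' x (y m) = None" "missing d c' x = missing d c x"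
    "missing d c (y m) \<subseteq> missing d c' (y m)"
    and all: "\<forall>B. x \<in> B \<longrightarrow> y ` {..m} \<subseteq> B \<longrightarrow> augmentable E d c' x (y m) B \<longrightarrow> augmentable E d c x (y 0) B"
    using fan_shift[OF c f] by (elim exE conjE) (rule that)
  have *: "augmentable E d c' x (y m) B \<longrightarrow> augmentable E d c x (y 0) B"
    using all \<open>x \<in> B\<close> \<open>y ` {..m} \<subseteq> B\<close> by simp
  have "augmentable E d c' x (y m) B"
    using c' a \<open>x \<in> B\<close> \<open>y ` {..m} \<subseteq> B\<close> fan_edge[OF c f, of m]
    by (intro augmentable_color[OF c'(1,2), of a]) auto
  then show ?thesis using * by blast
qed

text \<open>The switch makes \<open>a\<close> missing at \<open>y m\<close>, while \<open>x\<close>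
  lies outside \<open>C\<close> and still misses \<open>a\<close>, so \<open>fan_done\<close>
  applies. Edges at \<open>x\<close> do not change, and missing colors change only at leaves in
  \<open>C\<close>; the condition on \<beta> keeps these leaves usable.\<close>

lemma fan_kempe_flip:
  assumes c: "pcoloring E d c" and f: "fan E d c x y \<beta> m"
    and a: "a \<in> missing d c x" and b: "b \<in> missing d c (y m)"
    and C: "kempe_closed c b a C" "x \<notin> C" "y m \<in> C" "C \<subseteq> B" "gball E x 1 \<subseteq> B"
    and i: "\<And>i. i < m \<Longrightarrow> y i \<in> C \<Longrightarrow> \<beta> i \<noteq> a \<and> \<beta> i \<noteq> b"
  shows "augmentable E d c x (y 0) B"
proof (rule kempe_flip_augmentable[OF _ C(1) C(4) c])
  have ab: "a \<le> d" "b \<le> d" using missing_le[OF a] missing_le[OF b] by auto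
  let ?c = "kempe_flip c b a C"
  show "augmentable E d ?c x (y 0) B"
  proof (rule fan_done)
    show "pcoloring E d ?c" using kempe_flip_pcoloring[OF c C(1)] ab by simp
    show "fan E d ?c x y \<beta> m"
      unfolding fan_def
    proof (intro conjI allI impI)
      show "(x, y 0) \<in> E" "?c x (y 0) = None" "inj_on y {..m}"
        using f C(2) by (auto simp: fan_def kempe_flip_def)
      fix k assume k: "k < m"
      show "?c x (y (Suc k)) = Some (\<beta> k)"
        using f C(2) k by (auto simp: fan_def kempe_flip_def)
      have bk: "\<beta> k \<in> missing d c (y k)" using f k by (auto simp: fan_def)
      show "\<beta> k \<in> missing d ?c (y k)"
      proof (cases "y k \<in> C")
        case True
        then have "swap_colors b a (\<beta> k) = \<beta> k" using i[OF k] by (auto simp: swap_colors_def)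
        then show ?thesis using kempe_flip_missing_in[OF True bk, of b a] ab by simp
      next
        case False then show ?thesis using bk kempe_flip_missing_out by metis
      qed
    qed
    show "a \<in> missing d ?c x" using a C(2) kempe_flip_missing_out by metis
    have "swap_colors b a b = a" by (simp add: swap_colors_def)
    then show "a \<in> missing d ?c (y m)"
      using kempe_flip_missing_in[OF C(3) b, of b a] ab by simp
    show "gball E x 1 \<subseteq> B" by fact
  qed
qed

text \<open>Each of \<open>x\<close>, \<open>y j\<close> and \<open>y m\<close> misses one of the
  two colors and is thus an end of its component. A path has only two ends, so the component of one
  of the leaves avoids \<open>x\<close> and may be switched. The bound \<open>K\<close> on path
  lengths keeps that component inside \<open>B\<close>.\<close>

lemma vizing_end:
  assumes c: "pcoloring E d c" and f: "fan E d c x y \<beta> m"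
    and j: "j < m" "\<beta> j = \<beta> m" and inj: "inj_on \<beta> {..<m}"
    and a: "a \<in> missing d c x" and b: "\<beta> m \<in> missing d c (y m)"
    and short: "\<And>k p. k \<in> {j, m} \<Longrightarrow> p 0 = y k \<Longrightarrow> \<not> altpath d c (\<beta> m) a p K"
    and B: "gball E x (Suc K) \<subseteq> B"
  shows "augmentable E d c x (y 0) B"
proof -
  let ?b = "\<beta> m"
  have colx: "c x (y (Suc i)) = Some (\<beta> i)" "\<beta> i \<in> missing d c (y i)" if "i < m" for i
    using f that by (auto simp: fan_def)
  have na: "\<beta> i \<noteq> a" if "i < m" for i using colx(1)[OF that] missD[OF a] by auto
  have ba: "?b \<noteq> a" using na[OF j(1)] j(2) by simp
  have bj: "?b \<in> missing d c (y j)" using colx(2)[OF j(1)] j(2) by simp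
  have B1: "gball E x 1 \<subseteq> B" using B gball_mono[of 1 "Suc K" E x] by auto
  have sub: "gball E (y k) K \<subseteq> B" if "k \<le> m" for k
    using gball_trans[OF gball_edge[OF fan_edge[OF c f that]], of _ K] B by auto
  have yy: "y j \<noteq> y m" using f j(1) by (auto simp: fan_def inj_on_def)
  have xm: "y m \<noteq> x" using fan_edge[OF c f, of m] not_refl by auto
  have xj: "y j \<noteq> x" using fan_edge[OF c f, of j] not_refl j by auto
  have "\<not> (\<exists>p. p 0 = y j \<and> altpath d c ?b a p K)" using short by blast
  then obtain Cj wj where Cj: "y j \<in> Cj" "kempe_closed c ?b a Cj" "Cj \<subseteq> gball E (y j) K"
    "finite Cj" "card Cj \<le> K"
    "\<forall>w\<in>Cj. ?b \<in> missing d c w \<or> a \<in> missing d c w \<longrightarrow> w = y j \<or> w = wj"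
    "\<forall>C'. kempe_closed c ?b a C' \<longrightarrow> Cj \<inter> C' \<noteq> {} \<longrightarrow> Cj \<subseteq> C'"
    by (rule short_component[OF c ba bj])
  have "\<not> (\<exists>p. p 0 = y m \<and> altpath d c ?b a p K)" using short by blast
  then obtain Cm wm where Cm: "y m \<in> Cm" "kempe_closed c ?b a Cm" "Cm \<subseteq> gball E (y m) K"
    "finite Cm" "card Cm \<le> K"
    "\<forall>w\<in>Cm. ?b \<in> missing d c w \<or> a \<in> missing d c w \<longrightarrow> w = y m \<or> w = wm"
    "\<forall>C'. kempe_closed c ?b a C' \<longrightarrow> Cm \<inter> C' \<noteq> {} \<longrightarrow> Cm \<subseteq> C'"
    by (rule short_component[OF c ba b])
  show ?thesis
  proof (cases "x \<in> Cj")
    case False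
    \<comment> \<open>The fan is cut at \<open>j\<close>; by injectivity of \<beta> below
      \<open>m\<close>, the repeated color occurs at no leaf before \<open>j\<close>.\<close>
    show ?thesis
    proof (rule fan_kempe_flip[OF c fan_mono[OF f, of j] a bj Cj(2) False Cj(1)])
      show "\<beta> i \<noteq> a \<and> \<beta> i \<noteq> ?b" if "i < j" for i
        using na[of i] inj_onD[OF inj, of i j] j that by auto
    qed (use j B1 Cj(3) sub[of j] in auto)
  next
    case True
    then have "x = y j \<or> x = wj" using Cj(6) a by blast
    then have wj: "wj = x" using xj by auto
    have "y m \<notin> Cj"
    proof
      assume "y m \<in> Cj"
      then have "y m = y j \<or> y m = wj" using Cj(6) b by blast
      then show False using yy xm wj by auto
    qed
    then have dis: "w \<notin> Cj" if "w \<in> Cm" for w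
      using Cm(7) Cj(2) that Cm(1) by blast
    show ?thesis
    proof (rule fan_kempe_flip[OF c f a b Cm(2) _ Cm(1)])
      show "x \<notin> Cm" using dis True by blast
      show "\<beta> i \<noteq> a \<and> \<beta> i \<noteq> ?b" if i: "i < m" "y i \<in> Cm" for i
      proof -
        \<comment> \<open>Below \<open>m\<close> only the index \<open>j\<close> carries the
          repeated color, and \<open>y j\<close> lies in the other component.\<close>
        have "i \<noteq> j" using dis i Cj(1) by auto
        then show ?thesis using na[OF i(1)] inj_onD[OF inj, of i j] j i(1) by auto
      qed
    qed (use B1 Cm(3) sub[of m] in auto)
  qed
qed

text \<open>From a leaf \<open>z\<close> the fan continues across the edge at \<open>x\<close> of
  color \<open>sel z\<close>, until that color is missing at \<open>x\<close> or repeats; one of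
  these must happen since there are finitely many colors. Fixing \<open>sel\<close> in advance lets
  the second fan prescribe which missing colors are preferred.\<close>

lemma fan_exists:
  assumes c: "pcoloring E d c" and xy: "c x y0 = None" "(x, y0) \<in> E"
    and sel: "\<And>z. sel z \<in> missing d c z"
  obtains y m where "y 0 = y0" "fan E d c x y (\<lambda>i. sel (y i)) m" "inj_on (\<lambda>i. sel (y i)) {..<m}"
    "sel (y m) \<in> missing d c x \<or> (\<exists>j<m. sel (y j) = sel (y m))"
proof -
  \<comment> \<open>Meaningful only when the color \<open>sel z\<close> occurs at \<open>x\<close>;
    in the fan it is evaluated only before the stopping index.\<close>
  define f where "f z = (SOME w. c x w = Some (sel z))" for z
  define y where "y n = (f ^^ n) y0" for n
  let ?b = "\<lambda>i. sel (y i)"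
  let ?P = "\<lambda>m. ?b m \<in> missing d c x \<or> (\<exists>j<m. ?b j = ?b m)"
  have "\<exists>m. ?P m"
  proof (rule ccontr)
    assume "\<not> ?thesis"
    then have "?b j \<noteq> ?b m" if "j < m" for j m using that by blast
    then have "inj ?b" by (metis injI linorder_neqE_nat)
    moreover have "range ?b \<subseteq> {..d}" using sel missing_le by fastforce
    ultimately show False
      by (meson finite_atMost finite_imageD finite_subset infinite_UNIV_nat)
  qed
  then have "?P (LEAST m. ?P m)" by (rule LeastI_ex)
  moreover have "\<not> ?P i" if "i < (LEAST m. ?P m)" for i using not_less_Least[OF that] .
  ultimately obtain m where m: "?P m" "\<And>i. i < m \<Longrightarrow> \<not> ?P i" by blast
  have inj: "inj_on ?b {..<m}"
  proof (intro linorder_inj_onI)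
    show "?b i \<noteq> ?b k" if "i < k" "k \<in> {..<m}" for i k
      using m(2)[of k] that by auto
  qed auto
  have col: "c x (y (Suc i)) = Some (?b i)" if "i < m" for i
  proof -
    have "?b i \<notin> missing d c x" using m(2)[OF that] by blast
    then have "\<exists>w. c x w = Some (?b i)" using missing_le[OF sel] by (auto simp: missing_def)
    then have "c x (f (y i)) = Some (?b i)" unfolding f_def by (rule someI_ex)
    then show ?thesis by (simp add: y_def)
  qed
  have y0: "y 0 = y0" by (simp add: y_def)
  have "y i \<noteq> y k" if ik: "i < k" "k \<le> m" for i k
  proof
    assume eq: "y i = y k"
    obtain k' where k': "k = Suc k'" using ik by (cases k) auto
    show False
    proof (cases i)
      case 0
      then show False using col[of k'] eq k' ik xy y0 by auto
    next
      case (Suc i')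
      then have "?b i' = ?b k'" using col[of k'] col[of i'] eq k' ik by auto
      then show False using inj_onD[OF inj, of i' k'] Suc k' ik by auto
    qed
  qed
  then have "inj_on y {..m}" by (intro linorder_inj_onI) auto
  then have "fan E d c x y ?b m"
    using xy y0 col sel by (auto simp: fan_def)
  from that[OF y0 this inj m(1)] show ?thesis .
qed

section \<open>Moving an uncolored edge along an alternating path\<close>

text \<open>The uncolored edge joins \<open>p 0\<close> to \<open>p 1\<close>, and the alternating
  path starts at \<open>p 1\<close>, hence the index shift. The first path edge has color
  \<open>a\<close>, missing at \<open>p 0\<close>, so the uncolored edge can slide onto the
  path.\<close>

definition chain where
  "chain f p a b n \<longleftrightarrow> pcoloring E d f \<and> f (p 0) (p 1) = None \<and> (p 0, p 1) \<in> E \<and> a \<in> missing d f (p 0)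
     \<and> altpath d f b a (\<lambda>i. p (Suc i)) n \<and> inj_on p {..Suc n}"

text \<open>If \<open>vizing_end\<close> fails within this radius, a long path starts at one of the
  two leaves with the repeated color. Shifting the fan up to that leaf puts the uncolored edge right
  in front of the path.\<close>

lemma vizing_chain:
  assumes c: "pcoloring E d c" and xy: "c x y0 = None" "(x, y0) \<in> E"
    and not_aug: "\<not> augmentable E d c x y0 (gball E x (n + 2))"
  obtains f p a b where "chain f p a b n" "p 0 = x"
    "\<forall>B. gball E x 1 \<subseteq> B \<longrightarrow> augmentable E d f x (p 1) B \<longrightarrow> augmentable E d c x y0 B"
proof -
  obtain a where a: "a \<in> missing d c x" using missing_nonempty[OF c] by blast
  define sel where "sel z = (SOME b. b \<in> missing d c z)" for z
  have sel: "sel z \<in> missing d c z" for z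
    unfolding sel_def using missing_nonempty[OF c] by (rule someI_ex)
  obtain y m where y: "y 0 = y0" and f: "fan E d c x y (\<lambda>i. sel (y i)) m"
    and inj: "inj_on (\<lambda>i. sel (y i)) {..<m}"
    and stop: "sel (y m) \<in> missing d c x \<or> (\<exists>j<m. sel (y j) = sel (y m))"
    by (rule fan_exists[OF c xy sel])
  have "gball E x 1 \<subseteq> gball E x (n + 2)" by (rule gball_mono) simp
  then have "sel (y m) \<notin> missing d c x"
    using fan_done[OF c f _ sel] not_aug y by blast
  then obtain j where j: "j < m" "sel (y j) = sel (y m)" using stop by blast
  have "\<exists>k p. k \<in> {j, m} \<and> p 0 = y k \<and> altpath d c (sel (y m)) a p (Suc n)"
  proof (rule ccontr)
    assume "\<not> ?thesis"
    \<comment> \<open>With path length \<open>Suc n\<close>, \<open>vizing_end\<close> asks for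
      radius n + 2.\<close>
    then have "augmentable E d c x (y 0) (gball E x (n + 2))"
      by (intro vizing_end[OF c f j inj a sel, of "Suc n"]) auto
    then show False using not_aug y by simp
  qed
  then obtain k q where k: "k \<in> {j, m}" and q0: "q 0 = y k" and q: "altpath d c (sel (y m)) a q (Suc n)"
    by blast
  have km: "k \<le> m" using k j by auto
  define b where "b = sel (y m)"
  have bk: "b \<in> missing d c (y k)" using sel[of "y k"] k j by (auto simp: b_def)
  have col: "c (q i) (q (Suc i)) = Some (if even i then a else b)" if "i < Suc n" for i
    using q that by (auto simp: altpath_def b_def)
  have ab: "b \<noteq> a" using q by (simp add: altpath_def b_def)
  \<comment> \<open>Every \<open>q i\<close> with i \<le> n lies on an \<open>a\<close>-colored edge
    of the path, and \<open>x\<close> misses \<open>a\<close>. Only the last vertex could be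
    \<open>x\<close>, which is why length \<open>Suc n\<close> was requested and only
    \<open>n\<close> edges are kept; the shift recolors edges at \<open>x\<close> alone.\<close>
  have qx: "q i \<noteq> x" if "i \<le> n" for i
  proof
    assume eq: "q i = x"
    show False
    proof (cases "even i")
      case True then show False using col[of i] that eq missD[OF a] by auto
    next
      case False
      then obtain t where t: "i = Suc t" "even t" by (cases i) auto
      then have "c (q t) (q i) = Some a" using col[of t] that by simp
      then have "c (q i) (q t) = Some a" by (rule pcoloring_symD[OF c])
      then show False using eq missD[OF a] by auto
    qed
  qed
  have fk: "fan E d c x y (\<lambda>i. sel (y i)) k" by (rule fan_mono[OF f km])
  obtain f where f: "pcoloring E d f" "f x (y k) = None" "missing d f x = missing d c x"
    "\<forall>u v. u \<noteq> x \<longrightarrow> v \<noteq> x \<longrightarrow> f u v = c u v" "missing d c (y k) \<subseteq> missing d f (y k)"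
    "\<forall>B. x \<in> B \<longrightarrow> y ` {..k} \<subseteq> B \<longrightarrow> augmentable E d f x (y k) B \<longrightarrow> augmentable E d c x (y 0) B"
    using fan_shift[OF c fk] by (elim exE conjE) (rule that)
  define p where "p i = (case i of 0 \<Rightarrow> x | Suc i \<Rightarrow> q i)" for i
  have p: "p 0 = x" "p (Suc i) = q i" for i by (simp_all add: p_def)
  have alt: "altpath d f b a q n"
    unfolding altpath_def
  proof (intro conjI allI impI)
    show "b \<noteq> a" by (rule ab)
    show "b \<in> missing d f (q 0)" using bk f(5) q0 by auto
    show "f (q i) (q (Suc i)) = Some (if even i then a else b)" if "i < n" for i
      using col[of i] f(4) qx[of i] qx[of "Suc i"] that by simp
  qed
  have "inj_on p {..Suc n}"
  proof (intro linorder_inj_onI)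
    fix i l assume il: "i < l" "l \<in> {..Suc n}"
    obtain l' where l': "l = Suc l'" using il by (cases l) auto
    show "p i \<noteq> p l"
    proof (cases i)
      case 0 then show ?thesis using p l' qx[of l'] il by auto
    next
      case (Suc i')
      then show ?thesis using p l' il inj_onD[OF altpath_inj[OF f(1) alt], of i' l'] by auto
    qed
  qed auto
  then have ch: "chain f p a b n"
    unfolding chain_def using f alt a fan_edge[OF c fk, of k] q0 by (simp add: p)
  have "augmentable E d c x y0 B" if "gball E x 1 \<subseteq> B" "augmentable E d f x (p 1) B" for B
  proof -
    have "y ` {..k} \<subseteq> B" using gball_edge[OF fan_edge[OF c fk]] that(1) by auto
    moreover have "x \<in> B" using that(1) by auto
    moreover have "augmentable E d f x (y k) B" using that(2) p(2)[of 0] q0 by simp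
    ultimately show ?thesis using f(6) y by metis
  qed
  then show ?thesis using that[OF ch p(1)] by blast
qed

text \<open>The color of the path edge after the uncolored one is missing at \<open>p i\<close>, so
  \<open>slide\<close> applies again, with the roles of \<open>a\<close> and \<open>b\<close>
  exchanged. The other clauses record what survives: everything off the traversed segment, all other
  colors, and the rest of the path.\<close>

lemma slide_chain:
  assumes ch: "chain f p a b n" and "i \<le> n"
  shows "\<exists>e. pcoloring E d e \<and> e (p i) (p (Suc i)) = None \<and> (p i, p (Suc i)) \<in> E
    \<and> (if even i then a else b) \<in> missing d e (p i) \<and> (if even i then b else a) \<in> missing d e (p (Suc i))
    \<and> (\<forall>u v. u \<notin> p ` {..Suc i} \<longrightarrow> e u v = f u v)
    \<and> (\<forall>h u v. h \<noteq> a \<longrightarrow> h \<noteq> b \<longrightarrow> (e u v = Some h) = (f u v = Some h))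
    \<and> (\<forall>j. i < j \<longrightarrow> j \<le> n \<longrightarrow> e (p j) (p (Suc j)) = f (p j) (p (Suc j)))
    \<and> (\<forall>B. p ` {..Suc i} \<subseteq> B \<longrightarrow> augmentable E d e (p i) (p (Suc i)) B \<longrightarrow> augmentable E d f (p 0) (p 1) B)"
  using \<open>i \<le> n\<close>
proof (induction i)
  case 0
  then show ?case using ch by (intro exI[of _ f]) (auto simp: chain_def altpath_def)
next
  case (Suc i)
  have inj: "p s = p t \<longleftrightarrow> s = t" if "s \<le> Suc n" "t \<le> Suc n" for s t
    using ch that by (auto simp: chain_def dest: inj_onD)
  have ab: "b \<noteq> a" and col: "f (p (Suc i)) (p (Suc (Suc i))) = Some (if even i then a else b)" 
    using ch Suc.prems by (auto simp: chain_def altpath_def)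
  have "i \<le> n" using Suc.prems by simp
  obtain e where e: "pcoloring E d e" "e (p i) (p (Suc i)) = None" "(p i, p (Suc i)) \<in> E"
    "(if even i then a else b) \<in> missing d e (p i)" "(if even i then b else a) \<in> missing d e (p (Suc i))"
    "\<forall>u v. u \<notin> p ` {..Suc i} \<longrightarrow> e u v = f u v"
    "\<forall>h u v. h \<noteq> a \<longrightarrow> h \<noteq> b \<longrightarrow> (e u v = Some h) = (f u v = Some h)"
    "\<forall>j. i < j \<longrightarrow> j \<le> n \<longrightarrow> e (p j) (p (Suc j)) = f (p j) (p (Suc j))"
    "\<forall>B. p ` {..Suc i} \<subseteq> B \<longrightarrow> augmentable E d e (p i) (p (Suc i)) B \<longrightarrow> augmentable E d f (p 0) (p 1) B"
    using Suc.IH[OF \<open>i \<le> n\<close>] by (elim exE conjE) (rule that)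
  let ?g = "if even i then a else b" and ?h = "if even i then b else a"
  have vw: "e (p (Suc i)) (p (Suc (Suc i))) = Some ?g"
    using e(8) col Suc.prems by simp
  let ?e = "recolor (recolor e (p (Suc i)) (p (Suc (Suc i))) None) (p i) (p (Suc i)) (Some ?g)"
  note sl = slide[OF e(1-3) vw e(4)]
  have hg: "?h \<noteq> ?g" using ab by auto
  show ?case
  proof (intro exI[of _ ?e] conjI allI impI)
    show "pcoloring E d ?e" "?e (p (Suc i)) (p (Suc (Suc i))) = None" "(p (Suc i), p (Suc (Suc i))) \<in> E"
      by (rule sl)+
    have "?h \<in> missing d ?e (p (Suc i))" using sl(8)[OF hg] e(5) by blast
    then show "(if even (Suc i) then a else b) \<in> missing d ?e (p (Suc i))" by (simp split: if_splits)
    show "(if even (Suc i) then b else a) \<in> missing d ?e (p (Suc (Suc i)))"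
      using sl(9) by (simp split: if_splits)
    show "?e u v = f u v" if "u \<notin> p ` {..Suc (Suc i)}" for u v
    proof -
      have "u \<noteq> p i" "u \<noteq> p (Suc i)" "u \<noteq> p (Suc (Suc i))" and u: "u \<notin> p ` {..Suc i}" using that by auto
      then have "?e u v = e u v" by (intro sl(6)) (auto simp: doubleton_eq_iff)
      then show ?thesis using e(6) u by simp
    qed
    show "(?e u v = Some h) = (f u v = Some h)" if "h \<noteq> a" "h \<noteq> b" for h u v
      using sl(7)[of h u v] e(7) that by (simp split: if_splits)
    show "?e (p j) (p (Suc j)) = f (p j) (p (Suc j))" if "Suc i < j" "j \<le> n" for j
    proof -
      have "?e (p j) (p (Suc j)) = e (p j) (p (Suc j))"
        using that Suc.prems by (intro sl(6)) (auto simp: doubleton_eq_iff inj)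
      then show ?thesis using e(8) that by simp
    qed
    fix B assume B: "p ` {..Suc (Suc i)} \<subseteq> B" and "augmentable E d ?e (p (Suc i)) (p (Suc (Suc i))) B"
    then have "augmentable E d e (p i) (p (Suc i)) B"
      by (intro sl(12)) auto
    moreover have "p ` {..Suc i} \<subseteq> B" using B by auto
    ultimately show "augmentable E d f (p 0) (p 1) B" using e(9) by blast
  qed
qed

text \<open>An inner path vertex has an edge of each of the two colors, so whatever it misses is a
  third color. This is what makes a second fan independent of the slides possible.\<close>

lemma chain_inner:
  assumes ch: "chain f p a b n" and t: "2 \<le> t" "t \<le> n"
  shows "a \<notin> missing d f (p t)" "b \<notin> missing d f (p t)"
proof -
  have f: "pcoloring E d f" and col: "\<And>i. i < n \<Longrightarrow> f (p (Suc i)) (p (Suc (Suc i))) = Some (if even i then a else b)"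
    using ch by (auto simp: chain_def altpath_def)
  obtain s where s: "t = Suc (Suc s)" using t by (metis add_2_eq_Suc le_Suc_ex)
  have 1: "f (p t) (p (Suc t)) = Some (if even (Suc s) then a else b)" using col[of "Suc s"] s t by simp
  have "f (p (Suc s)) (p t) = Some (if even s then a else b)"
    using col[of s] s t by simp
  then have 2: "f (p t) (p (Suc s)) = Some (if even s then a else b)" by (rule pcoloring_symD[OF f])
  show "a \<notin> missing d f (p t)" "b \<notin> missing d f (p t)"
    using 1 2 missD[of a d f "p t"] missD[of b d f "p t"] by (cases "even s"; auto)+
qed

text \<open>
  The second Vizing fan, at the vertex \<open>p i\<close> to which the uncolored edge has been moved, uses colors
  other than \<open>a\<close> and \<open>b\<close> wherever possible, as these were not affected by the move. A fan vertex
  missing only colors among \<open>a\<close> and \<open>b\<close> can be made to lack the one of them that is missing at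
  \<open>p i\<close>, by flipping its short component.
\<close>

lemma second_fan:
  assumes ch: "chain f p a b n" and i: "2 \<le> i" "i < n" and K: "K < n"
    and far: "p 0 \<notin> gball E (p i) (Suc K)"
    and short: "\<And>w g h q. (p i, w) \<in> E \<Longrightarrow> q 0 = w \<Longrightarrow> \<not> altpath d f g h q K"
    and B: "gball E (p i) (Suc K) \<subseteq> B" "p ` {..Suc i} \<subseteq> B"
  shows "augmentable E d f (p 0) (p 1) B"
proof -
  let ?u = "p i"
  have f: "pcoloring E d f" and ab: "b \<noteq> a"
    and alt: "altpath d f b a (\<lambda>i. p (Suc i)) n" and inj: "inj_on p {..Suc n}"
    using ch by (auto simp: chain_def altpath_def)
  have "i \<le> n" using i by simp
  obtain e where e: "pcoloring E d e" "e ?u (p (Suc i)) = None" "(?u, p (Suc i)) \<in> E"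
    "(if even i then a else b) \<in> missing d e ?u" "(if even i then b else a) \<in> missing d e (p (Suc i))"
    "\<forall>u v. u \<notin> p ` {..Suc i} \<longrightarrow> e u v = f u v"
    "\<forall>h u v. h \<noteq> a \<longrightarrow> h \<noteq> b \<longrightarrow> (e u v = Some h) = (f u v = Some h)"
    "\<forall>j. i < j \<longrightarrow> j \<le> n \<longrightarrow> e (p j) (p (Suc j)) = f (p j) (p (Suc j))"
    "\<forall>B. p ` {..Suc i} \<subseteq> B \<longrightarrow> augmentable E d e ?u (p (Suc i)) B \<longrightarrow> augmentable E d f (p 0) (p 1) B"
    using slide_chain[OF ch \<open>i \<le> n\<close>] by (elim exE conjE) (rule that)
  have out: "missing d e z - {a, b} = missing d f z - {a, b}" for z
    using e(7) by (auto simp: missing_def)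
  \<comment> \<open>Slides do not touch the other colors, so inner path vertices still miss one of
    them.\<close>
  have inner: "missing d e (p t) - {a, b} \<noteq> {}" if "2 \<le> t" "t \<le> n" for t
    using chain_inner[OF ch that] missing_nonempty[OF f, of "p t"] unfolding out by auto
  have noalt: "\<not> altpath d e g h q K" if "(?u, w) \<in> E" "q 0 = w" "g \<noteq> a" "g \<noteq> b" "h \<noteq> a" "h \<noteq> b" for w g h q
  proof
    assume "altpath d e g h q K"
    then have "altpath d f g h q K"
      using that e(7) by (auto simp: altpath_def missing_def split: if_splits)
    then show False using short that by blast
  qed
  define sel where "sel z = (SOME h. if missing d e z \<subseteq> {a, b} then h \<in> missing d e z else h \<in> missing d e z - {a, b})" for z
  have sel': "if missing d e z \<subseteq> {a, b} then sel z \<in> missing d e z else sel z \<in> missing d e z - {a, b}" for z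
    unfolding sel_def by (rule someI_ex) (use missing_nonempty[OF e(1), of z] in auto)
  have sel: "sel z \<in> missing d e z" for z using sel'[of z] by (auto split: if_splits)
  obtain y m where y: "y 0 = p (Suc i)" and fan: "fan E d e ?u y (\<lambda>i. sel (y i)) m"
    and injs: "inj_on (\<lambda>i. sel (y i)) {..<m}"
    and stop: "sel (y m) \<in> missing d e ?u \<or> (\<exists>j<m. sel (y j) = sel (y m))"
    by (rule fan_exists[OF e(1-3) sel])
  have B1: "gball E ?u 1 \<subseteq> B" using B(1) gball_mono[of 1 "Suc K" E ?u] by auto
  have "augmentable E d e ?u (y 0) B"
  proof (cases "\<exists>k\<le>m. sel (y k) \<in> {a, b}")
    case True
    \<comment> \<open>The first leaf whose missing colors all lie in {a, b}. The fan colors before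
      it avoid both, so a switch of these two colors does not damage the fan.\<close>
    define k where "k = (LEAST k. k \<le> m \<and> sel (y k) \<in> {a, b})"
    have k: "k \<le> m" "sel (y k) \<in> {a, b}"
      using LeastI_ex[OF True] unfolding k_def by auto
    have less: "sel (y i) \<notin> {a, b}" if "i < k" for i
      using not_less_Least[of i "\<lambda>k. k \<le> m \<and> sel (y k) \<in> {a, b}"] that k(1) unfolding k_def by auto
    have fank: "fan E d e ?u y (\<lambda>i. sel (y i)) k" by (rule fan_mono[OF fan k(1)])
    let ?z = "y k"
    have uz: "(?u, ?z) \<in> E" by (rule fan_edge[OF e(1) fank]) simp
    have mz: "missing d e ?z \<subseteq> {a, b}" using sel'[of ?z] k(2) by (auto split: if_splits)
    define g where "g = (if even i then a else b)"
    define h where "h = (if even i then b else a)"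
    have gu: "g \<in> missing d e ?u" using e(4) by (simp add: g_def)
    have gh: "h \<noteq> g" "{a, b} = {g, h}" using ab by (auto simp: g_def h_def)
    show ?thesis
    proof (cases "g \<in> missing d e ?z")
      case True
      show ?thesis by (rule fan_done[OF e(1) fank gu True B1])
    next
      case False
      then have hz: "h \<in> missing d e ?z" using mz gh(2) sel[of ?z] by (metis insertE singletonD subsetD)
      \<comment> \<open>\<open>p 0\<close> is too far away, \<open>p 1\<close> starts a long
        alternating path and so is no neighbor of \<open>p i\<close>, and the later vertices miss a
        third color. Hence the slides did not affect this leaf.\<close>
      have zp: "?z \<notin> p ` {..Suc i}"
      proof
        assume "?z \<in> p ` {..Suc i}"
        then obtain t where t: "?z = p t" "t \<le> Suc i" by auto
        consider "t = 0" | "t = 1" | "2 \<le> t" by linarith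
        then show False
        proof cases
          case 1
          then show False using far gball_edge[OF uz] gball_mono[of 1 "Suc K" E ?u] t by auto
        next
          case 2
          have "altpath d f b a (\<lambda>i. p (Suc i)) K" using alt K by (simp add: altpath_def)
          then show False using short[OF uz, of "\<lambda>i. p (Suc i)"] 2 t by simp
        next
          case 3
          then show False using inner[of t] t i mz by auto
        qed
      qed
      then have "missing d f ?z = missing d e ?z" using e(6) by (simp add: missing_def)
      with hz have hz': "h \<in> missing d f ?z" by simp
      have "\<not> (\<exists>q. q 0 = ?z \<and> altpath d f h g q K)" using short[OF uz] by blast
      then obtain C w0 where C: "?z \<in> C" "kempe_closed f h g C" "C \<subseteq> gball E ?z K" "finite C" "card C \<le> K"
        "\<forall>w\<in>C. h \<in> missing d f w \<or> g \<in> missing d f w \<longrightarrow> w = ?z \<or> w = w0"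
        "\<forall>C'. kempe_closed f h g C' \<longrightarrow> C \<inter> C' \<noteq> {} \<longrightarrow> C \<subseteq> C'"
        by (rule short_component[OF f gh(1) hz'])
      have CB: "C \<subseteq> gball E ?u (Suc K)"
        using C(3) gball_trans[OF gball_edge[OF uz]] by fastforce
      \<comment> \<open>Meeting the path at a positive index would force all its n + 1 vertices into
        a set of at most \<open>K\<close> elements; \<open>p 0\<close> lies outside the ball
        containing \<open>C\<close>. So \<open>C\<close> is the same in \<open>e\<close> as in
        \<open>f\<close>.\<close>
      have Cp: "p t \<notin> C" if "t \<le> Suc n" for t
      proof
        assume tC: "p t \<in> C"
        show False
        proof (cases t)
          case 0 then show False using tC CB far by auto
        next
          case (Suc s)
          have "(\<lambda>i. p (Suc i)) ` {..n} \<subseteq> C"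
          proof (rule kempe_closed_path[OF f C(2)])
            show "f (p (Suc j)) (p (Suc (Suc j))) = Some h \<or> f (p (Suc j)) (p (Suc (Suc j))) = Some g" if "j < n" for j
              using alt that gh(2) by (auto simp: altpath_def doubleton_eq_iff)
          qed (use Suc tC that in auto)
          moreover have "inj_on (\<lambda>i. p (Suc i)) {..n}" by (rule altpath_inj[OF f alt])
          ultimately have "Suc n \<le> card C" using C(4) card_mono card_image
            by (metis card_atMost)
          then show False using C(5) K by simp
        qed
      qed
      have same: "e v w = f v w" if "v \<in> C" for v w
      proof -
        have "v \<notin> p ` {..Suc i}" using Cp that i by fastforce
        then show ?thesis using e(6) by simp
      qed
      have Ce: "kempe_closed e h g C"
        unfolding kempe_closed_def
      proof (intro ballI allI impI)
        fix v w assume v: "v \<in> C" and vw: "e v w = Some h \<or> e v w = Some g"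
        have "f v w = Some h \<or> f v w = Some g" using vw unfolding same[OF v] .
        then show "w \<in> C" by (rule kclosedD[OF C(2) v])
      qed
      show ?thesis
      proof (rule fan_kempe_flip[OF e(1) fank gu hz Ce])
        show "?u \<notin> C" using Cp[of i] i by simp
        show "sel (y i) \<noteq> g \<and> sel (y i) \<noteq> h" if "i < k" for i
          using less[OF that] gh(2) by auto
      qed (use C B CB B1 in auto)
    qed
  next
    case False
    \<comment> \<open>Now all fan colors and \<open>a'\<close> avoid {a, b}. The relevant
      alternating paths of \<open>e\<close> are then paths of \<open>f\<close> too, where they are
      known to be short.\<close>
    obtain a' where a': "a' \<in> missing d e ?u" "a' \<noteq> a" "a' \<noteq> b" using inner[of i] i by auto
    show ?thesis
    proof (cases "sel (y m) \<in> missing d e ?u")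
      case True
      show ?thesis by (rule fan_done[OF e(1) fan True sel B1])
    next
      case nm: False
      then obtain j where j: "j < m" "sel (y j) = sel (y m)" using stop by blast
      show ?thesis
      proof (rule vizing_end[OF e(1) fan j injs a'(1) sel _ B(1)])
        fix k and q :: "nat \<Rightarrow> 'v" assume k: "k \<in> {j, m}" and q: "q 0 = y k"
        have "(?u, y k) \<in> E" using fan_edge[OF e(1) fan, of k] k j by auto
        then show "\<not> altpath d e (sel (y m)) a' q K"
          using noalt[of "y k" q "sel (y m)" a'] q a' False by auto
      qed
    qed
  qed
  then show ?thesis using e(9) B(2) y by simp
qed

text \<open>
  Long alternating paths with different starting points may overlap if one traverses the other
  backwards, but then their vertices of even index are still disjoint.
\<close>

lemma card_long_ends:
  assumes f: "pcoloring E d f" and fin: "finite (gball E x (r + 2 * K))" and "finite W"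
    and W: "W \<subseteq> gball E x r" "\<And>w. w \<in> W \<Longrightarrow> \<exists>q. q 0 = w \<and> altpath d f g h q (2 * K)"
  shows "card W * Suc K \<le> card (gball E x (r + 2 * K))"
proof -
  obtain q where q: "\<And>w. w \<in> W \<Longrightarrow> q w 0 = w" "\<And>w. w \<in> W \<Longrightarrow> altpath d f g h (q w) (2 * K)"
    using W(2) by metis
  let ?A = "\<lambda>w. (\<lambda>t. q w (2 * t)) ` {..K}"
  have crd: "card (?A w) = Suc K" if "w \<in> W" for w
  proof -
    have "inj_on (\<lambda>t. q w (2 * t)) {..K}"
      using inj_onD[OF altpath_inj[OF f q(2)[OF that]]] by (intro inj_onI) fastforce
    then show ?thesis by (simp add: card_image)
  qed
  have "card (\<Union>w\<in>W. ?A w) = (\<Sum>w\<in>W. card (?A w))"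
  proof (rule card_UN_disjoint[OF \<open>finite W\<close>])
    show "\<forall>v\<in>W. \<forall>w\<in>W. v \<noteq> w \<longrightarrow> ?A v \<inter> ?A w = {}"
    proof (intro ballI impI)
      fix v w assume vw: "v \<in> W" "w \<in> W" "v \<noteq> w"
      have "q v (2 * s) \<noteq> q w (2 * t)" if "s \<le> K" "t \<le> K" for s t
        using altpath_even_disjoint[OF f q(2)[OF vw(1)] q(2)[OF vw(2)], of s t] q(1) vw that by auto
      then show "?A v \<inter> ?A w = {}" by auto
    qed
  qed auto
  also have "\<dots> = card W * Suc K" using crd by simp
  finally have "card W * Suc K = card (\<Union>w\<in>W. ?A w)" by simp
  also have "\<dots> \<le> card (gball E x (r + 2 * K))"
  proof (rule card_mono[OF fin], clarify)
    fix w t assume w: "w \<in> W" and "t \<le> K"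
    then have "q w (2 * t) \<in> gball E w (2 * K)"
      using altpath_gball[OF f q(2)[OF w], of "2 * t"] q(1)[OF w] gball_mono[of "2 * t" "2 * K" E w] by auto
    moreover have "w \<in> gball E x r" using W(1) w by blast
    ultimately show "q w (2 * t) \<in> gball E x (r + 2 * K)"
      by (rule gball_trans[rotated])
  qed
  finally show ?thesis .
qed

text \<open>If the second fan failed at every position 2 \<le> i < n, each \<open>p i\<close> would
  lie within 2K + 1 of \<open>x\<close> or next to a start of an alternating path of length 2K.
  Growth bounds the first kind directly. For the second, \<open>card_long_ends\<close> bounds the
  starts for each ordered color pair, and a start has at most \<open>d\<close> neighbors.\<close>

theorem local_augmentation:
  assumes fin: "\<And>v n. finite (gball E v n)" and growth: "\<And>v n. card (gball E v n) \<le> A * Suc n"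
  shows "\<exists>s. \<forall>c x y. pcoloring E d c \<longrightarrow> c x y = None \<longrightarrow> (x, y) \<in> E \<longrightarrow> augmentable E d c x y (gball E x s)"
proof -
  \<comment> \<open>\<open>M\<close> collects the degree, the ordered color pairs and the growth
    constant. As K + 1 exceeds 2M, starts block at most half of n + 2K + 2 positions;
    \<open>n\<close> is then more than twice the number of positions near \<open>x\<close> plus the
    remaining terms.\<close>
  define M where "M = d * (Suc d * Suc d) * A"
  define K where "K = Suc (2 * M)"
  define n where "n = 2 * A * (2 * K + 2) + 2 * K + 8"
  have "augmentable E d c x y (gball E x (n + 2 * K + 5))"
    if c: "pcoloring E d c" and xy: "c x y = None" "(x, y) \<in> E" for c x y
  proof (rule ccontr)
    let ?B = "gball E x (n + 2 * K + 5)"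
    assume not_aug: "\<not> augmentable E d c x y ?B"
    have sub: "gball E x (n + 2) \<subseteq> ?B" by (rule gball_mono) simp
    have "\<not> augmentable E d c x y (gball E x (n + 2))"
      using not_aug augmentable_mono[OF _ sub] by (rule contrapos_nn)
    then obtain f p a b where ch: "chain f p a b n" and p0: "p 0 = x"
      and tr: "\<forall>B. gball E x 1 \<subseteq> B \<longrightarrow> augmentable E d f x (p 1) B \<longrightarrow> augmentable E d c x y B"
      by (rule vizing_chain[OF c xy])
    have f: "pcoloring E d f" and p01: "(p 0, p 1) \<in> E" and alt: "altpath d f b a (\<lambda>i. p (Suc i)) n"
      and inj: "inj_on p {..Suc n}"
      using ch by (auto simp: chain_def)
    have "gball E x 1 \<subseteq> ?B" by (rule gball_mono) simp
    then have nf: "\<not> augmentable E d f (p 0) (p 1) ?B" using tr[rule_format, of ?B] not_aug p0 by auto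
    have pb: "p i \<in> gball E x i" if "i \<le> Suc n" for i
    proof (cases i)
      case 0 then show ?thesis using p0 by simp
    next
      case (Suc j)
      then have "p i \<in> gball E (p 1) j" using altpath_gball[OF f alt, of j] that by simp
      moreover have "p 1 \<in> gball E x 1" using gball_edge[OF p01] p0 by simp
      ultimately show ?thesis using gball_trans[of "p 1" E x 1 "p i" j] Suc by simp
    qed
    define L where "L g h = {w \<in> gball E x (Suc n). \<exists>q. q 0 = w \<and> altpath d f g h q (2 * K)}" for g h
    define W where "W = (\<Union>g\<in>{..d}. \<Union>h\<in>{..d}. L g h)"
    have finL: "finite (L g h)" for g h unfolding L_def using fin by simp
    have finW: "finite W" unfolding W_def using finL by blast
    let ?N = "card (gball E x (Suc n + 2 * K))"
    have cardL: "card (L g h) * Suc K \<le> ?N" for g h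
      by (rule card_long_ends[OF f fin finL]) (auto simp: L_def)
    have "card W \<le> (\<Sum>g\<in>{..d}. \<Sum>h\<in>{..d}. card (L g h))"
      unfolding W_def by (rule order_trans[OF card_UN_le]) (auto intro!: sum_mono card_UN_le)
    then have "card W * Suc K \<le> (\<Sum>g\<in>{..d}. \<Sum>h\<in>{..d}. card (L g h)) * Suc K"
      by (rule mult_le_mono1)
    also have "\<dots> = (\<Sum>g\<in>{..d}. \<Sum>h\<in>{..d}. card (L g h) * Suc K)"
      by (simp only: sum_distrib_right)
    also have "\<dots> \<le> (\<Sum>g\<in>{..d}. \<Sum>h\<in>{..d}. ?N)"
      by (intro sum_mono cardL)
    also have "\<dots> = Suc d * Suc d * ?N" by (simp add: algebra_simps)
    also have "\<dots> \<le> Suc d * Suc d * (A * Suc (Suc n + 2 * K))"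
      by (intro mult_le_mono2 growth)
    finally have "d * (card W * Suc K) \<le> d * (Suc d * Suc d * (A * Suc (Suc n + 2 * K)))"
      by (rule mult_le_mono2)
    then have dW: "(d * card W) * Suc K \<le> M * (n + 2 * K + 2)"
      by (simp add: M_def algebra_simps)
    have dW2: "2 * (d * card W) \<le> n + 2 * K + 2"
    proof (cases "M = 0")
      case True then show ?thesis using dW by auto
    next
      case False
      have "M * (2 * (d * card W)) \<le> M * (n + 2 * K + 2)" using dW by (simp add: K_def algebra_simps)
      with False show ?thesis unfolding mult_le_cancel1 by blast
    qed
    have bad: "p i \<in> gball E x (Suc (2 * K)) \<or> (\<exists>w\<in>W. (w, p i) \<in> E)" if i: "2 \<le> i" "i < n" for i
    proof (rule ccontr)
      assume good: "\<not> ?thesis"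
      have "augmentable E d f (p 0) (p 1) ?B"
      proof (rule second_fan[OF ch i, of "2 * K"])
        show "2 * K < n" by (simp add: n_def)
        show "p 0 \<notin> gball E (p i) (Suc (2 * K))" using good gball_sym[OF symE] p0 by blast
        show "\<not> altpath d f g h q (2 * K)" if w: "(p i, w) \<in> E" "q 0 = w" for w g h q
        proof
          assume q: "altpath d f g h q (2 * K)"
          have "w \<in> gball E x (Suc i)" by (rule gball_step[OF pb w(1)]) (use i in simp)
          then have wb: "w \<in> gball E x (Suc n)" using gball_mono[of "Suc i" "Suc n" E x] i by auto
          have "g \<le> d" using q by (auto simp: altpath_def missing_def)
          moreover have "h \<le> d"
          proof -
            \<comment> \<open>\<open>K\<close> is positive, so the path has a first edge, and it has
              color \<open>h\<close>.\<close>
            have "f (q 0) (q 1) = Some h" using q by (auto simp: altpath_def K_def)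
            then show ?thesis by (rule pcoloring_le[OF f])
          qed
          moreover have "w \<in> L g h" unfolding L_def using wb q w(2) by blast
          ultimately have "w \<in> W" unfolding W_def by blast
          then show False using good w(1) symED by blast
        qed
        show "gball E (p i) (Suc (2 * K)) \<subseteq> ?B"
        proof
          fix z assume "z \<in> gball E (p i) (Suc (2 * K))"
          then have "z \<in> gball E x (i + Suc (2 * K))" using gball_trans[OF pb[of i], of z "Suc (2 * K)"] i by simp
          then show "z \<in> ?B" using gball_mono[of "i + Suc (2 * K)" "n + 2 * K + 5" E x] i by auto
        qed
        show "p ` {..Suc i} \<subseteq> ?B"
        proof clarify
          fix t assume "t \<le> Suc i"
          then show "p t \<in> ?B" using pb[of t] gball_mono[of t "n + 2 * K + 5" E x] i by auto
        qed
      qed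
      then show False using nf by simp
    qed
    let ?I1 = "{i\<in>{2..<n}. p i \<in> gball E x (Suc (2 * K))}"
    let ?I2 = "\<lambda>w. {i\<in>{2..<n}. (w, p i) \<in> E}"
    have "{2..<n} \<subseteq> ?I1 \<union> (\<Union>w\<in>W. ?I2 w)"
    proof
      fix i assume "i \<in> {2..<n}"
      then show "i \<in> ?I1 \<union> (\<Union>w\<in>W. ?I2 w)" using bad[of i] by auto
    qed
    then have "card {2..<n} \<le> card (?I1 \<union> (\<Union>w\<in>W. ?I2 w))"
      by (rule card_mono[rotated]) (use finW in auto)
    also have "\<dots> \<le> card ?I1 + card (\<Union>w\<in>W. ?I2 w)" by (rule card_Un_le)
    also have "card ?I1 \<le> card (gball E x (Suc (2 * K)))"
    proof (rule card_inj_on_le[of p])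
      show "inj_on p ?I1" by (rule inj_on_subset[OF inj]) auto
    qed (use fin in auto)
    also have "\<dots> \<le> A * Suc (Suc (2 * K))" by (rule growth)
    also have "card (\<Union>w\<in>W. ?I2 w) \<le> (\<Sum>w\<in>W. card (?I2 w))" by (rule card_UN_le[OF finW])
    also have "\<dots> \<le> (\<Sum>w\<in>W. d)"
    proof (rule sum_mono)
      fix w
      have "card (?I2 w) \<le> card {v. (w, v) \<in> E}"
      proof (rule card_inj_on_le[of p])
        show "inj_on p (?I2 w)" by (rule inj_on_subset[OF inj]) auto
      qed (use finite_nbrs in auto)
      then show "card (?I2 w) \<le> d" using card_nbrs le_trans by blast
    qed
    also have "\<dots> = d * card W" by simp
    finally have "n - 2 \<le> A * Suc (Suc (2 * K)) + d * card W" by simp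
    then have "2 * (n - 2) \<le> 2 * (A * Suc (Suc (2 * K))) + 2 * (d * card W)" by simp
    also have "\<dots> \<le> 2 * (A * Suc (Suc (2 * K))) + (n + 2 * K + 2)" using dW2 by simp
    finally have "n \<le> 2 * (A * Suc (Suc (2 * K))) + 2 * K + 6" by simp
    then show False by (simp add: n_def algebra_simps)
  qed
  then show ?thesis by blast
qed

end

section \<open>Sets with finite coboundary in a two-ended graph\<close>

text \<open>Only pairs directed out of the set are recorded; for a symmetric \<open>E\<close> each
  boundary edge is counted once.\<close>

definition finite_coboundary :: "('v \<times> 'v) set \<Rightarrow> 'v set \<Rightarrow> bool" where
  "finite_coboundary E A \<longleftrightarrow> finite (E \<inter> A \<times> (- A))"

lemma finite_coboundary_Int: "finite_coboundary E A \<Longrightarrow> finite_coboundary E B \<Longrightarrow> finite_coboundary E (A \<inter> B)"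
  unfolding finite_coboundary_def
  by (rule finite_subset[of _ "(E \<inter> A \<times> (- A)) \<union> (E \<inter> B \<times> (- B))"]) auto

lemma finite_coboundary_compl:
  assumes "sym E" "finite_coboundary E A" "E \<subseteq> V \<times> V"
  shows "finite_coboundary E (V - A)"
proof -
  have "E \<inter> (V - A) \<times> (- (V - A)) \<subseteq> prod.swap ` (E \<inter> A \<times> (- A))"
  proof
    fix p assume p: "p \<in> E \<inter> (V - A) \<times> (- (V - A))"
    obtain u v where uv: "p = (u, v)" by (cases p)
    then have "(v, u) \<in> E \<inter> A \<times> (- A)" using p assms(1,3) by (auto dest: symD)
    then show "p \<in> prod.swap ` (E \<inter> A \<times> (- A))" using uv by force
  qed
  then show ?thesis using assms(2) unfolding finite_coboundary_def by (meson finite_imageI finite_subset)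
qed

lemma finite_coboundary_Diff:
  assumes "sym E" "E \<subseteq> V \<times> V" "A \<subseteq> V" "finite_coboundary E A" "finite_coboundary E B"
  shows "finite_coboundary E (A - B)"
proof -
  have "A - B = A \<inter> (V - B)" using assms by auto
  then show ?thesis using finite_coboundary_Int[OF assms(4) finite_coboundary_compl[OF assms(1,5,2)]] by simp
qed

text \<open>Koenig's lemma for the breadth-first layering of \<open>A\<close> from its inner
  boundary. That boundary is finite, and every vertex of \<open>A\<close> meets it, inside
  \<open>A\<close>, on the way to the outside point \<open>z\<close>.\<close>

lemma ray_in_finite_coboundary:
  assumes E: "sym E" and lf: "\<And>v. finite {w. (v, w) \<in> E}"
    and conn: "\<And>v w. v \<in> V \<Longrightarrow> w \<in> V \<Longrightarrow> (v, w) \<in> E\<^sup>*"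
    and A: "A \<subseteq> V" "z \<in> V" "z \<notin> A" "infinite A" "finite_coboundary E A"
  shows "\<exists>r\<in>rays E. \<forall>n. r n \<in> A"
proof -
  define D where "D = {v \<in> A. \<exists>w. w \<notin> A \<and> (v, w) \<in> E}"
  have "D = fst ` (E \<inter> A \<times> (- A))" unfolding D_def by force
  then have "finite D" using A(5) by (simp add: finite_coboundary_def)
  define R where "R = E \<inter> A \<times> A"
  have symR: "sym (R\<^sup>*)" using E by (intro sym_rtrancl) (auto simp: R_def sym_def)
  have "(v, w) \<in> E\<^sup>* \<Longrightarrow> w \<notin> A \<Longrightarrow> v \<in> A \<Longrightarrow> \<exists>d\<in>D. (v, d) \<in> R\<^sup>*" for v w
  proof (induction rule: converse_rtrancl_induct)
    case (step y u)
    show ?case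
    proof (cases "u \<in> A")
      case True
      then obtain d where "d \<in> D" "(u, d) \<in> R\<^sup>*" using step by blast
      moreover have "(y, u) \<in> R" using step True by (simp add: R_def)
      ultimately show ?thesis by (meson converse_rtrancl_into_rtrancl)
    next
      case False
      then have "y \<in> D" using step by (auto simp: D_def)
      then show ?thesis by blast
    qed
  qed simp
  then have toD: "\<exists>d\<in>D. (d, v) \<in> R\<^sup>*" if "v \<in> A" for v
    using conn[of v z] that A symD[OF symR] by blast
  define Q where "Q v k \<longleftrightarrow> (\<exists>d\<in>D. (d, v) \<in> R ^^ k)" for v k
  define lev where "lev v = (LEAST k. Q v k)" for v
  have lev: "Q v (lev v)" if "v \<in> A" for v
    unfolding lev_def
  proof (rule LeastI_ex)
    show "\<exists>k. Q v k" using toD[OF that] rtrancl_imp_relpow unfolding Q_def by metis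
  qed
  have lev_le: "lev v \<le> k" if "Q v k" for v k using that unfolding lev_def by (rule Least_le)
  \<comment> \<open>Edges that raise the distance to \<open>D\<close> within \<open>A\<close> by
    exactly one; following them forever visits no vertex twice.\<close>
  define P where "P = {(u, v). (u, v) \<in> R \<and> lev v = Suc (lev u)}"
  have "lev v = n \<Longrightarrow> v \<in> A \<Longrightarrow> \<exists>d\<in>D. (d, v) \<in> P\<^sup>*" for n v
  proof (induction n arbitrary: v)
    case 0
    then have "v \<in> D" using lev[of v] by (auto simp: Q_def)
    then show ?case by blast
  next
    case (Suc n)
    then have "Q v (Suc n)" using lev[of v] by simp
    then obtain d u where d: "d \<in> D" "(d, u) \<in> R ^^ n" "(u, v) \<in> R" by (auto simp: Q_def)
    then have u: "u \<in> A" "lev u \<le> n" using lev_le[of u n] by (auto simp: R_def Q_def)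
    obtain d' where d': "d' \<in> D" "(d', u) \<in> R ^^ lev u" using lev[OF u(1)] by (auto simp: Q_def)
    then have "Q v (Suc (lev u))" using d(3) unfolding Q_def by auto
    then have "Suc n \<le> Suc (lev u)" using lev_le[of v] Suc.prems by fastforce
    then have lu: "lev u = n" using u(2) by simp
    then have "(u, v) \<in> P" using d(3) Suc.prems by (simp add: P_def)
    moreover obtain d'' where "d'' \<in> D" "(d'', u) \<in> P\<^sup>*" using Suc.IH[OF lu u(1)] by blast
    ultimately show ?case by (meson rtrancl_into_rtrancl)
  qed
  then have "A \<subseteq> (\<Union>d\<in>D. P\<^sup>* `` {d})" by blast
  then obtain d where d: "d \<in> D" "infinite (P\<^sup>* `` {d})"
    using A(4) \<open>finite D\<close> by (meson finite_UN_I finite_subset)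
  have step: "\<exists>v. infinite (P\<^sup>* `` {v}) \<and> (u, v) \<in> P" if "infinite (P\<^sup>* `` {u})" for u
  proof (rule ccontr)
    assume n: "\<not> ?thesis"
    have "P\<^sup>* `` {u} \<subseteq> {u} \<union> (\<Union>v\<in>{v. (u, v) \<in> P}. P\<^sup>* `` {v})"
      by (auto elim: converse_rtranclE)
    moreover have "finite {v. (u, v) \<in> P}"
      by (rule finite_subset[OF _ lf[of u]]) (auto simp: P_def R_def)
    ultimately have "finite (P\<^sup>* `` {u})" using n
      by (intro finite_subset[of "P\<^sup>* `` {u}" "{u} \<union> (\<Union>v\<in>{v. (u, v) \<in> P}. P\<^sup>* `` {v})"]) auto
    then show False using that by simp
  qed
  obtain r where r: "\<And>n. infinite (P\<^sup>* `` {r n}) \<and> (r n, r (Suc n)) \<in> P"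
    using dependent_nat_choice[of "\<lambda>_ u. infinite (P\<^sup>* `` {u})" "\<lambda>_ u v. (u, v) \<in> P"] d(2) step by blast
  have "lev (r n) = lev (r 0) + n" for n
  proof (induction n)
    case (Suc n) then show ?case using r[of n] by (simp add: P_def)
  qed simp
  then have "inj r" by (metis (no_types) add_left_cancel injI)
  moreover have "(r n, r (Suc n)) \<in> R" for n using r[of n] by (simp add: P_def)
  ultimately show ?thesis by (intro bexI[of _ r]) (auto simp: rays_def R_def)
qed

text \<open>Deleting the finitely many inner endpoints of boundary edges leaves no way out of
  \<open>A\<close>.\<close>

lemma rays_separated:
  assumes "finite_coboundary E A" "\<And>n. r n \<in> A" "\<And>n. r' n \<notin> A"
  shows "(r, r') \<notin> ray_equiv E"
proof
  assume eq: "(r, r') \<in> ray_equiv E"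
  define F where "F = fst ` (E \<inter> A \<times> (- A))"
  have "finite F" using assms(1) by (simp add: F_def finite_coboundary_def)
  then obtain N where N: "\<forall>i\<ge>N. \<forall>j\<ge>N. same_component_avoiding E F (r i) (r' j)"
    using ray_equivD[OF eq] by blast
  then have "(r N, r' N) \<in> (E \<inter> (- F) \<times> (- F))\<^sup>*" by (auto simp: same_component_avoiding_def)
  then have "r' N \<in> A"
  proof (induction rule: rtrancl_induct)
    case base show ?case by (rule assms(2))
  next
    case (step y z)
    then show ?case unfolding F_def by force
  qed
  then show False using assms(3) by blast
qed

text \<open>Each of the three sets would contain a ray, and disjointness makes these rays pairwise
  inequivalent, giving three ends.\<close>

lemma no_three_finite_coboundary:
  assumes E: "sym E" and lf: "\<And>v. finite {w. (v, w) \<in> E}"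
    and conn: "\<And>v w. v \<in> V \<Longrightarrow> w \<in> V \<Longrightarrow> (v, w) \<in> E\<^sup>*"
    and two: "card (ends E) = 2"
    and A: "A \<subseteq> V" "infinite A" "finite_coboundary E A" and B: "B \<subseteq> V" "infinite B" "finite_coboundary E B"
    and C: "C \<subseteq> V" "infinite C" "finite_coboundary E C"
    and disj: "A \<inter> B = {}" "A \<inter> C = {}" "B \<inter> C = {}"
  shows False
proof -
  have ne: "\<exists>z. z \<in> X" if "infinite X" for X :: "'a set"
    using infinite_imp_nonempty[OF that] by blast
  obtain a b where "a \<in> A" "b \<in> B" using ne A B by metis
  then have a: "a \<in> V" "a \<notin> B" "a \<notin> C" and b: "b \<in> V" "b \<notin> A"
    using A B disj by auto
  obtain r1 where r1: "r1 \<in> rays E" "\<And>n. r1 n \<in> A"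
    using ray_in_finite_coboundary[OF E lf conn A(1) b A(2,3)] by blast
  obtain r2 where r2: "r2 \<in> rays E" "\<And>n. r2 n \<in> B"
    using ray_in_finite_coboundary[OF E lf conn B(1) a(1,2) B(2,3)] by blast
  obtain r3 where r3: "r3 \<in> rays E" "\<And>n. r3 n \<in> C"
    using ray_in_finite_coboundary[OF E lf conn C(1) a(1,3) C(2,3)] by blast
  note eq = equiv_ray_equiv[OF E]
  have "(r1, r2) \<notin> ray_equiv E" "(r1, r3) \<notin> ray_equiv E" "(r2, r3) \<notin> ray_equiv E"
    using rays_separated[OF A(3), of r1] rays_separated[OF B(3), of r2] r1 r2 r3 disj by blast+
  then have "ray_equiv E `` {r1} \<noteq> ray_equiv E `` {r2}" "ray_equiv E `` {r1} \<noteq> ray_equiv E `` {r3}"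
    "ray_equiv E `` {r2} \<noteq> ray_equiv E `` {r3}"
    using eq_equiv_class_iff[OF eq] r1(1) r2(1) r3(1) by blast+
  then have "card {ray_equiv E `` {r1}, ray_equiv E `` {r2}, ray_equiv E `` {r3}} = 3" by simp
  moreover have sub: "{ray_equiv E `` {r1}, ray_equiv E `` {r2}, ray_equiv E `` {r3}} \<subseteq> ends E"
    using r1(1) r2(1) r3(1) by (auto simp: ends_def intro: quotientI)
  moreover have "finite (ends E)" using two by (metis card.infinite zero_neq_numeral)
  ultimately show False using card_mono[OF _ sub] two by simp
qed

text \<open>Some finite \<open>F\<close> separates the tails of two inequivalent rays; the witness
  is the component outside \<open>F\<close> that contains a tail of the first. Edges leaving it must
  end in \<open>F\<close>, so local finiteness bounds their number.\<close>

lemma ex_finite_coboundary: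
  assumes E: "sym E" "E \<subseteq> V \<times> V" and lf: "\<And>v. finite {w. (v, w) \<in> E}"
    and two: "card (ends E) = 2"
  obtains A where "A \<subseteq> V" "infinite A" "infinite (V - A)" "finite_coboundary E A"
proof -
  obtain c1 c2 where c: "ends E = {c1, c2}" "c1 \<noteq> c2" using two by (auto simp: card_2_iff)
  then have "c1 \<in> ends E" "c2 \<in> ends E" by auto
  then obtain r r' where r: "r \<in> rays E" "c1 = ray_equiv E `` {r}" and r': "r' \<in> rays E" "c2 = ray_equiv E `` {r'}"
    unfolding ends_def by (meson quotientE)
  have "(r, r') \<notin> ray_equiv E"
    using c(2) r r' eq_equiv_class_iff[OF equiv_ray_equiv[OF E(1)]] by blast
  then have "\<not> (\<forall>F. finite F \<longrightarrow> (\<exists>N. \<forall>i\<ge>N. \<forall>j\<ge>N. same_component_avoiding E F (r i) (r' j)))"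
    using r(1) r'(1) by (simp add: ray_equiv_def)
  then obtain F where F: "finite F" "\<not> (\<exists>N. \<forall>i\<ge>N. \<forall>j\<ge>N. same_component_avoiding E F (r i) (r' j))"
    by (meson)
  have tail: "\<exists>N. \<forall>i\<ge>N. \<forall>j\<ge>N. same_component_avoiding E F (q i) (q j)" if "q \<in> rays E" for q
  proof -
    have "(q, q) \<in> ray_equiv E" using equiv_ray_equiv[OF E(1)] that by (meson equiv_def refl_onD)
    then show ?thesis by (rule ray_equivD[OF _ F(1)])
  qed
  obtain N1 where N1: "\<forall>i\<ge>N1. \<forall>j\<ge>N1. same_component_avoiding E F (r i) (r j)" using tail[OF r(1)] ..
  obtain N2 where N2: "\<forall>i\<ge>N2. \<forall>j\<ge>N2. same_component_avoiding E F (r' i) (r' j)" using tail[OF r'(1)] ..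
  have trans: "same_component_avoiding E F u w" if "same_component_avoiding E F u v" "same_component_avoiding E F v w" for u v w
    using that by (auto simp: same_component_avoiding_def intro: rtrancl_trans)
  define A where "A = {w. same_component_avoiding E F (r N1) w}"
  have rA: "r i \<in> A" if "i \<ge> N1" for i using N1 that by (simp add: A_def)
  have r'A: "r' j \<notin> A" if jN: "j \<ge> N2" for j
  proof
    assume "r' j \<in> A"
    then have j: "same_component_avoiding E F (r N1) (r' j)" by (simp add: A_def)
    have "same_component_avoiding E F (r i) (r' k)" if "i \<ge> max N1 N2" "k \<ge> max N1 N2" for i k
    proof -
      have "same_component_avoiding E F (r i) (r N1)" "same_component_avoiding E F (r' j) (r' k)"
        using N1 N2 that jN by simp_all
      then show ?thesis using j trans by blast
    qed
    then show False using F(2) by blast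
  qed
  have V: "q i \<in> V" if "q \<in> rays E" for q i using that E(2) by (auto simp: rays_def)
  have inf: "infinite (q ` {N..})" if "q \<in> rays E" for q :: "nat \<Rightarrow> 'a" and N
  proof -
    have "inj_on q {N..}" using that by (auto simp: rays_def intro: inj_on_subset)
    then show ?thesis using finite_imageD infinite_Ici by blast
  qed
  have "A \<subseteq> V"
  proof
    fix w assume "w \<in> A"
    then have "(r N1, w) \<in> (E \<inter> (- F) \<times> (- F))\<^sup>*" by (simp add: A_def same_component_avoiding_def)
    then show "w \<in> V" using V[OF r(1)] E(2) by (induction rule: rtrancl_induct) auto
  qed
  moreover have "infinite A"
    using inf[OF r(1), of N1] rA by (meson atLeast_iff finite_subset image_subsetI)
  moreover have "infinite (V - A)"
  proof -
    have "r' ` {N2..} \<subseteq> V - A" using V[OF r'(1)] r'A by auto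
    then show ?thesis using inf[OF r'(1), of N2] by (meson finite_subset)
  qed
  moreover have "finite_coboundary E A"
  proof -
    have "E \<inter> A \<times> (- A) \<subseteq> (\<Union>w\<in>F. (\<lambda>v. (v, w)) ` {v. (w, v) \<in> E})"
    proof
      fix p assume p: "p \<in> E \<inter> A \<times> (- A)"
      obtain u w where uw: "p = (u, w)" by (cases p)
      have "w \<in> F"
      proof (rule ccontr)
        assume "w \<notin> F"
        then have "same_component_avoiding E F u w" using p uw
          by (auto simp: A_def same_component_avoiding_def)
        then have "w \<in> A" using p uw trans by (auto simp: A_def)
        then show False using p uw by simp
      qed
      moreover have "(w, u) \<in> E" using p uw E(1) by (auto dest: symD)
      ultimately show "p \<in> (\<Union>w\<in>F. (\<lambda>v. (v, w)) ` {v. (w, v) \<in> E})" using uw by blast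
    qed
    then show ?thesis unfolding finite_coboundary_def by (rule finite_subset) (use F(1) lf in auto)
  qed
  ultimately show ?thesis by (rule that)
qed

text \<open>At most two of the four corners cut out by \<open>A\<close> and \<open>B\<close> are
  infinite. As \<open>A\<close>, \<open>B\<close> and their complements are infinite, each of them
  needs an infinite corner, so the two infinite corners are opposite.\<close>

lemma two_ends_dichotomy:
  assumes E: "sym E" "E \<subseteq> V \<times> V" and lf: "\<And>v. finite {w. (v, w) \<in> E}"
    and conn: "\<And>v w. v \<in> V \<Longrightarrow> w \<in> V \<Longrightarrow> (v, w) \<in> E\<^sup>*"
    and two: "card (ends E) = 2"
    and A: "A \<subseteq> V" "infinite A" "infinite (V - A)" "finite_coboundary E A"
    and B: "B \<subseteq> V" "infinite B" "infinite (V - B)" "finite_coboundary E B"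
  shows "finite (sym_diff A B) \<or> finite (sym_diff A (V - B))"
proof -
  let ?X1 = "A \<inter> B" and ?X2 = "A - B" and ?X3 = "B - A" and ?X4 = "V - A - B"
  have three: "\<not> (infinite X \<and> infinite Y \<and> infinite Z)"
    if "X \<subseteq> V" "finite_coboundary E X" "Y \<subseteq> V" "finite_coboundary E Y" "Z \<subseteq> V" "finite_coboundary E Z"
      "X \<inter> Y = {}" "X \<inter> Z = {}" "Y \<inter> Z = {}" for X Y Z
  proof
    assume "infinite X \<and> infinite Y \<and> infinite Z"
    then show False
      using no_three_finite_coboundary[of E V X Y Z] E(1) lf conn two that by blast
  qed
  have f: "finite_coboundary E ?X1" "finite_coboundary E ?X2" "finite_coboundary E ?X3" "finite_coboundary E ?X4"
    using finite_coboundary_Int[OF A(4) B(4)] finite_coboundary_Diff[OF E A(1) A(4) B(4)] finite_coboundary_Diff[OF E B(1) B(4) A(4)]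
      finite_coboundary_Diff[OF E _ finite_coboundary_compl[OF E(1) A(4) E(2)] B(4)] by auto
  have s: "?X1 \<subseteq> V" "?X2 \<subseteq> V" "?X3 \<subseteq> V" "?X4 \<subseteq> V" using A B by auto
  have i: "infinite ?X1 \<or> infinite ?X2" "infinite ?X3 \<or> infinite ?X4" "infinite ?X1 \<or> infinite ?X3"
    "infinite ?X2 \<or> infinite ?X4"
  proof -
    have "A = ?X1 \<union> ?X2" "V - A = ?X3 \<union> ?X4" "B = ?X1 \<union> ?X3" "V - B = ?X2 \<union> ?X4" using A B by auto
    then show "infinite ?X1 \<or> infinite ?X2" "infinite ?X3 \<or> infinite ?X4" "infinite ?X1 \<or> infinite ?X3"
    "infinite ?X2 \<or> infinite ?X4" using A(2,3) B(2,3) by (metis finite_UnI)+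
  qed
  have "\<not> (infinite ?X1 \<and> infinite ?X2 \<and> infinite ?X3)" by (rule three[OF s(1) f(1) s(2) f(2) s(3) f(3)]) auto
  moreover have "\<not> (infinite ?X1 \<and> infinite ?X2 \<and> infinite ?X4)" by (rule three[OF s(1) f(1) s(2) f(2) s(4) f(4)]) auto
  moreover have "\<not> (infinite ?X1 \<and> infinite ?X3 \<and> infinite ?X4)" by (rule three[OF s(1) f(1) s(3) f(3) s(4) f(4)]) auto
  moreover have "\<not> (infinite ?X2 \<and> infinite ?X3 \<and> infinite ?X4)" by (rule three[OF s(2) f(2) s(3) f(3) s(4) f(4)]) auto
  ultimately have "finite ?X2 \<and> finite ?X3 \<or> finite ?X1 \<and> finite ?X4" using i by argo
  moreover have "sym_diff A (V - B) = ?X1 \<union> ?X4" using A B by auto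
  ultimately show ?thesis by auto
qed

lemma sym_diff_triangle: "sym_diff A C \<subseteq> sym_diff A B \<union> sym_diff B C"
  by auto

text \<open>A substitute for |A| - |B| when both sets may be infinite; it has this meaning only if
  their symmetric difference is finite, since infinite sets have \<open>card\<close> 0.\<close>

definition excess :: "'v set \<Rightarrow> 'v set \<Rightarrow> int" where
  "excess A B = int (card (A - B)) - int (card (B - A))"

text \<open>Each of the six differences splits into two cells of the Venn diagram of the three sets,
  and the cells cancel. Additivity of \<open>height\<close> rests on this.\<close>

lemma excess_add:
  assumes "finite (sym_diff A B)" "finite (sym_diff B C)"
  shows "excess A B + excess B C = excess A C"
proof -
  have AC: "finite (sym_diff A C)"
    using sym_diff_triangle assms by (metis finite_UnI finite_subset)
  have split: "card X = card Y + card Z" if "finite X" "X = Y \<union> Z" "Y \<inter> Z = {}" for X Y Z :: "'a set"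
    using that by (simp add: card_Un_disjoint)
  have fin: "finite (A - B)" "finite (B - A)" "finite (B - C)" "finite (C - B)" "finite (A - C)" "finite (C - A)"
    using assms AC by auto
  have "card (A - B) = card (A - B - C) + card (A \<inter> C - B)" "card (B - A) = card (B \<inter> C - A) + card (B - A - C)"
    "card (B - C) = card (A \<inter> B - C) + card (B - A - C)" "card (C - B) = card (A \<inter> C - B) + card (C - A - B)"
    "card (A - C) = card (A \<inter> B - C) + card (A - B - C)" "card (C - A) = card (B \<inter> C - A) + card (C - A - B)"
    by (rule split; use fin in blast)+
  then show ?thesis by (simp add: excess_def)
qed

section \<open>Linear growth of two-ended groups\<close>

context marked_group
begin

abbreviation "\<Gamma> \<equiv> cayley_graph G S"

lemma gen_carrier: "s \<in> S \<Longrightarrow> s \<in> carrier G"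
  using gens_subset by blast

lemma cayley_edge_iff: "(g, h) \<in> \<Gamma> \<longleftrightarrow> g \<in> carrier G \<and> (\<exists>s\<in>S. h = g \<otimes> s)"
  by (auto simp: cayley_graph_def)

lemma cayley_subset: "\<Gamma> \<subseteq> carrier G \<times> carrier G"
  using gens_subset by (auto simp: cayley_graph_def)

lemma cayley_locally_finite: "finite {h. (g, h) \<in> \<Gamma>}"
  by (rule finite_subset[of _ "(\<lambda>s. g \<otimes> s) ` S"]) (use finite_gens in \<open>auto simp: cayley_graph_def\<close>)

section \<open>Word balls\<close>

primrec word_ball :: "nat \<Rightarrow> 'a set" where
  "word_ball 0 = {\<one>}"
| "word_ball (Suc n) = word_ball n \<union> (\<lambda>(g, s). g \<otimes> s) ` (word_ball n \<times> S)"

lemma finite_word_ball: "finite (word_ball n)"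
  by (induction n) (use finite_gens in auto)

lemma word_ball_carrier: "word_ball n \<subseteq> carrier G"
  by (induction n) (use gen_carrier in auto)

lemma word_ball_memD: "g \<in> word_ball n \<Longrightarrow> g \<in> carrier G"
  using word_ball_carrier by blast

lemma word_ball_mono: "m \<le> n \<Longrightarrow> word_ball m \<subseteq> word_ball n"
  by (induction n rule: dec_induct) auto

lemma word_ball_mult: "g \<in> word_ball m \<Longrightarrow> h \<in> word_ball n \<Longrightarrow> g \<otimes> h \<in> word_ball (m + n)"
proof (induction n arbitrary: h)
  case 0
  then show ?case using word_ball_memD[of g m] by simp
next
  case (Suc n)
  then consider "h \<in> word_ball n" | h' s where "h' \<in> word_ball n" "s \<in> S" "h = h' \<otimes> s" by auto
  then show ?case
  proof cases
    case 1
    then show ?thesis using Suc by simp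
  next
    case 2
    then have "g \<otimes> h = (g \<otimes> h') \<otimes> s"
      using m_assoc Suc.prems word_ball_memD gen_carrier by metis
    moreover have "g \<otimes> h' \<in> word_ball (m + n)" using Suc 2 by blast
    ultimately show ?thesis using 2(2) by auto
  qed
qed

lemma gen_word_ball: "s \<in> S \<Longrightarrow> s \<in> word_ball 1"
  using gen_carrier by (auto intro!: image_eqI[of _ _ "(\<one>, s)"])

lemma word_ball_inv: "g \<in> word_ball n \<Longrightarrow> inv g \<in> word_ball n"
proof (induction n arbitrary: g)
  case (Suc n)
  then consider "g \<in> word_ball n" | h s where "h \<in> word_ball n" "s \<in> S" "g = h \<otimes> s" by auto
  then show ?case
  proof cases
    case 1
    then show ?thesis using Suc.IH by simp
  next
    case 2
    then have "inv g = inv s \<otimes> inv h"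
      using inv_mult_group word_ball_memD gen_carrier by metis
    then show ?thesis
      using word_ball_mult[OF gen_word_ball[OF inv_in_gens[OF 2(2)]] Suc.IH[OF 2(1)]] by simp
  qed
qed simp

lemma ex_word_ball: "g \<in> carrier G \<Longrightarrow> \<exists>n. g \<in> word_ball n"
proof -
  assume "g \<in> carrier G"
  then have "g \<in> generate G S" using generate_gens by simp
  then show ?thesis
  proof induction
    case one
    then show ?case by (intro exI[of _ 0]) simp
  next
    case (incl h)
    then show ?case using gen_word_ball by blast
  next
    case (inv h)
    then show ?case using gen_word_ball inv_in_gens by blast
  next
    case (eng h1 h2)
    then show ?case using word_ball_mult by blast
  qed
qed

lemma finite_in_word_ball: "finite A \<Longrightarrow> A \<subseteq> carrier G \<Longrightarrow> \<exists>n. A \<subseteq> word_ball n"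
proof (induction rule: finite_induct)
  case (insert a A)
  then obtain n where n: "A \<subseteq> word_ball n" by auto
  obtain k where "a \<in> word_ball k" using ex_word_ball insert by blast
  then have "insert a A \<subseteq> word_ball (max n k)"
    using n word_ball_mono[of n "max n k"] word_ball_mono[of k "max n k"] by auto
  then show ?case by blast
qed simp

section \<open>Left translates, which are images under automorphisms of the Cayley graph\<close>

definition translate :: "'a \<Rightarrow> 'a set \<Rightarrow> 'a set" where
  "translate h A = (\<lambda>g. h \<otimes> g) ` A"

lemma translate_inj: "h \<in> carrier G \<Longrightarrow> A \<subseteq> carrier G \<Longrightarrow> inj_on (\<lambda>g. h \<otimes> g) A"
  by (auto simp: inj_on_def subset_iff)

lemma translate_subset: "h \<in> carrier G \<Longrightarrow> A \<subseteq> carrier G \<Longrightarrow> translate h A \<subseteq> carrier G"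
  by (auto simp: translate_def)

lemma translate_mult: "h \<in> carrier G \<Longrightarrow> k \<in> carrier G \<Longrightarrow> A \<subseteq> carrier G \<Longrightarrow> translate (h \<otimes> k) A = translate h (translate k A)"
  unfolding translate_def image_image by (intro image_cong) (auto simp: m_assoc)

lemma translate_one: "A \<subseteq> carrier G \<Longrightarrow> translate \<one> A = A"
  unfolding translate_def by (auto simp: image_iff subset_iff)

lemma translate_Diff:
  assumes "h \<in> carrier G" "A \<subseteq> carrier G" "B \<subseteq> carrier G"
  shows "translate h (A - B) = translate h A - translate h B"
  unfolding translate_def
  by (rule inj_on_image_set_diff[OF translate_inj[OF assms(1) subset_refl]]) (use assms in auto)

lemma translate_carrier: "h \<in> carrier G \<Longrightarrow> translate h (carrier G) = carrier G"
proof -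
  assume h: "h \<in> carrier G"
  have "g \<in> translate h (carrier G)" if "g \<in> carrier G" for g
  proof -
    have "g = h \<otimes> (inv h \<otimes> g)" using h that by (simp flip: m_assoc)
    then show ?thesis using h that unfolding translate_def by blast
  qed
  then show ?thesis using translate_subset[OF h subset_refl] by blast
qed

lemma translate_sym_diff:
  assumes "h \<in> carrier G" "A \<subseteq> carrier G" "B \<subseteq> carrier G"
  shows "translate h (sym_diff A B) = sym_diff (translate h A) (translate h B)"
proof -
  have "translate h (sym_diff A B) = translate h (A - B) \<union> translate h (B - A)" by (simp add: translate_def image_Un)
  then show ?thesis using assms by (simp add: translate_Diff)
qed

lemma card_translate: "h \<in> carrier G \<Longrightarrow> A \<subseteq> carrier G \<Longrightarrow> card (translate h A) = card A"
  unfolding translate_def by (intro card_image translate_inj)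

lemma finite_translate: "h \<in> carrier G \<Longrightarrow> A \<subseteq> carrier G \<Longrightarrow> finite (translate h A) = finite A"
  unfolding translate_def by (intro finite_image_iff translate_inj)

lemma excess_translate:
  assumes "h \<in> carrier G" "A \<subseteq> carrier G" "B \<subseteq> carrier G"
  shows "excess (translate h A) (translate h B) = excess A B"
proof -
  have "card (translate h A - translate h B) = card (A - B)" "card (translate h B - translate h A) = card (B - A)"
    using card_translate[OF assms(1), of "A - B"] card_translate[OF assms(1), of "B - A"] translate_Diff[OF assms]
      translate_Diff[OF assms(1,3,2)] assms by auto
  then show ?thesis by (simp add: excess_def)
qed

lemma cayley_translate:
  assumes "h \<in> carrier G" "g \<in> carrier G" "g' \<in> carrier G"
  shows "(h \<otimes> g, h \<otimes> g') \<in> \<Gamma> \<longleftrightarrow> (g, g') \<in> \<Gamma>"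
proof -
  have "h \<otimes> g' = h \<otimes> g \<otimes> s \<longleftrightarrow> g' = g \<otimes> s" if "s \<in> S" for s
    using assms gen_carrier[OF that] by (simp add: m_assoc)
  then show ?thesis using assms by (auto simp: cayley_edge_iff)
qed

lemma coboundary_translate:
  assumes "h \<in> carrier G" "A \<subseteq> carrier G"
  shows "\<Gamma> \<inter> translate h A \<times> (- translate h A) \<subseteq> (\<lambda>(u, v). (h \<otimes> u, h \<otimes> v)) ` (\<Gamma> \<inter> A \<times> (- A))"
proof
  fix p assume p: "p \<in> \<Gamma> \<inter> translate h A \<times> (- translate h A)"
  obtain u v where uv: "p = (u, v)" by (cases p)
  then have "u \<in> translate h A" "v \<in> carrier G" "v \<notin> translate h A" "(u, v) \<in> \<Gamma>" using p cayley_subset by auto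
  then obtain a where a: "a \<in> A" "u = h \<otimes> a" by (auto simp: translate_def)
  obtain b where b: "b \<in> carrier G" "v = h \<otimes> b"
    using \<open>v \<in> carrier G\<close> translate_carrier[OF assms(1)] unfolding translate_def by blast
  have "b \<notin> A" using b \<open>v \<notin> translate h A\<close> by (auto simp: translate_def)
  moreover have "(a, b) \<in> \<Gamma>" using cayley_translate[OF assms(1), of a b] a b assms(2) \<open>(u, v) \<in> \<Gamma>\<close> by blast
  ultimately show "p \<in> (\<lambda>(u, v). (h \<otimes> u, h \<otimes> v)) ` (\<Gamma> \<inter> A \<times> (- A))"
    using a b uv by force
qed

lemma finite_coboundary_translate: "h \<in> carrier G \<Longrightarrow> A \<subseteq> carrier G \<Longrightarrow> finite_coboundary \<Gamma> A \<Longrightarrow> finite_coboundary \<Gamma> (translate h A)"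
  unfolding finite_coboundary_def by (rule finite_subset[OF coboundary_translate]) auto

text \<open>Connectedness in the form used later: a proper subset is shown to be empty by checking
  that no edge leaves it.\<close>

lemma cayley_closed_set:
  assumes "A \<subseteq> carrier G" "a \<in> A" and closed: "\<And>u v. (u, v) \<in> \<Gamma> \<Longrightarrow> u \<in> A \<Longrightarrow> v \<in> A"
  shows "A = carrier G"
proof -
  have "a \<otimes> g \<in> A" if "g \<in> word_ball n" for g n
    using that
  proof (induction n arbitrary: g)
    case 0
    then show ?case using assms(1,2) by (simp add: subset_iff)
  next
    case (Suc n)
    then consider "g \<in> word_ball n" | h s where "h \<in> word_ball n" "s \<in> S" "g = h \<otimes> s" by auto
    then show ?case
    proof cases
      case 2
      have ah: "a \<otimes> h \<in> A" by (rule Suc.IH[OF 2(1)])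
      have "a \<otimes> g = (a \<otimes> h) \<otimes> s"
        using 2 assms(1,2) word_ball_memD[OF 2(1)] gen_carrier[OF 2(2)] by (simp add: m_assoc subset_iff)
      then have "(a \<otimes> h, a \<otimes> g) \<in> \<Gamma>" using 2(2) ah assms(1) by (auto simp: cayley_edge_iff)
      then show ?thesis using closed ah by blast
    qed (use Suc.IH in blast)
  qed
  moreover have "g = a \<otimes> (inv a \<otimes> g)" if "g \<in> carrier G" for g
    using that assms by (simp add: subset_iff flip: m_assoc)
  moreover have "inv a \<otimes> g \<in> carrier G" if "g \<in> carrier G" for g
    using that assms by (simp add: subset_iff)
  ultimately have "g \<in> A" if "g \<in> carrier G" for g using that ex_word_ball by metis
  then show ?thesis using assms(1) by blast
qed

lemma cayley_connected:
  assumes "v \<in> carrier G" "w \<in> carrier G"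
  shows "(v, w) \<in> \<Gamma>\<^sup>*"
proof -
  have "\<Gamma>\<^sup>* `` {v} \<subseteq> carrier G"
  proof clarify
    fix w assume "(v, w) \<in> \<Gamma>\<^sup>*"
    then show "w \<in> carrier G" using assms(1) cayley_subset by (induction rule: rtrancl_induct) auto
  qed
  then have "\<Gamma>\<^sup>* `` {v} = carrier G"
    by (rule cayley_closed_set[of _ v]) (auto intro: rtrancl_into_rtrancl)
  then show ?thesis using assms by blast
qed

text \<open>A translated ball is connected within itself, since a word and its prefixes lie in it; a
  set whose boundary it does not cross contains all or none of it.\<close>

lemma translate_word_ball_connected:
  assumes h: "h \<in> carrier G" and X: "\<And>u v. u \<in> translate h (word_ball n) \<Longrightarrow> v \<in> translate h (word_ball n) \<Longrightarrow> (u, v) \<in> \<Gamma> \<Longrightarrow> u \<in> X \<longleftrightarrow> v \<in> X"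
  shows "translate h (word_ball n) \<subseteq> X \<or> translate h (word_ball n) \<inter> X = {}"
proof -
  have "h \<otimes> g \<in> X \<longleftrightarrow> h \<in> X" if "g \<in> word_ball k" "k \<le> n" for g k
    using that
  proof (induction k arbitrary: g)
    case 0
    then show ?case using h by simp
  next
    case (Suc k)
    then consider "g \<in> word_ball k" | g' s where "g' \<in> word_ball k" "s \<in> S" "g = g' \<otimes> s" by auto
    then show ?case
    proof cases
      case 2
      have "(h \<otimes> g', h \<otimes> g) \<in> \<Gamma>"
      proof -
        have "h \<otimes> g = (h \<otimes> g') \<otimes> s"
          using 2(3) h word_ball_memD[OF 2(1)] gen_carrier[OF 2(2)] by (simp add: m_assoc)
        then show ?thesis using 2(2) h word_ball_memD[OF 2(1)] by (auto simp: cayley_edge_iff)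
      qed
      moreover have "g' \<in> word_ball n" "g \<in> word_ball n"
        using 2(1) Suc.prems word_ball_mono[of k n] word_ball_mono[of "Suc k" n] by auto
      ultimately have "h \<otimes> g' \<in> X \<longleftrightarrow> h \<otimes> g \<in> X" by (intro X) (auto simp: translate_def)
      then show ?thesis using Suc.IH[OF 2(1)] Suc.prems by simp
    qed (use Suc in auto)
  qed
  then show ?thesis unfolding translate_def by blast
qed

end

section \<open>Height along a two-ended group\<close>

locale two_ended_group = marked_group +
  fixes A :: "'a set"
  assumes two_ends: "card (ends \<Gamma>) = 2"
    and A: "A \<subseteq> carrier G" "infinite A" "infinite (carrier G - A)" "finite_coboundary \<Gamma> A"
begin

text \<open>Elements that do not exchange the two sides of the cut, up to a finite error.\<close>

definition sep :: "'a \<Rightarrow> bool" where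
  "sep h \<longleftrightarrow> finite (sym_diff A (translate h A))"

definition height :: "'a \<Rightarrow> int" where
  "height h = excess A (translate h A)"

lemma translate_A_subset: "h \<in> carrier G \<Longrightarrow> translate h A \<subseteq> carrier G"
  by (rule translate_subset[OF _ A(1)])

text \<open>Commensurability with an explicit bound, needed for estimates linear in the word length.
  Finiteness is stated separately because infinite sets have \<open>card\<close> 0.\<close>

definition near :: "'a set \<Rightarrow> 'a set \<Rightarrow> nat \<Rightarrow> bool" where
  "near B C n \<longleftrightarrow> finite (sym_diff B C) \<and> card (sym_diff B C) \<le> n"

definition near_or_co :: "'a set \<Rightarrow> 'a set \<Rightarrow> nat \<Rightarrow> bool" where
  "near_or_co B C n \<longleftrightarrow> near B C n \<or> near B (carrier G - C) n"

lemma near_trans: "near B C m \<Longrightarrow> near C D n \<Longrightarrow> near B D (m + n)"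
proof -
  assume *: "near B C m" "near C D n"
  have "card (sym_diff B D) \<le> card (sym_diff B C \<union> sym_diff C D)"
    using * by (intro card_mono sym_diff_triangle) (auto simp: near_def)
  also have "\<dots> \<le> card (sym_diff B C) + card (sym_diff C D)" by (rule card_Un_le)
  finally show ?thesis
    using * finite_subset[OF sym_diff_triangle[of B D C]] by (auto simp: near_def)
qed

lemma near_compl: "B \<subseteq> carrier G \<Longrightarrow> C \<subseteq> carrier G \<Longrightarrow> near (carrier G - B) (carrier G - C) n = near B C n"
proof -
  assume "B \<subseteq> carrier G" "C \<subseteq> carrier G"
  then have "sym_diff (carrier G - B) (carrier G - C) = sym_diff B C" by blast
  then show ?thesis by (simp add: near_def)
qed

lemma near_or_co_trans:
  assumes "near_or_co B C m" "near_or_co C D n" and sub: "B \<subseteq> carrier G" "C \<subseteq> carrier G" "D \<subseteq> carrier G"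
  shows "near_or_co B D (m + n)"
proof -
  have cc: "carrier G - (carrier G - D) = D" using sub by blast
  have "near (carrier G - C) (carrier G - D) n \<or> near (carrier G - C) D n"
    using assms(2) near_compl[OF sub(2,3)] near_compl[OF sub(2), of "carrier G - D"] cc
    by (auto simp: near_or_co_def)
  then show ?thesis
    using assms(1,2) near_trans unfolding near_or_co_def by blast
qed

lemma near_translate: "h \<in> carrier G \<Longrightarrow> B \<subseteq> carrier G \<Longrightarrow> C \<subseteq> carrier G \<Longrightarrow> near (translate h B) (translate h C) n = near B C n"
proof -
  assume *: "h \<in> carrier G" "B \<subseteq> carrier G" "C \<subseteq> carrier G"
  then have "sym_diff B C \<subseteq> carrier G" by blast
  then show ?thesis
    unfolding near_def translate_sym_diff[OF *, symmetric] using card_translate[OF *(1)] finite_translate[OF *(1)] by presburger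
qed

lemma near_or_co_translate: "h \<in> carrier G \<Longrightarrow> B \<subseteq> carrier G \<Longrightarrow> C \<subseteq> carrier G \<Longrightarrow> near_or_co B C n \<Longrightarrow> near_or_co (translate h B) (translate h C) n"
  unfolding near_or_co_def using near_translate[of h B C] near_translate[of h B "carrier G - C"] translate_Diff[of h "carrier G" C] translate_carrier[of h]
  by auto

lemma sep_or: "h \<in> carrier G \<Longrightarrow> sep h \<or> finite (sym_diff A (carrier G - translate h A))"
proof -
  assume h: "h \<in> carrier G"
  have inf: "infinite (translate h A)" using finite_translate[OF h A(1)] A(2) by simp
  have "carrier G - translate h A = translate h (carrier G - A)" using translate_Diff[OF h subset_refl A(1)] translate_carrier[OF h] by simp
  then have inf': "infinite (carrier G - translate h A)" using finite_translate[OF h, of "carrier G - A"] A(3) by simp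
  show ?thesis unfolding sep_def
    by (rule two_ends_dichotomy[OF sym_cayley_graph cayley_subset cayley_locally_finite cayley_connected two_ends A])
      (use translate_A_subset[OF h] inf inf' finite_coboundary_translate[OF h A(1,4)] in auto)
qed

text \<open>Along the prefixes of a word, passing from \<open>g\<close> to \<open>g\<close> times a
  generator costs at most a constant, since left translation by \<open>g\<close> preserves symmetric
  differences; the costs add up.\<close>

lemma near_or_co_word_ball: "\<exists>C. \<forall>n. \<forall>h\<in>word_ball n. near_or_co A (translate h A) (C * n)"
proof -
  have "\<exists>m. near_or_co A (translate s A) m" if "s \<in> S" for s
    using sep_or[OF gen_carrier[OF that]] unfolding sep_def near_or_co_def near_def by blast
  then obtain m where m: "\<And>s. s \<in> S \<Longrightarrow> near_or_co A (translate s A) (m s)" by metis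
  define C where "C = sum m S"
  have mono: "near_or_co B D k" if "near_or_co B D j" "j \<le> k" for B D j k
    using that by (auto simp: near_or_co_def near_def)
  have C: "near_or_co A (translate s A) C" if "s \<in> S" for s
    by (rule mono[OF m[OF that]]) (use that finite_gens in \<open>simp add: C_def member_le_sum\<close>)
  have "near_or_co A (translate h A) (C * n)" if "h \<in> word_ball n" for n h
    using that
  proof (induction n arbitrary: h)
    case 0
    then show ?case using translate_one[OF A(1)] by (simp add: near_or_co_def near_def)
  next
    case (Suc n)
    then consider "h \<in> word_ball n" | g s where "g \<in> word_ball n" "s \<in> S" "h = g \<otimes> s" by auto
    then show ?case
    proof cases
      case 1
      then show ?thesis using mono[OF Suc.IH, of h "C * Suc n"] by simp
    next
      case 2
      have g: "g \<in> carrier G" and s: "s \<in> carrier G" using 2 word_ball_memD gen_carrier by auto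
      have "near_or_co (translate g A) (translate g (translate s A)) C"
        using near_or_co_translate[OF g A(1) translate_A_subset[OF s] C[OF 2(2)]] .
      then have "near_or_co (translate g A) (translate h A) C" using translate_mult[OF g s A(1)] 2(3) by simp
      then have "near_or_co A (translate h A) (C * n + C)"
        using near_or_co_trans[OF Suc.IH[OF 2(1)] _ A(1) translate_A_subset[OF g] translate_A_subset[of h]] g s 2(3) by simp
      then show ?thesis by (simp add: algebra_simps)
    qed
  qed
  then show ?thesis by blast
qed

lemma not_sep_both: "h \<in> carrier G \<Longrightarrow> sep h \<Longrightarrow> infinite (sym_diff A (carrier G - translate h A))"
proof
  assume h: "h \<in> carrier G" "sep h" "finite (sym_diff A (carrier G - translate h A))"
  have "A \<subseteq> sym_diff A (translate h A) \<union> sym_diff A (carrier G - translate h A)" using A(1) by blast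
  then have "finite A" by (rule finite_subset) (use h in \<open>simp add: sep_def\<close>)
  then show False using A(2) by simp
qed

lemma height_bound: "\<exists>C. \<forall>n. \<forall>h\<in>word_ball n. sep h \<longrightarrow> \<bar>height h\<bar> \<le> int (C * n)"
proof -
  obtain C where C: "\<forall>n. \<forall>h\<in>word_ball n. near_or_co A (translate h A) (C * n)" using near_or_co_word_ball by blast
  have "\<bar>height h\<bar> \<le> int (C * n)" if h: "h \<in> word_ball n" and "sep h" for h n
  proof -
    have "near A (translate h A) (C * n)"
      using C h not_sep_both[OF word_ball_memD[OF h] \<open>sep h\<close>] by (auto simp: near_or_co_def near_def)
    then have f: "finite (sym_diff A (translate h A))" and c: "card (sym_diff A (translate h A)) \<le> C * n" by (auto simp: near_def)
    have "card (A - translate h A) \<le> card (sym_diff A (translate h A))" "card (translate h A - A) \<le> card (sym_diff A (translate h A))"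
      using f by (auto intro: card_mono)
    then show ?thesis using c unfolding height_def excess_def by linarith
  qed
  then show ?thesis by blast
qed

text \<open>Translating by the inverse of \<open>h\<close> reduces the comparison of two translates
  to one with \<open>A\<close> itself.\<close>

lemma sep_diff:
  assumes "h \<in> carrier G" "k \<in> carrier G" "finite (sym_diff (translate h A) (translate k A))"
  shows "sep (inv h \<otimes> k)" "height (inv h \<otimes> k) = excess (translate h A) (translate k A)"
proof -
  have ih: "inv h \<in> carrier G" using assms by simp
  have *: "translate (inv h) (translate h A) = A" "translate (inv h) (translate k A) = translate (inv h \<otimes> k) A"
    using assms A(1) translate_mult[OF ih assms(1) A(1)] translate_mult[OF ih assms(2) A(1)] translate_one[OF A(1)] by auto
  have "translate (inv h) (sym_diff (translate h A) (translate k A)) = sym_diff A (translate (inv h \<otimes> k) A)"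
    using translate_sym_diff[OF ih translate_A_subset[OF assms(1)] translate_A_subset[OF assms(2)]] * by simp
  then show "sep (inv h \<otimes> k)"
    using assms(3) unfolding sep_def translate_def by (metis finite_imageI)
  show "height (inv h \<otimes> k) = excess (translate h A) (translate k A)"
    using excess_translate[OF ih translate_A_subset[OF assms(1)] translate_A_subset[OF assms(2)]] * by (simp add: height_def)
qed

text \<open>
  If \<open>m\<close> moves a large ball off itself, then no edge can leave the appropriate one of the four sets
  cut out by \<open>A\<close> and \<open>m A\<close>, so that \<open>A\<close> and \<open>m A\<close> are strictly nested.
\<close>

lemma finite_kernel: "finite {m \<in> carrier G. sep m \<and> height m = 0}"
proof -
  have "finite (fst ` (\<Gamma> \<inter> A \<times> (- A)) \<union> snd ` (\<Gamma> \<inter> A \<times> (- A)))"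
    using A(4) by (simp add: finite_coboundary_def)
  moreover have "fst ` (\<Gamma> \<inter> A \<times> (- A)) \<union> snd ` (\<Gamma> \<inter> A \<times> (- A)) \<subseteq> carrier G"
    using cayley_subset by auto
  \<comment> \<open>A ball containing both ends of every edge across the cut.\<close>
  ultimately obtain r where r: "fst ` (\<Gamma> \<inter> A \<times> (- A)) \<union> snd ` (\<Gamma> \<inter> A \<times> (- A)) \<subseteq> word_ball r"
    using finite_in_word_ball by blast
  let ?K = "word_ball r"
  have out: "u \<in> ?K \<and> v \<in> ?K" if "(u, v) \<in> \<Gamma>" "u \<in> A" "v \<notin> A" for u v
    using r that by force
  have cob: "u \<in> ?K \<and> v \<in> ?K" if "(u, v) \<in> \<Gamma>" "u \<in> A \<longleftrightarrow> v \<notin> A" for u v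
    using out[of u v] out[of v u] that symD[OF sym_cayley_graph that(1)] by blast
  have "translate m ?K \<inter> ?K \<noteq> {}" if m: "m \<in> carrier G" "sep m" "height m = 0" for m
  proof
    assume disj: "translate m ?K \<inter> ?K = {}"
    let ?B = "translate m A"
    have fin: "finite (A - ?B)" "finite (?B - A)" using m(2) by (auto simp: sep_def)
    have zero: "card (A - ?B) = card (?B - A)" using m(3) by (simp add: height_def excess_def)
    have outB: "u \<in> translate m ?K \<and> v \<in> translate m ?K" if "(u, v) \<in> \<Gamma>" "u \<in> ?B" "v \<notin> ?B" for u v
    proof -
      have "(u, v) \<in> (\<lambda>(u, v). (m \<otimes> u, m \<otimes> v)) ` (\<Gamma> \<inter> A \<times> (- A))"
        using coboundary_translate[OF m(1) A(1)] that by blast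
      then obtain u' v' where "u = m \<otimes> u'" "v = m \<otimes> v'" "(u', v') \<in> \<Gamma>" "u' \<in> A" "v' \<notin> A" by auto
      then show ?thesis using out[of u' v'] unfolding translate_def by blast
    qed
    have cobB: "u \<in> translate m ?K \<and> v \<in> translate m ?K" if "(u, v) \<in> \<Gamma>" "u \<in> ?B \<longleftrightarrow> v \<notin> ?B" for u v
      using outB[of u v] outB[of v u] that symD[OF sym_cayley_graph that(1)] by blast
    \<comment> \<open>The translated ball avoids \<open>word_ball r\<close>, hence contains no edge
      crossing the cut, and it is connected; so it lies on one side. The same holds for
      \<open>word_ball r\<close> and the translated cut.\<close>
    have W: "translate m ?K \<subseteq> A \<or> translate m ?K \<inter> A = {}"
    proof (rule translate_word_ball_connected[OF m(1)])
      fix u v assume "u \<in> translate m ?K" "v \<in> translate m ?K" "(u, v) \<in> \<Gamma>"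
      then show "u \<in> A \<longleftrightarrow> v \<in> A" using cob[of u v] disj by blast
    qed
    have K: "?K \<subseteq> ?B \<or> ?K \<inter> ?B = {}"
    proof -
      have "translate \<one> ?K \<subseteq> ?B \<or> translate \<one> ?K \<inter> ?B = {}"
      proof (rule translate_word_ball_connected[OF one_closed])
        fix u v assume "u \<in> translate \<one> ?K" "v \<in> translate \<one> ?K" "(u, v) \<in> \<Gamma>"
        then show "u \<in> ?B \<longleftrightarrow> v \<in> ?B" using cobB[of u v] disj translate_one[OF word_ball_carrier] by blast
      qed
      then show ?thesis using translate_one[OF word_ball_carrier] by simp
    qed
    have empty: "Y = {}" if "Y \<subseteq> carrier G" "Y \<noteq> carrier G"
      "\<And>u v. (u, v) \<in> \<Gamma> \<Longrightarrow> u \<in> Y \<Longrightarrow> v \<notin> Y \<Longrightarrow> False" for Y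
      using cayley_closed_set[of Y] that by blast
    obtain a where a: "a \<in> A" using A(2) by (metis ex_in_conv finite.emptyI)
    obtain b where b: "b \<in> carrier G" "b \<notin> A" using A(3) by (metis DiffD1 DiffD2 ex_in_conv finite.emptyI)
    obtain u v where uv: "(u, v) \<in> \<Gamma>" "u \<in> A" "v \<notin> A"
      using empty[OF A(1)] a b by blast
    then have uvK: "u \<in> ?K" "v \<in> ?K" using out by auto
    have edge: "u \<in> carrier G \<and> v \<in> carrier G" if "(u, v) \<in> \<Gamma>" for u v using that cayley_subset by blast
    have B: "?B \<subseteq> carrier G" by (rule translate_A_subset[OF m(1)])
    \<comment> \<open>In each case an edge leaving one particular corner would have to cross one cut
      on the wrong side of the other, so this corner is empty. Inclusion between \<open>A\<close>
      and its translate clashes with height zero; covering everything or being disjoint clashes with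
      \<open>sep m\<close>.\<close>
    from W K consider "translate m ?K \<subseteq> A" "?K \<inter> ?B = {}" | "translate m ?K \<subseteq> A" "?K \<subseteq> ?B"
      | "translate m ?K \<inter> A = {}" "?K \<subseteq> ?B" | "translate m ?K \<inter> A = {}" "?K \<inter> ?B = {}" by blast
    then show False
    proof cases
      case 1
      have "?B - A = {}"
      proof (rule empty)
        show False if "(u, v) \<in> \<Gamma>" "u \<in> ?B - A" "v \<notin> ?B - A" for u v
          using that cob[of u v] cobB[of u v] 1 by blast
      qed (use B a A(1) in blast)+
      then have "card (A - ?B) = 0" unfolding zero by (simp only: card.empty)
      then have "A - ?B = {}" using card_0_eq[OF fin(1)] by blast
      then show False using uv(2) uvK(1) 1(2) by blast
    next
      case 2
      have "carrier G - ?B - A = {}"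
      proof (rule empty)
        show False if "(u, v) \<in> \<Gamma>" "u \<in> carrier G - ?B - A" "v \<notin> carrier G - ?B - A" for u v
          using that cob[of u v] cobB[of u v] edge[of u v] 2 by blast
      qed (use a A(1) in blast)+
      then have "carrier G - A \<subseteq> ?B - A" by blast
      then show False using fin(2) A(3) finite_subset by blast
    next
      case 3
      have "A - ?B = {}"
      proof (rule empty)
        show False if "(u, v) \<in> \<Gamma>" "u \<in> A - ?B" "v \<notin> A - ?B" for u v
          using that cob[of u v] cobB[of u v] 3 by blast
      qed (use b A(1) in blast)+
      then have "card (?B - A) = 0" unfolding zero[symmetric] by (simp only: card.empty)
      then have "?B - A = {}" using card_0_eq[OF fin(2)] by blast
      then show False using uv(3) uvK(2) 3(2) by blast
    next
      case 4
      have "A \<inter> ?B = {}"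
      proof (rule empty)
        show False if "(u, v) \<in> \<Gamma>" "u \<in> A \<inter> ?B" "v \<notin> A \<inter> ?B" for u v
          using that cob[of u v] cobB[of u v] 4 by blast
      qed (use b A(1) in blast)+
      then have "A \<subseteq> A - ?B" by blast
      then show False using fin(1) A(2) finite_subset by blast
    qed
  qed
  then have "{m \<in> carrier G. sep m \<and> height m = 0} \<subseteq> (\<lambda>(k, k'). k \<otimes> inv k') ` (?K \<times> ?K)"
  proof clarify
    fix m assume m: "m \<in> carrier G" "sep m" "height m = 0"
    and meet: "\<And>m. m \<in> carrier G \<Longrightarrow> sep m \<Longrightarrow> height m = 0 \<Longrightarrow> translate m ?K \<inter> ?K \<noteq> {}"
    then obtain k k' where k: "k \<in> ?K" "k' \<in> ?K" "k = m \<otimes> k'" unfolding translate_def by blast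
    then have "m = k \<otimes> inv k'" using m(1) word_ball_memD[OF k(2)] by (simp add: m_assoc)
    then show "m \<in> (\<lambda>(k, k'). k \<otimes> inv k') ` (?K \<times> ?K)" using k by force
  qed
  then show ?thesis using finite_word_ball finite_subset by blast
qed

text \<open>On a ball of radius \<open>n\<close> the height takes at most 2Cn + 1 values, and
  elements of equal height differ by a right factor in the finite kernel.\<close>

lemma sep_growth: "\<exists>C. \<forall>n. card {h \<in> word_ball n. sep h} \<le> C * Suc n"
proof -
  let ?N = "{m \<in> carrier G. sep m \<and> height m = 0}"
  obtain C where C: "\<forall>n. \<forall>h\<in>word_ball n. sep h \<longrightarrow> \<bar>height h\<bar> \<le> int (C * n)" using height_bound by blast
  have fib: "card {h \<in> word_ball n. sep h \<and> height h = i} \<le> card ?N" for n i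
  proof (cases "{h \<in> word_ball n. sep h \<and> height h = i} = {}")
    case False
    then obtain h where h: "h \<in> word_ball n" "sep h" "height h = i" by blast
    have hc: "h \<in> carrier G" by (rule word_ball_memD[OF h(1)])
    have "{h \<in> word_ball n. sep h \<and> height h = i} \<subseteq> (\<lambda>m. h \<otimes> m) ` ?N"
    proof clarify
      fix k assume k: "k \<in> word_ball n" "sep k" "i = height k"
      have kc: "k \<in> carrier G" by (rule word_ball_memD[OF k(1)])
      have f1: "finite (sym_diff (translate h A) A)" using h(2) unfolding sep_def by (simp add: Un_commute)
      have f2: "finite (sym_diff A (translate k A))" using k(2) unfolding sep_def .
      have f: "finite (sym_diff (translate h A) (translate k A))"
        by (rule finite_subset[OF sym_diff_triangle[of _ _ A]]) (use f1 f2 in blast)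
      have "excess (translate h A) (translate k A) = excess (translate h A) A + excess A (translate k A)"
        using excess_add[OF f1 f2] by simp
      also have "\<dots> = 0" using h(3) k(3) by (simp add: height_def excess_def)
      finally have "inv h \<otimes> k \<in> ?N" using sep_diff[OF hc kc f] hc kc by simp
      moreover have "k = h \<otimes> (inv h \<otimes> k)" using hc kc by (simp flip: m_assoc)
      ultimately show "k \<in> (\<lambda>m. h \<otimes> m) ` ?N" by blast
    qed
    then show ?thesis using finite_kernel by (meson card_image_le card_mono finite_imageI le_trans)
  next
    case True
    then show ?thesis by (metis card.empty le0)
  qed
  have "card {h \<in> word_ball n. sep h} \<le> (2 * C + 1) * card ?N * Suc n" for n
  proof -
    have sub: "{h \<in> word_ball n. sep h} \<subseteq> (\<Union>i\<in>{- int (C * n)..int (C * n)}. {h \<in> word_ball n. sep h \<and> height h = i})"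
    proof clarify
      fix h assume h: "h \<in> word_ball n" "sep h"
      then have "\<bar>height h\<bar> \<le> int (C * n)" using C by blast
      then have "height h \<in> {- int (C * n)..int (C * n)}" unfolding atLeastAtMost_iff by linarith
      then show "h \<in> (\<Union>i\<in>{- int (C * n)..int (C * n)}. {h \<in> word_ball n. sep h \<and> height h = i})"
        using h by blast
    qed
    have "card {h \<in> word_ball n. sep h} \<le> card (\<Union>i\<in>{- int (C * n)..int (C * n)}. {h \<in> word_ball n. sep h \<and> height h = i})"
      by (rule card_mono[OF _ sub]) (use finite_word_ball in auto)
    also have "\<dots> \<le> (\<Sum>i\<in>{- int (C * n)..int (C * n)}. card {h \<in> word_ball n. sep h \<and> height h = i})"
      by (rule card_UN_le) simp
    also have "\<dots> \<le> (\<Sum>i\<in>{- int (C * n)..int (C * n)}. card ?N)" by (intro sum_mono fib)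
    also have "\<dots> = (2 * (C * n) + 1) * card ?N"
    proof -
      have "card {- int (C * n)..int (C * n)} = 2 * (C * n) + 1"
        unfolding card_atLeastAtMost_int by linarith
      then show ?thesis by (simp only: sum_constant of_nat_id)
    qed
    also have "\<dots> \<le> ((2 * C + 1) * Suc n) * card ?N" by (intro mult_le_mono1) (simp add: algebra_simps)
    finally show ?thesis by (simp add: algebra_simps)
  qed
  then show ?thesis by blast
qed

text \<open>If some \<open>g\<close> fails \<open>sep\<close>, multiplying by its inverse carries
  the other elements failing \<open>sep\<close> injectively into those satisfying it, at the cost of
  a fixed increase \<open>r\<close> of the radius.\<close>

lemma word_ball_growth: "\<exists>C. \<forall>n. card (word_ball n) \<le> C * Suc n"
proof -
  obtain C where C: "\<And>n. card {h \<in> word_ball n. sep h} \<le> C * Suc n" using sep_growth by blast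
  show ?thesis
  proof (cases "\<forall>g\<in>carrier G. sep g")
    case True
    then have "{h \<in> word_ball n. sep h} = word_ball n" for n using word_ball_memD by blast
    then show ?thesis using C by metis
  next
    case False
    then obtain g where g: "g \<in> carrier G" "\<not> sep g" by blast
    obtain r where r: "inv g \<in> word_ball r" using ex_word_ball g(1) inv_closed by blast
    have "card (word_ball n) \<le> C * (r + 2) * Suc n" for n
    proof -
      let ?N = "{h \<in> word_ball n. \<not> sep h}"
      have "(\<lambda>h. inv g \<otimes> h) ` ?N \<subseteq> {h \<in> word_ball (r + n). sep h}"
      proof clarify
        fix h assume h: "h \<in> word_ball n" "\<not> sep h"
        have hc: "h \<in> carrier G" by (rule word_ball_memD[OF h(1)])
        let ?V = "carrier G"
        have "finite (sym_diff A (?V - translate g A))" "finite (sym_diff A (?V - translate h A))"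
          using sep_or g h(2) hc by blast+
        then have "finite (sym_diff (translate g A) (?V - A))" "finite (sym_diff (?V - A) (translate h A))"
        proof -
          have "sym_diff (translate g A) (?V - A) = sym_diff A (?V - translate g A)"
            "sym_diff (?V - A) (translate h A) = sym_diff A (?V - translate h A)"
            using translate_A_subset[OF g(1)] translate_A_subset[OF hc] A(1) by blast+
          then show "finite (sym_diff (translate g A) (?V - A))" "finite (sym_diff (?V - A) (translate h A))"
            using \<open>finite (sym_diff A (?V - translate g A))\<close> \<open>finite (sym_diff A (?V - translate h A))\<close> by simp_all
        qed
        then have "finite (sym_diff (translate g A) (?V - A) \<union> sym_diff (?V - A) (translate h A))" by simp
        then have "finite (sym_diff (translate g A) (translate h A))"
          by (rule finite_subset[OF sym_diff_triangle])
        then have "sep (inv g \<otimes> h)" using sep_diff(1)[OF g(1) hc] by blast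
        then show "inv g \<otimes> h \<in> word_ball (r + n) \<and> sep (inv g \<otimes> h)" using word_ball_mult[OF r h(1)] by blast
      qed
      moreover have "inj_on (\<lambda>h. inv g \<otimes> h) ?N" using g(1) word_ball_memD by (intro translate_inj) auto
      ultimately have "card ?N \<le> card {h \<in> word_ball (r + n). sep h}"
        using finite_word_ball by (intro card_inj_on_le[of "\<lambda>h. inv g \<otimes> h"]) auto
      also have "\<dots> \<le> C * Suc (r + n)" by (rule C)
      finally have N: "card ?N \<le> C * Suc (r + n)" .
      have "word_ball n = {h \<in> word_ball n. sep h} \<union> ?N" by blast
      then have "card (word_ball n) \<le> card {h \<in> word_ball n. sep h} + card ?N" by (metis card_Un_le)
      also have "\<dots> \<le> C * Suc n + C * Suc (r + n)" using C[of n] N by simp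
      also have "\<dots> = C * (Suc n + Suc (r + n))" by (simp add: algebra_simps)
      also have "\<dots> \<le> C * ((r + 2) * Suc n)" by (intro mult_le_mono2) (simp add: algebra_simps)
      finally show ?thesis by (simp add: algebra_simps)
    qed
    then show ?thesis by blast
  qed
qed

end

theorem (in marked_group) two_ends_growth:
  assumes "card (ends \<Gamma>) = 2"
  shows "\<exists>C. \<forall>n. card (word_ball n) \<le> C * Suc n"
proof -
  obtain A where "A \<subseteq> carrier G" "infinite A" "infinite (carrier G - A)" "finite_coboundary \<Gamma> A"
    by (rule ex_finite_coboundary[OF sym_cayley_graph cayley_subset cayley_locally_finite assms])
  then interpret two_ended_group G S A
    by unfold_locales (use assms in auto)
  show ?thesis by (rule word_ball_growth)
qed

section \<open>Borel independent sets in the free part\<close>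

context marked_group
begin

text \<open>
  The orbit map \<open>g \<mapsto> g \<cdot> x\<close> of a point of the free part is an isomorphism of this graph onto the
  component of \<open>x\<close> in the shift graph.
\<close>

definition left_cayley :: "('a \<times> 'a) set" where
  "left_cayley = {(g, s \<otimes> g) | g s. g \<in> carrier G \<and> s \<in> S}"

lemma left_cayley_iff: "(g, h) \<in> left_cayley \<longleftrightarrow> g \<in> carrier G \<and> (\<exists>s\<in>S. h = s \<otimes> g)"
  by (auto simp: left_cayley_def)

lemma left_cayley_nbrs: "{h. (g, h) \<in> left_cayley} \<subseteq> (\<lambda>s. s \<otimes> g) ` S"
  by (auto simp: left_cayley_iff)

lemma bounded_degree_left_cayley: "bounded_degree_graph left_cayley (card S)"
proof
  show "sym left_cayley"
  proof (rule symI)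
    fix g h assume "(g, h) \<in> left_cayley"
    then obtain s where s: "g \<in> carrier G" "s \<in> S" "h = s \<otimes> g" by (auto simp: left_cayley_iff)
    then have "g = inv s \<otimes> h" "h \<in> carrier G" using gen_carrier by (auto simp flip: m_assoc)
    then show "(h, g) \<in> left_cayley" using inv_in_gens[OF s(2)] by (auto simp: left_cayley_iff)
  qed
  show "irrefl left_cayley"
  proof (rule irreflI)
    fix g show "(g, g) \<notin> left_cayley"
    proof
      assume "(g, g) \<in> left_cayley"
      then obtain s where s: "g \<in> carrier G" "s \<in> S" "g = s \<otimes> g" by (auto simp: left_cayley_iff)
      then have "s = \<one>" using gen_carrier by (metis r_cancel_one')
      then show False using s(2) one_notin_gens by simp
    qed
  qed
  show "finite {h. (g, h) \<in> left_cayley}" for g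
    by (rule finite_subset[OF left_cayley_nbrs]) (use finite_gens in simp)
  show "card {h. (g, h) \<in> left_cayley} \<le> card S" for g
    using card_mono[OF _ left_cayley_nbrs[of g]] card_image_le[OF finite_gens, of "\<lambda>s. s \<otimes> g"] finite_gens
    by (meson finite_imageI le_trans)
qed

text \<open>The separate point \<open>g\<close> covers vertices outside the carrier, whose ball is a
  singleton. Elsewhere several left multiplications combine into one by a product of generators, so
  word balls bound the growth at every vertex.\<close>

lemma gball_left_cayley: "gball left_cayley g n \<subseteq> insert g ((\<lambda>h. h \<otimes> g) ` word_ball n)"
proof
  have *: "w = g \<or> (g \<in> carrier G \<and> (\<exists>h\<in>word_ball k. w = h \<otimes> g))" if "(g, w) \<in> left_cayley ^^ k" for w k
    using that
  proof (induction k arbitrary: w)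
    case (Suc k)
    then obtain u where u: "(g, u) \<in> left_cayley ^^ k" "(u, w) \<in> left_cayley" by auto
    then obtain s where s: "u \<in> carrier G" "s \<in> S" "w = s \<otimes> u" by (auto simp: left_cayley_iff)
    from Suc.IH[OF u(1)] show ?case
    proof (elim disjE conjE bexE)
      assume "u = g"
      moreover have "s \<in> word_ball (Suc k)" using gen_word_ball[OF s(2)] word_ball_mono[of 1 "Suc k"] by auto
      ultimately show ?thesis using s by blast
    next
      fix h assume h: "g \<in> carrier G" "h \<in> word_ball k" "u = h \<otimes> g"
      then have "w = (s \<otimes> h) \<otimes> g" using s gen_carrier[OF s(2)] word_ball_memD[OF h(2)] by (simp add: m_assoc)
      moreover have "s \<otimes> h \<in> word_ball (Suc k)" using word_ball_mult[OF gen_word_ball[OF s(2)] h(2)] by simp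
      ultimately show ?thesis using h(1) by blast
    qed
  qed simp
  fix w assume "w \<in> gball left_cayley g n"
  then obtain k where "k \<le> n" "(g, w) \<in> left_cayley ^^ k" by (auto simp: gball_def)
  then show "w \<in> insert g ((\<lambda>h. h \<otimes> g) ` word_ball n)" using * word_ball_mono[of k n] by blast
qed

lemma group_augmentation:
  assumes "card (ends \<Gamma>) = 2"
  shows "\<exists>s. \<forall>c. \<forall>\<gamma>\<in>S. pcoloring left_cayley (card S) c \<longrightarrow> c \<one> \<gamma> = None \<longrightarrow> augmentable left_cayley (card S) c \<one> \<gamma> (word_ball s)"
proof -
  interpret L: bounded_degree_graph left_cayley "card S" by (rule bounded_degree_left_cayley)
  obtain C where C: "\<And>n. card (word_ball n) \<le> C * Suc n" using two_ends_growth[OF assms] by blast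
  have fin: "finite (gball left_cayley g n)" for g n
    by (rule finite_subset[OF gball_left_cayley]) (use finite_word_ball in simp)
  have "card (gball left_cayley g n) \<le> Suc C * Suc n" for g n
  proof -
    have "card (gball left_cayley g n) \<le> card (insert g ((\<lambda>h. h \<otimes> g) ` word_ball n))"
      by (rule card_mono[OF _ gball_left_cayley]) (use finite_word_ball in simp)
    also have "\<dots> \<le> Suc (card ((\<lambda>h. h \<otimes> g) ` word_ball n))" by (rule card_insert_le_m1) simp_all
    also have "\<dots> \<le> Suc (card (word_ball n))" using card_image_le[OF finite_word_ball] by simp
    also have "\<dots> \<le> Suc C * Suc n" using C[of n] by simp
    finally show ?thesis .
  qed
  then obtain s where s: "\<forall>c x y. pcoloring left_cayley (card S) c \<longrightarrow> c x y = None \<longrightarrow> (x, y) \<in> left_cayley \<longrightarrow>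
      augmentable left_cayley (card S) c x y (gball left_cayley x s)"
    using L.local_augmentation[OF fin] by blast
  have "augmentable left_cayley (card S) c \<one> \<gamma> (word_ball s)"
    if "\<gamma> \<in> S" "pcoloring left_cayley (card S) c" "c \<one> \<gamma> = None" for c \<gamma>
  proof (rule augmentable_mono)
    have "\<gamma> = \<gamma> \<otimes> \<one>" using gen_carrier[OF that(1)] by simp
    then have "(\<one>, \<gamma>) \<in> left_cayley" using that(1) one_closed unfolding left_cayley_iff by blast
    then show "augmentable left_cayley (card S) c \<one> \<gamma> (gball left_cayley \<one> s)" using s that by blast
    have "\<one> \<in> word_ball s" using word_ball_mono[of 0 s] by auto
    moreover have "(\<lambda>h. h \<otimes> \<one>) ` word_ball s \<subseteq> word_ball s" using word_ball_memD by auto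
    ultimately show "gball left_cayley \<one> s \<subseteq> word_ball s" using gball_left_cayley[of \<one> s] by blast
  qed
  then show ?thesis by blast
qed

section \<open>The shift action on the free part\<close>

abbreviation "X \<equiv> free_part G"
abbreviation "M \<equiv> free_part_space G"
abbreviation act :: "'a \<Rightarrow> ('a \<Rightarrow> bool) \<Rightarrow> 'a \<Rightarrow> bool" where "act \<equiv> shift G"
abbreviation "\<Sigma> \<equiv> shift_graph G S"

lemma X_topspace: "x \<in> X \<Longrightarrow> x \<in> topspace (shift_topology G)"
  by (simp add: free_part_def)

lemma act_one: "x \<in> X \<Longrightarrow> act \<one> x = x"
  using shift_one X_topspace by blast

lemma act_inv_act: "x \<in> X \<Longrightarrow> g \<in> carrier G \<Longrightarrow> act (inv g) (act g x) = x"
  using shift_inv_shift X_topspace by blast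

lemma act_act_inv: "x \<in> X \<Longrightarrow> g \<in> carrier G \<Longrightarrow> act g (act (inv g) x) = x"
  using act_inv_act[of x "inv g"] by simp

lemma measurable_coordinate: "\<delta> \<in> carrier G \<Longrightarrow> (\<lambda>x. x \<delta>) \<in> measurable M (count_space UNIV)"
  unfolding free_part_space_def by (intro measurable_restrict_space1 measurable_shift_coordinate)

lemma measurable_act:
  assumes g: "g \<in> carrier G"
  shows "act g \<in> measurable M M"
proof -
  let ?T = "shift_topology G"
  have cont: "continuous_map ?T ?T (act g)"
    unfolding shift_topology_def continuous_map_componentwise
  proof (intro conjI ballI)
    show "act g ` topspace (product_topology (\<lambda>_. discrete_topology UNIV) (carrier G)) \<subseteq> extensional (carrier G)"
      by (auto simp: shift_def)
    fix k assume k: "k \<in> carrier G"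
    have "continuous_map (product_topology (\<lambda>_. discrete_topology UNIV) (carrier G)) (discrete_topology UNIV) (\<lambda>x. x (inv g \<otimes> k))"
      using g k by (intro continuous_map_product_projection) simp
    then show "continuous_map (product_topology (\<lambda>_. discrete_topology UNIV) (carrier G)) (discrete_topology UNIV) (\<lambda>x. act g x k)"
      using k by (simp add: shift_def)
  qed
  have "act g \<in> measurable (borel_of_topology ?T) (sigma (topspace ?T) {U. openin ?T U})"
  proof (rule measurable_measure_of)
    show "{U. openin ?T U} \<subseteq> Pow (topspace ?T)" using openin_subset by blast
    show "act g \<in> space (borel_of_topology ?T) \<rightarrow> topspace ?T" using shift_in_space by simp
    fix U assume "U \<in> {U. openin ?T U}"
    then have "openin ?T {x \<in> topspace ?T. act g x \<in> U}"
      using openin_continuous_map_preimage[OF cont] by simp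
    then have "{x \<in> topspace ?T. act g x \<in> U} \<in> sets (borel_of_topology ?T)" by (rule sets_borel_of_topology_openin)
    moreover have "act g -` U \<inter> space (borel_of_topology ?T) = {x \<in> topspace ?T. act g x \<in> U}" by auto
    ultimately show "act g -` U \<inter> space (borel_of_topology ?T) \<in> sets (borel_of_topology ?T)" by simp
  qed
  then have "act g \<in> measurable (borel_of_topology ?T) (borel_of_topology ?T)"
    by (simp add: borel_of_topology_def)
  then have "act g \<in> measurable M (borel_of_topology ?T)"
    unfolding free_part_space_def by (rule measurable_restrict_space1)
  moreover have "act g \<in> space M \<rightarrow> X"
    using shift_free_part[OF _ g] by (simp add: space_free_part_space)
  ultimately show ?thesis
    by (subst (2) free_part_space_def) (rule measurable_restrict_space2)
qed

lemma act_preimage: "g \<in> carrier G \<Longrightarrow> A \<in> sets M \<Longrightarrow> {x \<in> X. act g x \<in> A} \<in> sets M"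
  using measurable_sets[OF measurable_act, of g A] by (simp add: vimage_def Int_def conj_commute space_free_part_space)

lemma sets_M_subset: "A \<in> sets M \<Longrightarrow> A \<subseteq> X"
  using sets.sets_into_space space_free_part_space by metis

lemma X_sets: "X \<in> sets M"
  using sets.top[of M] by (simp add: space_free_part_space)

definition indep :: "'a set \<Rightarrow> ('a \<Rightarrow> bool) set \<Rightarrow> bool" where
  "indep K A \<longleftrightarrow> (\<forall>x\<in>A. \<forall>g\<in>K. act g x \<notin> A)"

text \<open>A set of the cover consists of the points that follow a finite 0/1 word \<open>l\<close>
  along an enumeration of the group while all their translates by \<open>K\<close> violate it.
  Freeness provides, for each element of \<open>K\<close>, a coordinate that distinguishes a point
  from its translate.\<close>

lemma countable_indep_cover:
  assumes K: "finite K" "K \<subseteq> carrier G - {\<one>}"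
  obtains V :: "nat \<Rightarrow> ('a \<Rightarrow> bool) set"
  where "\<forall>n. V n \<in> sets M" "\<forall>n. indep K (V n)" "X \<subseteq> (\<Union>n. V n)"
proof -
  define e where "e = from_nat_into (carrier G)"
  have "carrier G \<noteq> {}" using one_closed by blast
  then have e: "range e = carrier G" unfolding e_def by (rule range_from_nat_into[OF _ countable_carrier])
  then have ec: "e i \<in> carrier G" for i by blast
  define W where "W l = {x \<in> X. (\<forall>i<length l. x (e i) = l ! i) \<and> (\<forall>g\<in>K. \<exists>i<length l. act g x (e i) \<noteq> l ! i)}" for l :: "bool list"
  define V where "V n = W (from_nat n)" for n
  have coord: "{x \<in> X. x (e i) = b} \<in> sets M" for i b
  proof -
    have "(\<lambda>x. x (e i)) -` {b} \<inter> space M \<in> sets M"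
      by (rule measurable_sets[OF measurable_coordinate[OF ec]]) simp
    moreover have "(\<lambda>x. x (e i)) -` {b} \<inter> space M = {x \<in> X. x (e i) = b}" by (auto simp: space_free_part_space)
    ultimately show ?thesis by simp
  qed
  have "W l \<in> sets M" for l
  proof -
    have 1: "{x \<in> space M. \<forall>i\<in>{..<length l}. x (e i) = l ! i} \<in> sets M"
      by (intro sets.sets_Collect_finite_All finite_lessThan) (use coord in \<open>auto simp: space_free_part_space\<close>)
    have 2: "{x \<in> space M. \<forall>g\<in>K. \<exists>i\<in>{..<length l}. act g x (e i) \<noteq> l ! i} \<in> sets M"
    proof (intro sets.sets_Collect_finite_All sets.sets_Collect_finite_Ex K(1) finite_lessThan)
      fix g i assume g: "g \<in> K"
      then have gc: "g \<in> carrier G" using K by blast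
      have "{x \<in> X. act g x \<in> {x \<in> X. x (e i) = (\<not> l ! i)}} \<in> sets M" by (rule act_preimage[OF gc coord])
      moreover have "{x \<in> X. act g x \<in> {x \<in> X. x (e i) = (\<not> l ! i)}} = {x \<in> space M. act g x (e i) \<noteq> l ! i}"
        using shift_free_part[OF _ gc] by (auto simp: space_free_part_space)
      ultimately show "{x \<in> space M. act g x (e i) \<noteq> l ! i} \<in> sets M" by simp
    qed
    have "W l = {x \<in> space M. \<forall>i\<in>{..<length l}. x (e i) = l ! i} \<inter>
      {x \<in> space M. \<forall>g\<in>K. \<exists>i\<in>{..<length l}. act g x (e i) \<noteq> l ! i}"
      by (auto simp: W_def space_free_part_space)
    then show ?thesis using sets.Int[OF 1 2] by simp
  qed
  then have "V n \<in> sets M" for n by (simp add: V_def)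
  moreover have "indep K (V n)" for n
    unfolding indep_def V_def W_def by blast
  moreover have "X \<subseteq> (\<Union>n. V n)"
  proof
    fix x assume x: "x \<in> X"
    have "\<exists>i. act g x (e i) \<noteq> x (e i)" if g: "g \<in> K" for g
    proof (rule ccontr)
      assume "\<not> ?thesis"
      then have "act g x \<delta> = x \<delta>" if "\<delta> \<in> carrier G" for \<delta> using that e by (metis rangeE)
      moreover have "act g x \<in> extensional (carrier G)" "x \<in> extensional (carrier G)"
        using shift_in_space[of g x] X_topspace[OF x] by (auto simp: topspace_shift_topology PiE_def)
      ultimately have "act g x = x" by (rule extensionalityI[rotated 2])
      then show False using x g K(2) by (auto simp: free_part_def)
    qed
    then obtain i where i: "\<And>g. g \<in> K \<Longrightarrow> act g x (e (i g)) \<noteq> x (e (i g))" by metis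
    \<comment> \<open>A prefix longer than all distinguishing indices; the inserted 0 covers the
      case of an empty \<open>K\<close>.\<close>
    define N where "N = Suc (Max (insert 0 (i ` K)))"
    have iN: "i g < N" if "g \<in> K" for g
    proof -
      have "i g \<le> Max (insert 0 (i ` K))" by (rule Max_ge) (use K that in auto)
      then show ?thesis by (simp add: N_def)
    qed
    let ?l = "map (\<lambda>i. x (e i)) [0..<N]"
    have "x \<in> W ?l" unfolding W_def using x i iN by fastforce
    then have "x \<in> V (to_nat ?l)" by (simp add: V_def)
    then show "x \<in> (\<Union>n. V n)" by blast
  qed
  ultimately show ?thesis using that[of V] by blast
qed

text \<open>Greedy choice along the countable cover: at stage \<open>n\<close> a point of
  \<open>V n\<close> is added unless it has a neighbor already chosen. Points added at the same
  stage are not adjacent since \<open>V n\<close> is independent, and symmetry of \<open>K\<close>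
  handles different stages.\<close>

lemma maximal_indep:
  assumes K: "finite K" "K \<subseteq> carrier G - {\<one>}" "\<And>g. g \<in> K \<Longrightarrow> inv g \<in> K" and Y: "Y \<in> sets M"
  shows "\<exists>I. I \<in> sets M \<and> I \<subseteq> Y \<and> indep K I \<and> (\<forall>y\<in>Y - I. \<exists>g\<in>K. act g y \<in> I)"
proof -
  obtain V :: "nat \<Rightarrow> ('a \<Rightarrow> bool) set"
    where V: "\<forall>n. V n \<in> sets M" "\<forall>n. indep K (V n)" "X \<subseteq> (\<Union>n. V n)"
    by (rule countable_indep_cover[OF K(1,2)])
  have Kc: "g \<in> carrier G" if "g \<in> K" for g using K(2) that by blast
  define U where "U = rec_nat {} (\<lambda>n U. U \<union> {x \<in> Y \<inter> V n. \<forall>g\<in>K. act g x \<notin> U})"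
  have U0: "U 0 = {}" and US: "U (Suc n) = U n \<union> {x \<in> Y \<inter> V n. \<forall>g\<in>K. act g x \<notin> U n}" for n
    by (simp_all add: U_def)
  have YX: "Y \<subseteq> X" by (rule sets_M_subset[OF Y])
  have Us: "U n \<in> sets M \<and> U n \<subseteq> Y" for n
  proof (induction n)
    case (Suc n)
    have "{x \<in> space M. \<forall>g\<in>K. act g x \<notin> U n} \<in> sets M"
    proof (intro sets.sets_Collect_finite_All sets.sets_Collect_neg K(1))
      fix g assume "g \<in> K"
      then show "{x \<in> space M. act g x \<in> U n} \<in> sets M"
        using act_preimage[OF Kc, of g "U n"] Suc by (simp add: space_free_part_space)
    qed
    then have "Y \<inter> V n \<inter> {x \<in> space M. \<forall>g\<in>K. act g x \<notin> U n} \<in> sets M" using Y V(1) by blast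
    moreover have "Y \<inter> V n \<inter> {x \<in> space M. \<forall>g\<in>K. act g x \<notin> U n} = {x \<in> Y \<inter> V n. \<forall>g\<in>K. act g x \<notin> U n}"
      using YX by (auto simp: space_free_part_space)
    ultimately show ?case using Suc unfolding US by auto
  qed (simp add: U0)
  have mono: "U m \<subseteq> U n" if "m \<le> n" for m n using that by (induction n rule: dec_induct) (auto simp: US)
  have ind: "act g x \<notin> U n" if "x \<in> U n" "g \<in> K" for x g n
    using that
  proof (induction n arbitrary: x g)
    case (Suc n)
    have "x \<in> X" using Suc.prems Us YX by blast
    then have bwd: "act (inv g) (act g x) = x" using act_inv_act Kc Suc.prems by blast
    show ?case
    proof
      assume "act g x \<in> U (Suc n)"
      then consider "x \<in> U n" "act g x \<in> U n" | "x \<in> U n" "\<forall>h\<in>K. act h (act g x) \<notin> U n"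
        | "\<forall>h\<in>K. act h x \<notin> U n" "act g x \<in> U n" | "x \<in> V n" "act g x \<in> V n"
        using Suc.prems(1) unfolding US by blast
      then show False
      proof cases
        case 1 then show False using Suc.IH Suc.prems(2) by blast
      next
        case 2 then show False using bwd K(3)[OF Suc.prems(2)] by metis
      next
        case 3 then show False using Suc.prems(2) by blast
      next
        case 4 then show False using V(2) Suc.prems(2) unfolding indep_def by blast
      qed
    qed
  qed (simp add: U0)
  let ?I = "\<Union>n. U n"
  have "?I \<in> sets M" using Us by blast
  moreover have "?I \<subseteq> Y" using Us by blast
  moreover have "indep K ?I"
    unfolding indep_def
  proof (intro ballI notI)
    fix x g assume "x \<in> ?I" "g \<in> K" "act g x \<in> ?I"
    then obtain m n where mn: "x \<in> U m" "act g x \<in> U n" by blast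
    then have "x \<in> U (max m n)" "act g x \<in> U (max m n)" using mono[of m "max m n"] mono[of n "max m n"] by auto
    then show False using ind \<open>g \<in> K\<close> by blast
  qed
  moreover have "\<exists>g\<in>K. act g y \<in> ?I" if y: "y \<in> Y - ?I" for y
  proof -
    obtain n where n: "y \<in> V n" using y YX V(3) by blast
    have "y \<notin> U (Suc n)" using y by blast
    then show ?thesis using n y unfolding US by blast
  qed
  ultimately show ?thesis by (intro exI[of _ ?I] conjI ballI)
qed

text \<open>
  Maximal independent sets are removed repeatedly: a point that survives \<open>n\<close> rounds has neighbours in
  \<open>n\<close> disjoint sets.
\<close>

lemma finite_indep_cover:
  assumes K: "finite K" "K \<subseteq> carrier G - {\<one>}" "\<And>g. g \<in> K \<Longrightarrow> inv g \<in> K"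
  obtains A :: "nat \<Rightarrow> ('a \<Rightarrow> bool) set" and N
  where "\<forall>n. A n \<in> sets M" "\<forall>n. indep K (A n)" "X \<subseteq> (\<Union>n<N. A n)"
proof -
  define max_indep where "max_indep Y = (SOME I. I \<in> sets M \<and> I \<subseteq> Y \<and> indep K I \<and> (\<forall>y\<in>Y - I. \<exists>g\<in>K. act g y \<in> I))" for Y
  have max_indep: "max_indep Y \<in> sets M \<and> max_indep Y \<subseteq> Y \<and> indep K (max_indep Y) \<and> (\<forall>y\<in>Y - max_indep Y. \<exists>g\<in>K. act g y \<in> max_indep Y)" if "Y \<in> sets M" for Y
    unfolding max_indep_def by (rule someI_ex) (rule maximal_indep[OF K that])
  define Y where "Y = rec_nat X (\<lambda>n Y. Y - max_indep Y)"
  have Y0: "Y 0 = X" and YS: "Y (Suc n) = Y n - max_indep (Y n)" for n by (simp_all add: Y_def)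
  have Ys: "Y n \<in> sets M" for n
  proof (induction n)
    case (Suc n) then show ?case unfolding YS using max_indep[OF Suc] by (intro sets.Diff) auto
  qed (simp add: Y0 X_sets)
  have mono: "Y n \<subseteq> Y m" if "m \<le> n" for m n using that by (induction n rule: dec_induct) (auto simp: YS)
  have disj: "max_indep (Y m) \<inter> max_indep (Y n) = {}" if "m < n" for m n
  proof -
    have "max_indep (Y n) \<subseteq> Y (Suc m)" using max_indep[OF Ys[of n]] mono[of "Suc m" n] that by auto
    then show ?thesis unfolding YS by blast
  qed
  let ?N = "Suc (card K)"
  have "Y ?N = {}"
  proof (rule ccontr)
    assume "Y ?N \<noteq> {}"
    then obtain y where y: "y \<in> Y ?N" by blast
    have "\<exists>g\<in>K. act g y \<in> max_indep (Y n)" if "n < ?N" for n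
    proof -
      have "y \<in> Y n - max_indep (Y n)" using y mono[of "Suc n" ?N] that unfolding YS by auto
      then show ?thesis using max_indep[OF Ys] by blast
    qed
    then obtain h where h: "\<And>n. n < ?N \<Longrightarrow> h n \<in> K \<and> act (h n) y \<in> max_indep (Y n)" by metis
    have "inj_on h {..<?N}"
    proof (intro linorder_inj_onI)
      fix m n assume "m < n" "m \<in> {..<?N}" "n \<in> {..<?N}"
      then show "h m \<noteq> h n" using h[of m] h[of n] disj[of m n] by auto
    qed auto
    then have "card (h ` {..<?N}) = ?N" by (simp add: card_image)
    moreover have "h ` {..<?N} \<subseteq> K" using h by blast
    ultimately show False using card_mono[OF K(1)] by (metis Suc_n_not_le_n)
  qed
  moreover have "X \<subseteq> (\<Union>n<m. max_indep (Y n)) \<union> Y m" for m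
  proof (induction m)
    case (Suc m)
    have "Y m \<subseteq> max_indep (Y m) \<union> Y (Suc m)" unfolding YS by blast
    then show ?case using Suc by (auto simp: lessThan_Suc)
  qed (simp add: Y0)
  ultimately have "X \<subseteq> (\<Union>n<?N. max_indep (Y n))" by blast
  then show ?thesis using that[of "\<lambda>n. max_indep (Y n)" ?N] max_indep[OF Ys] by simp
qed

section \<open>Coloring the shift graph\<close>

abbreviation "d \<equiv> card S"
abbreviation "\<Lambda> \<equiv> left_cayley"

lemma shift_graph_iff: "(x, y) \<in> \<Sigma> \<longleftrightarrow> x \<in> X \<and> (\<exists>\<gamma>\<in>S. y = act \<gamma> x)"
  using shift_free_part gen_carrier by (auto simp: shift_graph_def)

lemma act_mult: "g \<in> carrier G \<Longrightarrow> h \<in> carrier G \<Longrightarrow> act (g \<otimes> h) x = act g (act h x)"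
  by (rule shift_mult)

text \<open>Every edge at \<open>x\<close> is named by a generator, so sets of single points suffice
  and the product space enters only at the very end.\<close>

definition borel_pcoloring :: "(('a \<Rightarrow> bool) \<Rightarrow> ('a \<Rightarrow> bool) \<Rightarrow> nat option) \<Rightarrow> bool" where
  "borel_pcoloring c \<longleftrightarrow> (\<forall>\<gamma>\<in>S. \<forall>k. {x \<in> X. c x (act \<gamma> x) = k} \<in> sets M)"

text \<open>
  The replacement near a point is chosen as a function of one of finitely many patterns, so no
  measurable selection is needed.
\<close>

definition pattern_edges :: "nat \<Rightarrow> ('a \<times> 'a) set" where
  "pattern_edges s = \<Lambda> \<inter> word_ball (Suc s) \<times> word_ball (Suc s)"

text \<open>The coloring seen through the orbit map at \<open>x\<close>. It reaches one step beyond
  the radius \<open>s\<close> of the changes, so it includes every edge at a vertex of the ball and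
  the new pattern is proper against edges leaving that ball.\<close>

definition local_pattern :: "(('a \<Rightarrow> bool) \<Rightarrow> ('a \<Rightarrow> bool) \<Rightarrow> nat option) \<Rightarrow> nat \<Rightarrow> ('a \<Rightarrow> bool) \<Rightarrow> 'a \<Rightarrow> 'a \<Rightarrow> nat option" where
  "local_pattern c s x = (\<lambda>g h. if (g, h) \<in> pattern_edges s then c (act g x) (act h x) else None)"

lemma left_cayley_carrier: "(g, h) \<in> \<Lambda> \<Longrightarrow> g \<in> carrier G \<and> h \<in> carrier G"
  using gen_carrier by (auto simp: left_cayley_iff)

lemma left_cayley_sym: "(g, h) \<in> \<Lambda> \<Longrightarrow> (h, g) \<in> \<Lambda>"
  using bounded_degree_graph.symED[OF bounded_degree_left_cayley] .

lemma pattern_edges_edge: "p \<in> pattern_edges s \<Longrightarrow> p \<in> \<Lambda>"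
  by (simp add: pattern_edges_def)

lemma finite_pattern_edges: "finite (pattern_edges s)"
  unfolding pattern_edges_def using finite_word_ball[of "Suc s"] by blast

lemma local_pattern_pcoloring:
  assumes c: "pcoloring \<Sigma> d c" and x: "x \<in> X"
  shows "pcoloring \<Lambda> d (local_pattern c s x)"
  unfolding pcoloring_def
proof (intro conjI allI impI)
  have iff: "(g, h) \<in> pattern_edges s \<longleftrightarrow> (h, g) \<in> pattern_edges s" for g h
    unfolding pattern_edges_def using left_cayley_sym by blast
  show "local_pattern c s x g h = local_pattern c s x h g" for g h
    unfolding local_pattern_def using iff[of g h] pcoloring_sym[OF c, of "act g x" "act h x"] by metis
  have *: "(g, h) \<in> \<Lambda> \<and> c (act g x) (act h x) = Some a" if "local_pattern c s x g h = Some a" for g h a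
    using that by (auto simp: local_pattern_def pattern_edges_edge split: if_splits)
  show "(g, h) \<in> \<Lambda>" "a \<le> d" if "local_pattern c s x g h = Some a" for g h a
    using *[OF that] pcoloring_le[OF c] by blast+
  show "h = h'" if 1: "local_pattern c s x g h = Some a" and 2: "local_pattern c s x g h' = Some a" for g h h' a
  proof -
    have "act h x = act h' x" using *[OF 1] *[OF 2] pcoloring_inj[OF c] by blast
    then show ?thesis
      using free_part_shift_eq_iff[OF x, of h h'] *[OF 1] *[OF 2] left_cayley_carrier by blast
  qed
qed

lemma finite_local_pattern_range:
  assumes c: "pcoloring \<Sigma> d c"
  shows "finite (range (local_pattern c s))"
proof -
  let ?F = "pattern_edges s" and ?B = "insert None (Some ` {..d})"
  have "finite {f. \<forall>p. (p \<in> ?F \<longrightarrow> f p \<in> ?B) \<and> (p \<notin> ?F \<longrightarrow> f p = None)}"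
    by (rule finite_set_of_finite_funs[OF finite_pattern_edges]) simp
  moreover have "range (local_pattern c s) \<subseteq> curry ` {f. \<forall>p. (p \<in> ?F \<longrightarrow> f p \<in> ?B) \<and> (p \<notin> ?F \<longrightarrow> f p = None)}"
  proof
    fix \<pi> assume "\<pi> \<in> range (local_pattern c s)"
    then obtain x where x: "\<pi> = local_pattern c s x" by blast
    have "c u v \<in> ?B" for u v using pcoloring_le[OF c, of u v] by (cases "c u v") auto
    then have "case_prod \<pi> \<in> {f. \<forall>p. (p \<in> ?F \<longrightarrow> f p \<in> ?B) \<and> (p \<notin> ?F \<longrightarrow> f p = None)}"
      unfolding x local_pattern_def by (simp add: case_prod_beta)
    then have "curry (case_prod \<pi>) \<in> curry ` {f. \<forall>p. (p \<in> pattern_edges s \<longrightarrow> f p \<in> ?B) \<and> (p \<notin> pattern_edges s \<longrightarrow> f p = None)}"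
      by (rule imageI)
    then show "\<pi> \<in> curry ` {f. \<forall>p. (p \<in> ?F \<longrightarrow> f p \<in> ?B) \<and> (p \<notin> ?F \<longrightarrow> f p = None)}"
      by simp
  qed
  ultimately show ?thesis by (meson finite_imageI finite_subset)
qed

text \<open>No regularity of \<Phi> is needed, even if it involves arbitrary choices: only finitely
  many patterns occur, and each of them occurs on a Borel set.\<close>

lemma local_pattern_measurable:
  assumes c: "pcoloring \<Sigma> d c" and b: "borel_pcoloring c"
  shows "{x \<in> X. \<Phi> (local_pattern c s x)} \<in> sets M"
proof -
  let ?F = "pattern_edges s"
  have single: "{x \<in> X. c (act g x) (act h x) = k} \<in> sets M" if gh: "(g, h) \<in> \<Lambda>" for g h k
  proof -
    obtain \<gamma> where \<gamma>: "g \<in> carrier G" "\<gamma> \<in> S" "h = \<gamma> \<otimes> g" using gh by (auto simp: left_cayley_iff)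
    have "{x \<in> X. act g x \<in> {y \<in> X. c y (act \<gamma> y) = k}} \<in> sets M"
      using b \<gamma> by (intro act_preimage) (auto simp: borel_pcoloring_def)
    moreover have "{x \<in> X. act g x \<in> {y \<in> X. c y (act \<gamma> y) = k}} = {x \<in> X. c (act g x) (act h x) = k}"
      using shift_free_part[OF _ \<gamma>(1)] act_mult[OF gen_carrier[OF \<gamma>(2)] \<gamma>(1)] \<gamma>(3) by auto
    ultimately show ?thesis by simp
  qed
  have pi: "{x \<in> X. local_pattern c s x = \<pi>} \<in> sets M" for \<pi>
  proof (cases "\<forall>g h. (g, h) \<notin> ?F \<longrightarrow> \<pi> g h = None")
    case True
    have eq: "local_pattern c s x = \<pi> \<longleftrightarrow> (\<forall>p\<in>?F. c (act (fst p) x) (act (snd p) x) = \<pi> (fst p) (snd p))" for x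
    proof
      assume e: "local_pattern c s x = \<pi>"
      show "\<forall>p\<in>?F. c (act (fst p) x) (act (snd p) x) = \<pi> (fst p) (snd p)"
      proof
        fix p assume "p \<in> ?F"
        moreover obtain g h where "p = (g, h)" by (cases p)
        ultimately show "c (act (fst p) x) (act (snd p) x) = \<pi> (fst p) (snd p)"
          using e unfolding local_pattern_def by auto
      qed
    next
      assume r: "\<forall>p\<in>?F. c (act (fst p) x) (act (snd p) x) = \<pi> (fst p) (snd p)"
      show "local_pattern c s x = \<pi>"
      proof (intro ext)
        fix g h show "local_pattern c s x g h = \<pi> g h"
          using r True by (cases "(g, h) \<in> ?F") (auto simp: local_pattern_def)
      qed
    qed
    have "{x \<in> space M. \<forall>p\<in>?F. c (act (fst p) x) (act (snd p) x) = \<pi> (fst p) (snd p)} \<in> sets M"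
    proof (intro sets.sets_Collect_finite_All)
      show "finite ?F" by (rule finite_pattern_edges)
      fix p assume "p \<in> ?F"
      then show "{x \<in> space M. c (act (fst p) x) (act (snd p) x) = \<pi> (fst p) (snd p)} \<in> sets M"
        using single[of "fst p" "snd p"] pattern_edges_edge[of p s] by (simp add: space_free_part_space)
    qed
    then show ?thesis by (simp add: eq space_free_part_space)
  next
    case False
    then have "{x \<in> X. local_pattern c s x = \<pi>} = {}" by (auto simp: local_pattern_def)
    then show ?thesis by (simp only: sets.empty_sets)
  qed
  have "{x \<in> X. \<Phi> (local_pattern c s x)} = (\<Union>\<pi>\<in>{\<pi> \<in> range (local_pattern c s). \<Phi> \<pi>}. {x \<in> X. local_pattern c s x = \<pi>})" by auto
  moreover have "finite {\<pi> \<in> range (local_pattern c s). \<Phi> \<pi>}" using finite_local_pattern_range[OF c] by simp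
  ultimately show ?thesis using pi by (simp add: sets.finite_UN)
qed

text \<open>One round for a single generator: every point of \<open>A\<close> receives an
  augmentation inside its own translate of \<open>word_ball s\<close>. Independence at radius 2s
  makes these regions disjoint, so the pieces can be pasted together.\<close>

lemma augment_separated:
  assumes aug: "\<forall>c. \<forall>\<gamma>\<in>S. pcoloring \<Lambda> d c \<longrightarrow> c \<one> \<gamma> = None \<longrightarrow> augmentable \<Lambda> d c \<one> \<gamma> (word_ball s)"
    and c: "pcoloring \<Sigma> d c" "borel_pcoloring c" and A: "A \<in> sets M" "indep (word_ball (2 * s) - {\<one>}) A" and \<gamma>0: "\<gamma>0 \<in> S"
  shows "\<exists>c'. pcoloring \<Sigma> d c' \<and> borel_pcoloring c' \<and> (\<forall>x y. c x y \<noteq> None \<longrightarrow> c' x y \<noteq> None) \<and> (\<forall>x\<in>A. c' x (act \<gamma>0 x) \<noteq> None)"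
proof -
  have AX: "A \<subseteq> X" by (rule sets_M_subset[OF A(1)])
  define good where "good \<pi> \<pi>' \<longleftrightarrow> pcoloring \<Lambda> d \<pi>' \<and> \<pi>' \<one> \<gamma>0 \<noteq> None \<and> (\<forall>x y. \<pi> x y \<noteq> None \<longrightarrow> \<pi>' x y \<noteq> None)
     \<and> (\<forall>x y. \<pi>' x y \<noteq> \<pi> x y \<longrightarrow> x \<in> word_ball s \<and> y \<in> word_ball s)" for \<pi> \<pi>'
  \<comment> \<open>The choice is made per pattern and not per point, so any condition on
    \<open>q x\<close> is a condition on the pattern at \<open>x\<close>.\<close>
  define aug where "aug \<pi> = (SOME \<pi>'. good \<pi> \<pi>')" for \<pi>
  define q where "q x = aug (local_pattern c s x)" for x
  have ex_good: "\<exists>\<pi>'. good \<pi> \<pi>'" if "pcoloring \<Lambda> d \<pi>" for \<pi>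
  proof (cases "\<pi> \<one> \<gamma>0 = None")
    case True
    then show ?thesis using assms(1) \<gamma>0 that unfolding augmentable_def good_def by blast
  next
    case False
    then have "good \<pi> \<pi>" using that by (simp add: good_def)
    then show ?thesis by blast
  qed
  have "good (local_pattern c s x) (q x)" if "x \<in> X" for x
    using someI_ex[OF ex_good[OF local_pattern_pcoloring[OF c(1) that]]] unfolding q_def aug_def .
  then have q1: "pcoloring \<Lambda> d (q x)" and q2: "q x \<one> \<gamma>0 \<noteq> None"
    and q3: "local_pattern c s x g h \<noteq> None \<Longrightarrow> q x g h \<noteq> None"
    and q4: "q x g h \<noteq> local_pattern c s x g h \<Longrightarrow> g \<in> word_ball s \<and> h \<in> word_ball s" if "x \<in> X" for x g h
    using that unfolding good_def by blast+
  \<comment> \<open>If two balls met, one center would be the translate of the other by an element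
    of length at most 2s, which independence rules out unless it is the identity.\<close>
  have uniq: "x = x' \<and> g = g'" if "x \<in> A" "x' \<in> A" "g \<in> word_ball s" "g' \<in> word_ball s" "act g x = act g' x'" for x x' g g'
  proof -
    have gc: "g \<in> carrier G" "g' \<in> carrier G" and xX: "x \<in> X" "x' \<in> X"
      using that word_ball_memD AX by auto
    have x': "x' = act (inv g' \<otimes> g) x"
      using act_inv_act[OF xX(2) gc(2)] that(5) gc by (simp add: act_mult)
    have "inv g' \<otimes> g \<in> word_ball (2 * s)"
      using word_ball_mult[OF word_ball_inv[OF that(4)] that(3)] by (simp add: mult_2)
    then have one: "inv g' \<otimes> g = \<one>" using A(2) x' that(1,2) unfolding indep_def by blast
    then have "x' = x" using x' act_one[OF xX(1)] by simp
    moreover have "g = g'" using one gc by (metis inv_closed inv_equality inv_inv)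
    ultimately show ?thesis by simp
  qed
  define R where "R y z p \<longleftrightarrow> (case p of (g, h, x) \<Rightarrow> x \<in> A \<and> g \<in> word_ball s \<and> h \<in> word_ball s \<and> y = act g x \<and> z = act h x)" for y z p
  define c' where "c' y z = (if \<exists>p. R y z p then (case SOME p. R y z p of (g, h, x) \<Rightarrow> q x g h) else c y z)" for y z
  have Runiq: "p = p'" if "R y z p" "R y z p'" for y z p p'
  proof -
    obtain g h x g' h' x' where p: "p = (g, h, x)" "p' = (g', h', x')" by (cases p, cases p') auto
    have "x = x' \<and> g = g'" using uniq[of x x' g g'] that unfolding p R_def by auto
    moreover have "x = x' \<and> h = h'" using uniq[of x x' h h'] that unfolding p R_def by auto
    ultimately show ?thesis by (simp add: p)
  qed
  have cR: "c' y z = q x g h" if "R y z (g, h, x)" for y z g h x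
  proof -
    have "(SOME p. R y z p) = (g, h, x)" using Runiq[OF _ that] that by (metis someI)
    then show ?thesis using that unfolding c'_def by auto
  qed
  have cN: "c' y z = c y z" if "\<not> (\<exists>p. R y z p)" for y z using that by (simp add: c'_def)
  have near: "c' (act g x) (act (\<gamma> \<otimes> g) x) = q x g (\<gamma> \<otimes> g)"
    "c (act g x) (act (\<gamma> \<otimes> g) x) = local_pattern c s x g (\<gamma> \<otimes> g)" if x: "x \<in> A" and g: "g \<in> word_ball s" and \<gamma>: "\<gamma> \<in> S" for x g \<gamma>
  proof -
    have gc: "g \<in> carrier G" "\<gamma> \<in> carrier G" using word_ball_memD[OF g] gen_carrier[OF \<gamma>] by auto
    have xX: "x \<in> X" using x AX by blast
    have e: "(g, \<gamma> \<otimes> g) \<in> \<Lambda>" using gc \<gamma> by (auto simp: left_cayley_iff)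
    have w: "g \<in> word_ball (Suc s)" "\<gamma> \<otimes> g \<in> word_ball (Suc s)"
      using g word_ball_mono[of s "Suc s"] word_ball_mult[OF gen_word_ball[OF \<gamma>] g] by auto
    show pc: "c (act g x) (act (\<gamma> \<otimes> g) x) = local_pattern c s x g (\<gamma> \<otimes> g)" using e w by (simp add: local_pattern_def pattern_edges_def)
    show "c' (act g x) (act (\<gamma> \<otimes> g) x) = q x g (\<gamma> \<otimes> g)"
    proof (cases "\<gamma> \<otimes> g \<in> word_ball s")
      case True
      then show ?thesis using x g by (intro cR) (simp add: R_def)
    next
      case False
      \<comment> \<open>An edge leaving the ball is not in any of the regions: its inner end
        determines the center. It keeps its old color, and so does the pattern, because changes have
        both ends in the ball.\<close>
      have "\<not> R (act g x) (act (\<gamma> \<otimes> g) x) p" for p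
      proof
        assume R: "R (act g x) (act (\<gamma> \<otimes> g) x) p"
        obtain g' h' x' where p: "p = (g', h', x')" by (cases p)
        have "x = x'" using uniq[of x x' g g'] R x g unfolding p R_def by auto
        moreover have "h' \<in> word_ball s" "act (\<gamma> \<otimes> g) x = act h' x'" using R unfolding p R_def by auto
        ultimately have "\<gamma> \<otimes> g = h'"
          using free_part_shift_eq_iff[OF xX, of "\<gamma> \<otimes> g" h'] gc word_ball_memD by auto
        then show False using False \<open>h' \<in> word_ball s\<close> by simp
      qed
      then have "c' (act g x) (act (\<gamma> \<otimes> g) x) = c (act g x) (act (\<gamma> \<otimes> g) x)" by (intro cN) blast
      then show ?thesis using pc q4[OF xX, of g "\<gamma> \<otimes> g"] False by metis
    qed
  qed
  have far: "c' y z = c y z" if "\<And>x g. x \<in> A \<Longrightarrow> g \<in> word_ball s \<Longrightarrow> y \<noteq> act g x" for y z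
    by (rule cN) (use that in \<open>auto simp: R_def\<close>)
  have step: "\<exists>\<gamma>\<in>S. z = act (\<gamma> \<otimes> g) x" if "x \<in> X" "g \<in> carrier G" "(act g x, z) \<in> \<Sigma>" for x g z
    using that by (auto simp: shift_graph_iff act_mult gen_carrier)
  have edge: "(y, z) \<in> \<Sigma> \<and> a \<le> d" if a: "c' y z = Some a" for y z a
  proof (cases "\<exists>p. R y z p")
    case True
    then obtain g h x where R: "R y z (g, h, x)" by auto
    then have x: "x \<in> X" "x \<in> A" "g \<in> word_ball s" "y = act g x" "z = act h x" using AX by (auto simp: R_def)
    have qa: "q x g h = Some a" using cR[OF R] a by simp
    have "(g, h) \<in> \<Lambda>" by (rule pcoloring_edge[OF q1[OF x(1)] qa])
    then obtain \<gamma> where \<gamma>: "g \<in> carrier G" "\<gamma> \<in> S" "h = \<gamma> \<otimes> g" by (auto simp: left_cayley_iff)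
    then have "z = act \<gamma> y" using x by (simp add: act_mult gen_carrier)
    then have "(y, z) \<in> \<Sigma>" unfolding shift_graph_iff using \<gamma> x shift_free_part by blast
    then show ?thesis using pcoloring_le[OF q1[OF x(1)] qa] by blast
  next
    case False
    then have "c y z = Some a" using cN[OF False] a by simp
    then show ?thesis using pcoloring_edge[OF c(1)] pcoloring_le[OF c(1)] by blast
  qed
  have pc': "pcoloring \<Sigma> d c'"
    unfolding pcoloring_def
  proof (intro conjI allI impI)
    show "c' y z = c' z y" for y z
    proof (cases "\<exists>p. R y z p")
      case True
      then obtain g h x where R: "R y z (g, h, x)" by auto
      then have R': "R z y (h, g, x)" and x: "x \<in> X" using AX by (auto simp: R_def)
      show ?thesis using cR[OF R] cR[OF R'] pcoloring_sym[OF q1[OF x], of g h] by simp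
    next
      case False
      then have "\<not> (\<exists>p. R z y p)" by (auto simp: R_def)
      then show ?thesis using cN[OF False] cN[of z y] pcoloring_sym[OF c(1), of y z] by simp
    qed
    show "(y, z) \<in> \<Sigma>" "a \<le> d" if "c' y z = Some a" for y z a using edge[OF that] by auto
    show "z = w" if z: "c' y z = Some a" and w: "c' y w = Some a" for y z w a
    proof (cases "\<exists>x g. x \<in> A \<and> g \<in> word_ball s \<and> y = act g x")
      case True
      then obtain x g where x: "x \<in> A" "g \<in> word_ball s" "y = act g x" by blast
      then have xX: "x \<in> X" and gc: "g \<in> carrier G" using AX word_ball_memD by auto
      obtain \<gamma> where \<gamma>: "\<gamma> \<in> S" "z = act (\<gamma> \<otimes> g) x" using step[OF xX gc] edge[OF z] x(3) by blast
      obtain \<delta> where \<delta>: "\<delta> \<in> S" "w = act (\<delta> \<otimes> g) x" using step[OF xX gc] edge[OF w] x(3) by blast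
      \<comment> \<open>All edges at a vertex of a ball are read in the single pattern
        \<open>q x\<close>, whose properness is transported to the orbit.\<close>
      have "q x g (\<gamma> \<otimes> g) = Some a" "q x g (\<delta> \<otimes> g) = Some a"
        using near(1)[OF x(1,2) \<gamma>(1)] near(1)[OF x(1,2) \<delta>(1)] z w x(3) \<gamma>(2) \<delta>(2) by auto
      then have "\<gamma> \<otimes> g = \<delta> \<otimes> g" by (rule pcoloring_inj[OF q1[OF xX]])
      then show ?thesis using \<gamma> \<delta> by simp
    next
      case False
      then have f: "c' y z = c y z" "c' y w = c y w" using far by blast+
      have "c y z = Some a" "c y w = Some a" using f z w by simp_all
      then show ?thesis by (rule pcoloring_inj[OF c(1)])
    qed
  qed
  have "c' y z \<noteq> None" if yz: "c y z \<noteq> None" for y z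
  proof (cases "\<exists>x g. x \<in> A \<and> g \<in> word_ball s \<and> y = act g x")
    case True
    then obtain x g where x: "x \<in> A" "g \<in> word_ball s" "y = act g x" by blast
    then have xX: "x \<in> X" and gc: "g \<in> carrier G" using AX word_ball_memD by auto
    have "(y, z) \<in> \<Sigma>" using yz pcoloring_edge[OF c(1)] by blast
    then obtain \<gamma> where \<gamma>: "\<gamma> \<in> S" "z = act (\<gamma> \<otimes> g) x" using step[OF xX gc] x(3) by blast
    show ?thesis
      using near[OF x(1,2) \<gamma>(1)] q3[OF xX, of g "\<gamma> \<otimes> g"] yz x(3) \<gamma>(2) by simp
  next
    case False
    then have "c' y z = c y z" using far by blast
    then show ?thesis using yz by simp
  qed
  moreover have "c' x (act \<gamma>0 x) \<noteq> None" if "x \<in> A" for x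
  proof -
    have xX: "x \<in> X" using that AX by blast
    have "\<one> \<in> word_ball s" using word_ball_mono[of 0 s] by auto
    from near(1)[OF that this \<gamma>0] show ?thesis
      using q2[OF xX] act_one[OF xX] gen_carrier[OF \<gamma>0] by simp
  qed
  moreover have "borel_pcoloring c'"
    unfolding borel_pcoloring_def
  proof (intro ballI allI)
    fix \<gamma> k assume \<gamma>: "\<gamma> \<in> S"
    \<comment> \<open>\<open>?U\<close> describes the fibre over \<open>k\<close> inside the balls,
      with the center recovered by applying the inverse of \<open>g\<close>; \<open>?C\<close>
      describes it outside, where nothing changed.\<close>
    let ?Z = "\<lambda>g. {x \<in> X. x \<in> A \<and> q x g (\<gamma> \<otimes> g) = k}"
    let ?U = "\<Union>g\<in>word_ball s. {y \<in> X. act (inv g) y \<in> ?Z g}"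
    let ?C = "{y \<in> X. c y (act \<gamma> y) = k} - (\<Union>g\<in>word_ball s. {y \<in> X. act (inv g) y \<in> A})"
    have Z: "?Z g \<in> sets M" for g
    proof -
      have "{x \<in> X. q x g (\<gamma> \<otimes> g) = k} \<in> sets M"
        unfolding q_def by (rule local_pattern_measurable[OF c])
      then have "A \<inter> {x \<in> X. q x g (\<gamma> \<otimes> g) = k} \<in> sets M" using A(1) by blast
      moreover have "?Z g = A \<inter> {x \<in> X. q x g (\<gamma> \<otimes> g) = k}" by blast
      ultimately show ?thesis by simp
    qed
    have pre: "{y \<in> X. act (inv g) y \<in> B} \<in> sets M" if "g \<in> word_ball s" "B \<in> sets M" for g B
      using act_preimage[of "inv g" B] word_ball_memD[OF that(1)] that(2) by simp
    have "?U \<in> sets M" by (intro sets.finite_UN finite_word_ball pre Z)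
    moreover have "?C \<in> sets M"
    proof (rule sets.Diff)
      show "{y \<in> X. c y (act \<gamma> y) = k} \<in> sets M" using c(2) \<gamma> unfolding borel_pcoloring_def by blast
      show "(\<Union>g\<in>word_ball s. {y \<in> X. act (inv g) y \<in> A}) \<in> sets M"
        by (intro sets.finite_UN finite_word_ball pre A(1))
    qed
    ultimately have "?U \<union> ?C \<in> sets M" by blast
    moreover have "{y \<in> X. c' y (act \<gamma> y) = k} = ?U \<union> ?C"
    proof (intro Set.set_eqI)
      fix y
      show "y \<in> {y \<in> X. c' y (act \<gamma> y) = k} \<longleftrightarrow> y \<in> ?U \<union> ?C"
      proof (cases "y \<in> X \<and> (\<exists>x g. x \<in> A \<and> g \<in> word_ball s \<and> y = act g x)")
        case True
        then obtain x g where x: "x \<in> A" "g \<in> word_ball s" "y = act g x" and yX: "y \<in> X" by blast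
        then have xX: "x \<in> X" and gc: "g \<in> carrier G" using AX word_ball_memD by auto
        have xy: "act (inv g) y = x" using act_inv_act[OF xX gc] x(3) by simp
        have only: "g' = g" if "g' \<in> word_ball s" "act (inv g') y \<in> A" for g'
          using uniq[OF that(2) x(1) that(1) x(2)] act_act_inv[OF yX word_ball_memD[OF that(1)]] x(3) by simp
        have "c' y (act \<gamma> y) = q x g (\<gamma> \<otimes> g)"
          using near(1)[OF x(1,2) \<gamma>] x(3) act_mult[OF gen_carrier[OF \<gamma>] gc] by simp
        then have L: "y \<in> {y \<in> X. c' y (act \<gamma> y) = k} \<longleftrightarrow> q x g (\<gamma> \<otimes> g) = k" using yX by simp
        have C: "y \<notin> ?C" using x(1,2) xy yX by auto
        have U: "y \<in> ?U \<longleftrightarrow> q x g (\<gamma> \<otimes> g) = k"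
        proof
          assume "y \<in> ?U"
          then obtain g' where g': "g' \<in> word_ball s" "act (inv g') y \<in> ?Z g'" by blast
          then have "g' = g" using only by blast
          then show "q x g (\<gamma> \<otimes> g) = k" using g'(2) xy by simp
        next
          assume "q x g (\<gamma> \<otimes> g) = k"
          then have "act (inv g) y \<in> ?Z g" using xy x(1) xX by simp
          then show "y \<in> ?U" using yX x(2) by blast
        qed
        show ?thesis unfolding Un_iff using L U C by argo
      next
        case False
        have no: "act (inv g) y \<notin> A" if "y \<in> X" "g \<in> word_ball s" for g
          using False that act_act_inv[OF that(1) word_ball_memD[OF that(2)]] by metis
        have "c' y (act \<gamma> y) = c y (act \<gamma> y)" if "y \<in> X" by (rule far) (use False that in blast)
        then show ?thesis using no by auto
      qed
    qed
    ultimately show "{y \<in> X. c' y (act \<gamma> y) = k} \<in> sets M" by simp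
  qed
  ultimately show ?thesis using pc' by blast
qed

text \<open>There is one round for each pair of a separated class and a generator, starting from the
  empty coloring. Colored edges stay colored, and every edge starts at a point of some
  class.\<close>

lemma ex_total_coloring:
  assumes "card (ends \<Gamma>) = 2"
  obtains c where "pcoloring \<Sigma> d c" "borel_pcoloring c" "\<forall>(x, y)\<in>\<Sigma>. c x y \<noteq> None"
proof -
  obtain s where s: "\<forall>c. \<forall>\<gamma>\<in>S. pcoloring \<Lambda> d c \<longrightarrow> c \<one> \<gamma> = None \<longrightarrow> augmentable \<Lambda> d c \<one> \<gamma> (word_ball s)"
    using group_augmentation[OF assms] by blast
  define K where "K = word_ball (2 * s) - {\<one>}"
  have K: "finite K" "K \<subseteq> carrier G - {\<one>}" using finite_word_ball word_ball_memD by (auto simp: K_def)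
  have Kinv: "inv g \<in> K" if "g \<in> K" for g
    using that word_ball_inv[of g "2 * s"] word_ball_memD[of g "2 * s"] by (auto simp: K_def)
  obtain A :: "nat \<Rightarrow> ('a \<Rightarrow> bool) set" and N
    where A: "\<forall>n. A n \<in> sets M" "\<forall>n. indep K (A n)" "X \<subseteq> (\<Union>n<N. A n)"
    by (rule finite_indep_cover[OF K Kinv])
  have "\<exists>c. pcoloring \<Sigma> d c \<and> borel_pcoloring c \<and> (\<forall>(i, \<gamma>)\<in>P. \<forall>x\<in>A i. c x (act \<gamma> x) \<noteq> None)"
    if "finite P" "P \<subseteq> {..<N} \<times> S" for P
    using that
  proof (induction rule: finite_induct)
    case empty
    have "pcoloring \<Sigma> d (\<lambda>_ _. None)" by (simp add: pcoloring_def)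
    moreover have "borel_pcoloring (\<lambda>_ _. None)"
      unfolding borel_pcoloring_def
    proof (intro ballI allI)
      fix k :: "nat option"
      show "{x \<in> X. None = k} \<in> sets M" using X_sets by (cases k) auto
    qed
    ultimately show ?case by blast
  next
    case (insert p P)
    then obtain c where c: "pcoloring \<Sigma> d c" "borel_pcoloring c" "\<forall>(i, \<gamma>)\<in>P. \<forall>x\<in>A i. c x (act \<gamma> x) \<noteq> None" by blast
    obtain i \<gamma> where p: "p = (i, \<gamma>)" by (cases p)
    then have \<gamma>: "\<gamma> \<in> S" using insert by blast
    have Ai: "A i \<in> sets M" "indep (word_ball (2 * s) - {\<one>}) (A i)" using A unfolding K_def by auto
    obtain c' where c': "pcoloring \<Sigma> d c'" "borel_pcoloring c'" "\<forall>x y. c x y \<noteq> None \<longrightarrow> c' x y \<noteq> None"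
      "\<forall>x\<in>A i. c' x (act \<gamma> x) \<noteq> None"
      using augment_separated[OF s c(1,2) Ai \<gamma>] by blast
    have "\<forall>(i, \<gamma>)\<in>insert p P. \<forall>x\<in>A i. c' x (act \<gamma> x) \<noteq> None"
      using c(3) c'(3,4) p by fast
    then show ?case using c'(1,2) by blast
  qed
  from this[of "{..<N} \<times> S"] obtain c where c: "pcoloring \<Sigma> d c" "borel_pcoloring c"
    "\<forall>(i, \<gamma>)\<in>{..<N} \<times> S. \<forall>x\<in>A i. c x (act \<gamma> x) \<noteq> None"
    using finite_gens by auto
  have "c x y \<noteq> None" if xy: "(x, y) \<in> \<Sigma>" for x y
  proof -
    obtain \<gamma> where \<gamma>: "x \<in> X" "\<gamma> \<in> S" "y = act \<gamma> x" using xy by (auto simp: shift_graph_iff)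
    then obtain i where "i < N" "x \<in> A i" using A(3) by blast
    then show ?thesis using c(3) \<gamma> by blast
  qed
  then show ?thesis using that[OF c(1,2)] by blast
qed

theorem ex_borel_edge_coloring:
  assumes "card (ends \<Gamma>) = 2"
  shows "\<exists>c. borel_edge_coloring M \<Sigma> (d + 1) c"
proof -
  obtain c where c: "pcoloring \<Sigma> d c" "borel_pcoloring c" and tot: "\<forall>(x, y)\<in>\<Sigma>. c x y \<noteq> None"
    by (rule ex_total_coloring[OF assms])
  \<comment> \<open>The color of an unordered edge; symmetry of \<open>c\<close> makes the choice
    unique on edges.\<close>
  define f where "f e = (SOME k. \<exists>x y. e = {x, y} \<and> c x y = Some k)" for e
  have f: "c x y = Some (f {x, y})" if xy: "(x, y) \<in> \<Sigma>" for x y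
  proof -
    obtain k where k: "c x y = Some k" using tot xy by blast
    have "l = k" if "{x, y} = {u, v}" "c u v = Some l" for u v l
    proof -
      from that(1) have "u = x \<and> v = y \<or> u = y \<and> v = x" by (auto simp: doubleton_eq_iff)
      then have "c x y = Some l" using that(2) pcoloring_symD[OF c(1)] by blast
      then show ?thesis using k by simp
    qed
    then have "f {x, y} = k" unfolding f_def using k by (intro some_equality) blast+
    then show ?thesis using k by simp
  qed
  have "edge_coloring \<Sigma> (d + 1) f"
    unfolding edge_coloring_def
  proof (intro conjI ballI impI)
    fix e assume "e \<in> edges \<Sigma>"
    then obtain x y where e: "e = {x, y}" "(x, y) \<in> \<Sigma>" by (auto simp: edges_def)
    show "f e < d + 1" using pcoloring_le[OF c(1), OF f[OF e(2)]] e(1) by simp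
  next
    fix e e' assume "e \<in> edges \<Sigma>" "e' \<in> edges \<Sigma>" and ne: "e \<noteq> e' \<and> e \<inter> e' \<noteq> {}"
    then obtain x y x' y' where e: "e = {x, y}" "(x, y) \<in> \<Sigma>" "e' = {x', y'}" "(x', y') \<in> \<Sigma>"
      by (auto simp: edges_def)
    then have sym: "(y, x) \<in> \<Sigma>" "(y', x') \<in> \<Sigma>" using sym_shift_graph by (auto dest: symD)
    obtain z where z: "z \<in> e" "z \<in> e'" using ne by blast
    obtain u where u: "e = {z, u}" "(z, u) \<in> \<Sigma>" using e sym z by auto
    obtain u' where u': "e' = {z, u'}" "(z, u') \<in> \<Sigma>" using e sym z by auto
    show "f e \<noteq> f e'"
    proof
      assume "f e = f e'"
      then have "u = u'" using pcoloring_inj[OF c(1), OF f[OF u(2)]] f[OF u'(2)] u(1) u'(1) by simp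
      then show False using ne u u' by simp
    qed
  qed
  moreover have "(\<lambda>(x, y). f {x, y}) \<in> measurable (restrict_space (M \<Otimes>\<^sub>M M) \<Sigma>) (count_space {..<d + 1})"
  proof -
    let ?P = "M \<Otimes>\<^sub>M M"
    have sub: "\<Sigma> \<inter> space ?P \<in> sets ?P" using shift_graph_borel by (intro sets.Int) auto
    have sp: "space (restrict_space ?P \<Sigma>) = \<Sigma>"
      using sets.sets_into_space[OF shift_graph_borel] by (auto simp: space_restrict_space)
    have coord: "(\<lambda>x. x \<delta>) \<in> measurable M (count_space UNIV)" if "\<delta> \<in> carrier G" for \<delta>
      by (rule measurable_coordinate[OF that])
    have graph: "{p \<in> space ?P. \<forall>\<delta>\<in>carrier G. snd p \<delta> = fst p (inv \<gamma> \<otimes> \<delta>)} \<in> sets ?P" if \<gamma>: "\<gamma> \<in> S" for \<gamma>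
    proof (intro sets.sets_Collect_countable_All' countable_carrier)
      fix \<delta> assume \<delta>: "\<delta> \<in> carrier G"
      have cl: "inv \<gamma> \<otimes> \<delta> \<in> carrier G" using \<delta> gen_carrier[OF \<gamma>] by auto
      have [measurable]: "Measurable.pred ?P (\<lambda>p. snd p \<delta>)" "Measurable.pred ?P (\<lambda>p. fst p (inv \<gamma> \<otimes> \<delta>))"
        using measurable_compose[OF measurable_snd coord[OF \<delta>]]
          measurable_compose[OF measurable_fst coord[OF cl]] by auto
      show "{p \<in> space ?P. snd p \<delta> = fst p (inv \<gamma> \<otimes> \<delta>)} \<in> sets ?P" by measurable
    qed
    have gr: "(\<forall>\<delta>\<in>carrier G. snd p \<delta> = fst p (inv \<gamma> \<otimes> \<delta>)) \<longleftrightarrow> snd p = act \<gamma> (fst p)" if "p \<in> space ?P" for p \<gamma>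
    proof -
      have "snd p \<in> X" using that by (auto simp: space_pair_measure space_free_part_space)
      then show ?thesis using shift_eq_iff[OF X_topspace, of "snd p" \<gamma> "fst p"] by simp
    qed
    show ?thesis
    proof (subst measurable_count_space_eq2, simp, intro conjI ballI)
      show "(\<lambda>(x, y). f {x, y}) \<in> space (restrict_space ?P \<Sigma>) \<rightarrow> {..<d + 1}"
      proof (rule funcsetI)
        fix p assume "p \<in> space (restrict_space ?P \<Sigma>)"
        then have p: "(fst p, snd p) \<in> \<Sigma>" unfolding sp by simp
        show "(\<lambda>(x, y). f {x, y}) p \<in> {..<d + 1}"
          using pcoloring_le[OF c(1), OF f[OF p]] by (simp add: case_prod_beta)
      qed
      fix k :: nat
      \<comment> \<open>The fibre over \<open>k\<close> is split by generators: the graph of the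
        action of \<gamma>, given by countably many coordinate conditions, meets a Borel condition
        on the first component.\<close>
      let ?Q = "\<lambda>\<gamma>. {p \<in> space ?P. \<forall>\<delta>\<in>carrier G. snd p \<delta> = fst p (inv \<gamma> \<otimes> \<delta>)} \<inter>
          (fst -` {x \<in> X. c x (act \<gamma> x) = Some k} \<inter> space ?P)"
      have "?Q \<gamma> \<in> sets ?P" if "\<gamma> \<in> S" for \<gamma>
        by (intro sets.Int graph[OF that] measurable_sets[OF measurable_fst]) (use c(2) that in \<open>auto simp: borel_pcoloring_def\<close>)
      then have "(\<Union>\<gamma>\<in>S. ?Q \<gamma>) \<in> sets ?P" using finite_gens by (intro sets.finite_UN) auto
      moreover have "(\<lambda>(x, y). f {x, y}) -` {k} \<inter> space (restrict_space ?P \<Sigma>) = (\<Union>\<gamma>\<in>S. ?Q \<gamma>)"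
      proof (intro equalityI subsetI)
        fix p assume p: "p \<in> (\<lambda>(x, y). f {x, y}) -` {k} \<inter> space (restrict_space ?P \<Sigma>)"
        then have e: "(fst p, snd p) \<in> \<Sigma>" "f {fst p, snd p} = k" unfolding sp by (auto simp: case_prod_beta)
        then have ps: "p \<in> space ?P" using sets.sets_into_space[OF shift_graph_borel] by auto
        obtain \<gamma> where \<gamma>: "fst p \<in> X" "\<gamma> \<in> S" "snd p = act \<gamma> (fst p)" using e(1)[unfolded shift_graph_iff] by blast
        have "p \<in> ?Q \<gamma>" using ps gr[OF ps, of \<gamma>] \<gamma> f[OF e(1)] e(2) by simp
        then show "p \<in> (\<Union>\<gamma>\<in>S. ?Q \<gamma>)" using \<gamma>(2) by blast
      next
        fix p assume "p \<in> (\<Union>\<gamma>\<in>S. ?Q \<gamma>)"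
        then obtain \<gamma> where \<gamma>: "\<gamma> \<in> S" "p \<in> ?Q \<gamma>" by blast
        then have ps: "p \<in> space ?P" and x: "fst p \<in> X" "c (fst p) (act \<gamma> (fst p)) = Some k" by auto
        have y: "snd p = act \<gamma> (fst p)" using gr[OF ps, of \<gamma>] \<gamma>(2) by blast
        then have e: "(fst p, snd p) \<in> \<Sigma>" using x \<gamma>(1) by (auto simp: shift_graph_iff)
        then have "f {fst p, snd p} = k" using f[OF e] x(2) y by simp
        then show "p \<in> (\<lambda>(x, y). f {x, y}) -` {k} \<inter> space (restrict_space ?P \<Sigma>)"
          using e unfolding sp by (simp add: case_prod_beta)
      qed
      ultimately have "(\<lambda>(x, y). f {x, y}) -` {k} \<inter> space (restrict_space ?P \<Sigma>) \<in> sets ?P" by simp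
      then show "(\<lambda>(x, y). f {x, y}) -` {k} \<inter> space (restrict_space ?P \<Sigma>) \<in> sets (restrict_space ?P \<Sigma>)"
        unfolding sets_restrict_space_iff[OF sub] sp by simp
    qed
  qed
  ultimately show ?thesis unfolding borel_edge_coloring_def by blast
qed

end

theorem theorem1:
  fixes G :: "('a, 'b) monoid_scheme" and S :: "'a set" and d :: nat
  assumes "marked_group G S"
    and "card S = d"
    and "card (ends (cayley_graph G S)) = 2"
  shows "borel_edge_chromatic_number (free_part_space G) (shift_graph G S) \<le> enat (d + 1)"
  unfolding borel_edge_chromatic_number_le_iff
  using marked_group.ex_borel_edge_coloring[OF assms(1,3)] assms(2) by simp
end
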